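(* The following spaces are all $\sigma$-homeomorphic to each other: (1) the $\omega$-left-CEA space $\omega\mathbf{CEA}$; (2) Rubin–Schori–Walsh's totally disconnected strongly infinite dimensional space $\mathbf{RSW}$; (3) Roman Pol's counterexample $\mathbf{RP}$ to Alexandrov's problem.
   Context: A function $f:X\to Y$ between topological spaces is $\sigma$-continuous if $X=\bigcup_{n\in\mathbb N}X_n$ for some sets $X_n$ with each $f|_{X_n}$ continuous. A $\sigma$-homeomorphism is a bijection $f$ with $f$ and $f^{-1}$ $\sigma$-continuous. The space $\omega\mathbf{CEA}$. For $k\in\mathbb N$ let $(B^k_i)_{i\in\mathbb N}$ be a standard effective enumeration of the rational open balls of $\{0,1\}^{\mathbb N}\times[0,1]^k$. For a c.e. set $W\subseteq\mathbb N\times\mathbb Q$ and $z\in\{0,1\}^{\mathbb N}\times[0,1]^k$ let $J^k_W(z)=\sup\{\min\{|q|,1\}: z\in B^k_i\text{ for some }(i,q)\in W\}$ (with $\sup\emptyset=0$). Let $((W_{e,k})_{k\in\mathbb N})_{e\in\mathbb N}$ be a standard effective enumeration of all uniformly c.e. sequences of subsets of $\mathbb N\times\mathbb Q$. Put $J^\omega_e(x)=(r_0,r_1,\dots)$ with $r_k=J^k_{W_{e,k}}(x,r_0,\dots,r_{k-1})$. Then $\omega\mathbf{CEA}=\{(e,x,r)\in\mathbb N\times\{0,1\}^{\mathbb N}\times[0,1]^{\mathbb N}: r=J^\omega_e(x)\}$. The space $\mathbf{RSW}$. Let $\pi_n:[0,1]^{\mathbb N}\to[0,1]$ be the $n$-th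 projection. For a nonempty compact $P\subseteq[0,1]^{\mathbb N}$, its leftmost point $\min P\in P$ is defined inductively by $\pi_n(\min P)=\min\pi_n[\{z\in P:(\forall i<n)\ \pi_i(z)=\pi_i(\min P)\}]$. A continuum is a connected compact metric space. Let $S$ be the closed subspace, in the hyperspace of subcontinua of $[0,1]^{\mathbb N}$ with the Vietoris topology, of all continua meeting both $\pi_0^{-1}\{0\}$ and $\pi_0^{-1}\{1\}$. Represent the hyperspace by the usual positive-and-negative representation, and fix a total Cantor representation of $S$, i.e. a continuous surjection $\delta$ from the Cantor set $C\subseteq[0,1]$ onto $S$ which is an admissible representation of $S$ (every continuous map from a subset of $\mathbb N^{\mathbb N}$ to $S$ factors continuously through $\delta$). Then $$\mathbf{RSW}=\{\min(\delta(p)^{[p]}):p\in C\},\qquad A^{[p]}=A\cap\pi_0^{-1}\{p\}.$$ The space $\mathbf{RP}$ is a Lelek compactification of $\mathbf{RSW}$: a compact metrizable space containing $\mathbf{RSW}$ as a dense subspace such that $\mathbf{RP}\setminus\mathbf{RSW}$ is countable dimensional (a countable union of finite dimensional subspaces). *)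

theory Defs
  imports "HOL-Analysis.Analysis" "HOL-Library.Nat_Bijection" "HOL-Library.Countable"
begin

section \<open>Sigma-continuity and sigma-homeomorphisms\<close>

definition sigma_continuous_map ::
    "'a topology \<Rightarrow> 'b topology \<Rightarrow> ('a \<Rightarrow> 'b) \<Rightarrow> bool" where
  "sigma_continuous_map X Y f \<longleftrightarrow>
     f \<in> topspace X \<rightarrow> topspace Y \<and>
     (\<exists>F :: nat \<Rightarrow> 'a set. topspace X = (\<Union>n. F n) \<and>
        (\<forall>n. continuous_map (subtopology X (F n)) Y f))"

definition sigma_homeomorphic_map ::
    "'a topology \<Rightarrow> 'b topology \<Rightarrow> ('a \<Rightarrow> 'b) \<Rightarrow> bool" where
  "sigma_homeomorphic_map X Y f \<longleftrightarrow>
     bij_betw f (topspace X) (topspace Y) \<and>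
     sigma_continuous_map X Y f \<and>
     sigma_continuous_map Y X (inv_into (topspace X) f)"

definition sigma_homeomorphic_space :: "'a topology \<Rightarrow> 'b topology \<Rightarrow> bool" where
  "sigma_homeomorphic_space X Y \<longleftrightarrow> (\<exists>f. sigma_homeomorphic_map X Y f)"

section \<open>Computable functions and c.e. sets\<close>

text \<open>Programs for the partial recursive functions, with big-step semantics:
  \<open>computes f xs y\<close> says that \<open>f\<close> halts on the argument list \<open>xs\<close> with output \<open>y\<close>.\<close>

datatype recf =
    Zero
  | Succ
  | Proj nat
  | Comp recf "recf list"
  | PrimRec recf recf
  | Mu recf

inductive computes :: "recf \<Rightarrow> nat list \<Rightarrow> nat \<Rightarrow> bool" where
  zero: "computes Zero xs 0"
| succ: "computes Succ [x] (Suc x)"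
| proj: "i < length xs \<Longrightarrow> computes (Proj i) xs (xs ! i)"
| comp: "list_all2 (\<lambda>g y. computes g xs y) gs ys \<Longrightarrow> computes f ys z
    \<Longrightarrow> computes (Comp f gs) xs z"
| prim_rec_0: "computes f xs y \<Longrightarrow> computes (PrimRec f g) (0 # xs) y"
| prim_rec_Suc: "computes (PrimRec f g) (n # xs) y \<Longrightarrow> computes g (n # y # xs) z
    \<Longrightarrow> computes (PrimRec f g) (Suc n # xs) z"
| mu: "computes f (n # xs) 0 \<Longrightarrow> (\<forall>m<n. \<exists>y. computes f (m # xs) (Suc y))
    \<Longrightarrow> computes (Mu f) xs n"

definition halts :: "recf \<Rightarrow> nat list \<Rightarrow> bool" where
  "halts f xs \<longleftrightarrow> (\<exists>y. computes f xs y)"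

definition computable_fun :: "(nat \<Rightarrow> nat) \<Rightarrow> bool" where
  "computable_fun s \<longleftrightarrow> (\<exists>f. \<forall>n. computes f [n] (s n))"

text \<open>Rationals are coded by the surjection \<^const>\<open>nat_to_rat_surj\<close>
  (numerator and denominator via \<^const>\<open>prod_decode\<close> and \<^const>\<open>int_decode\<close>). Equality of
  coded rationals is decidable, so a set of pairs is c.e. iff its set of codes is.\<close>

definition uniformly_ce :: "(nat \<Rightarrow> (nat \<times> rat) set) \<Rightarrow> bool" where
  "uniformly_ce V \<longleftrightarrow>
     (\<exists>f. \<forall>k i m. (i, nat_to_rat_surj m) \<in> V k \<longleftrightarrow> halts f [k, i, m])"

definition uniformly_ce2 :: "(nat \<Rightarrow> nat \<Rightarrow> (nat \<times> rat) set) \<Rightarrow> bool" where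
  "uniformly_ce2 V \<longleftrightarrow>
     (\<exists>f. \<forall>e k i m. (i, nat_to_rat_surj m) \<in> V e k \<longleftrightarrow> halts f [e, k, i, m])"

text \<open>A standard effective enumeration of all uniformly c.e. sequences: it is itself uniformly
  c.e., it lists exactly the uniformly c.e. sequences, and it is acceptable, i.e. every
  uniformly c.e. family of such sequences reduces to it by a computable translation of indices.\<close>

definition standard_ce_enumeration :: "(nat \<Rightarrow> nat \<Rightarrow> (nat \<times> rat) set) \<Rightarrow> bool" where
  "standard_ce_enumeration W \<longleftrightarrow>
     uniformly_ce2 W \<and>
     range W = {V. uniformly_ce V} \<and>
     (\<forall>V. uniformly_ce2 V \<longrightarrow> (\<exists>s. computable_fun s \<and> (\<forall>e. V e = W (s e))))"

section \<open>The omega-left-CEA space\<close>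

text \<open>Cantor space is \<^typ>\<open>nat \<Rightarrow> bool\<close> with its product topology, and \<open>[0,1]\<close> to the power
  \<open>k\<close> consists of the lists of length \<open>k\<close> over \<open>[0,1]\<close>. Rational balls are taken with
  respect to the maximum of the usual metrics on the factors.\<close>

definition cantor_dist :: "(nat \<Rightarrow> bool) \<Rightarrow> (nat \<Rightarrow> bool) \<Rightarrow> real" where
  "cantor_dist x y = (if x = y then 0 else (1/2) ^ (LEAST n. x n \<noteq> y n))"

definition open_ball ::
    "nat \<Rightarrow> (nat \<Rightarrow> bool) \<Rightarrow> (nat \<Rightarrow> real) \<Rightarrow> real \<Rightarrow> ((nat \<Rightarrow> bool) \<times> real list) set" where
  "open_ball k c a \<rho> =
     {(x, z). length z = k \<and> set z \<subseteq> {0..1} \<and>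
        cantor_dist x c < \<rho> \<and> (\<forall>j<k. \<bar>z ! j - a j\<bar> < \<rho>)}"

text \<open>The center in Cantor space is a finite binary word followed by zeros; the other center
  coordinates are rationals truncated to \<open>[0,1]\<close> (0 if the coded list is too short); the radius is
  a positive rational.\<close>

definition cantor_center :: "nat list \<Rightarrow> nat \<Rightarrow> bool" where
  "cantor_center u n \<longleftrightarrow> n < length u \<and> odd (u ! n)"

definition cube_center :: "nat list \<Rightarrow> nat \<Rightarrow> real" where
  "cube_center v j =
     (if j < length v then max 0 (min 1 (real_of_rat (nat_to_rat_surj (v ! j)))) else 0)"

definition rational_ball :: "nat \<Rightarrow> nat \<Rightarrow> ((nat \<Rightarrow> bool) \<times> real list) set" where
  "rational_ball k i =
     (let (a, b) = prod_decode i; (c, d) = prod_decode b; (m, n) = prod_decode d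
      in open_ball k (cantor_center (list_decode a)) (cube_center (list_decode c))
           (real (Suc m) / real (Suc n)))"

text \<open>All values are nonnegative, so inserting 0 only serves to make the supremum of the
  empty set 0.\<close>

definition J :: "nat \<Rightarrow> (nat \<times> rat) set \<Rightarrow> (nat \<Rightarrow> bool) \<times> real list \<Rightarrow> real" where
  "J k V z = Sup (insert 0 {min \<bar>real_of_rat q\<bar> 1 | i q. (i, q) \<in> V \<and> z \<in> rational_ball k i})"

fun J_omega :: "(nat \<Rightarrow> (nat \<times> rat) set) \<Rightarrow> (nat \<Rightarrow> bool) \<Rightarrow> nat \<Rightarrow> real" where
  "J_omega V x k = J k (V k) (x, map (\<lambda>j. J_omega V x j) [0..<k])"

declare J_omega.simps [simp del]

definition hilbert_cube :: "(nat \<Rightarrow> real) set" where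
  "hilbert_cube = UNIV \<rightarrow> {0..1}"

definition omega_CEA ::
    "(nat \<Rightarrow> nat \<Rightarrow> (nat \<times> rat) set) \<Rightarrow> (nat \<times> (nat \<Rightarrow> bool) \<times> (nat \<Rightarrow> real)) set" where
  "omega_CEA W = {(e, x, r). r \<in> hilbert_cube \<and> r = J_omega (W e) x}"

section \<open>The Rubin--Schori--Walsh space\<close>

fun leftmost :: "(nat \<Rightarrow> real) set \<Rightarrow> nat \<Rightarrow> real" where
  "leftmost P n = (LEAST t. t \<in> (\<lambda>z. z n) ` {z \<in> P. \<forall>i<n. z i = leftmost P i})"

declare leftmost.simps [simp del]

definition subcontinua :: "'a topology \<Rightarrow> 'a set set" where
  "subcontinua X = {K. K \<noteq> {} \<and> compactin X K \<and> connectedin X K}"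

definition vietoris_subcontinua :: "'a topology \<Rightarrow> 'a set topology" where
  "vietoris_subcontinua X = topology_generated_by
     ({{K \<in> subcontinua X. K \<subseteq> U} | U. openin X U} \<union>
      {{K \<in> subcontinua X. K \<inter> U \<noteq> {}} | U. openin X U})"

definition crossing_continua :: "(nat \<Rightarrow> real) set topology" where
  "crossing_continua = subtopology (vietoris_subcontinua (top_of_set hilbert_cube))
     {K. (\<exists>z\<in>K. z 0 = 0) \<and> (\<exists>z\<in>K. z 0 = 1)}"

definition cantor_set :: "real set" where
  "cantor_set = range (\<lambda>x :: nat \<Rightarrow> bool. \<Sum>n. (if x n then 2 else 0) / 3 ^ Suc n)"

text \<open>Baire space is \<^typ>\<open>nat \<Rightarrow> nat\<close> with its product topology.\<close>

definition total_cantor_representation :: "'a topology \<Rightarrow> (real \<Rightarrow> 'a) \<Rightarrow> bool" where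
  "total_cantor_representation S \<delta> \<longleftrightarrow>
     continuous_map (top_of_set cantor_set) S \<delta> \<and>
     \<delta> ` cantor_set = topspace S \<and>
     (\<forall>(D :: (nat \<Rightarrow> nat) set) f. continuous_map (top_of_set D) S f \<longrightarrow>
        (\<exists>g. continuous_map (top_of_set D) (top_of_set cantor_set) g \<and>
             (\<forall>d\<in>D. f d = \<delta> (g d))))"

definition RSW :: "(real \<Rightarrow> (nat \<Rightarrow> real) set) \<Rightarrow> (nat \<Rightarrow> real) set" where
  "RSW \<delta> = {leftmost (\<delta> p \<inter> {z. z 0 = p}) | p. p \<in> cantor_set}"

section \<open>Lelek compactifications\<close>

definition finite_dimensional_space :: "'a topology \<Rightarrow> bool" where
  "finite_dimensional_space X \<longleftrightarrow> (\<exists>d. X dim_le d)"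

definition countable_dimensional_space :: "'a topology \<Rightarrow> bool" where
  "countable_dimensional_space X \<longleftrightarrow>
     (\<exists>F :: nat \<Rightarrow> 'a set. topspace X = (\<Union>n. F n) \<and>
        (\<forall>n. finite_dimensional_space (subtopology X (F n))))"

text \<open>The space \<open>Y\<close> is regarded as a subspace of \<open>X\<close> along the embedding \<open>\<iota>\<close>.\<close>

definition lelek_compactification :: "'a topology \<Rightarrow> 'b topology \<Rightarrow> ('a \<Rightarrow> 'b) \<Rightarrow> bool" where
  "lelek_compactification Y X \<iota> \<longleftrightarrow>
     compact_space X \<and> metrizable_space X \<and>
     embedding_map Y X \<iota> \<and>
     X closure_of (\<iota> ` topspace Y) = topspace X \<and>
     countable_dimensional_space (subtopology X (topspace X - \<iota> ` topspace Y))"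

end

theory Submission
  imports Defs
begin

text \<open>Sigma-continuity is insensitive to cutting the domain into countably many arbitrary pieces, so by the
  Schroeder--Bernstein argument it is enough to find injections in both directions that are
  embeddings on countably many pieces.

  From \<open>omega_CEA\<close> to \<open>RSW\<close>: for fixed \<open>e\<close> the points above the lower semicontinuous functions \<open>J\<close> form, for
  every \<open>x\<close>, a compact connected set with leftmost point \<open>J_omega (W e) x\<close>. It does not depend
  continuously on \<open>x\<close>, but it is the section over the points of the Cantor set in a continuum whose
  sections over the gaps use continuous approximations to \<open>J\<close> from below, the better the closer
  to the Cantor set; this continuum does depend continuously on \<open>x\<close>. As all sections over the Cantor
  set agree, the index of the continuum in the representation \<open>\<delta>\<close> is irrelevant.

  From \<open>RSW\<close> to \<open>omega_CEA\<close>: the coordinates of the leftmost point of \<open>\<delta> p\<close> over \<open>p\<close> are lower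
  semicontinuous functions of \<open>p\<close> and the previous coordinates. A sequence of bits depending continuously
  on \<open>p\<close> lists lower bounds on rational cells, and one c.e. set reads off the coordinates.

  From \<open>RP\<close> to \<open>RSW\<close>: the remainder is a countable union of subspaces of the Cantor space, and these are
  absorbed by a copy of the Cantor space inside \<open>RSW\<close>.\<close>

section \<open>Sigma-embeddings\<close>

text \<open>In the direction towards \<open>RSW \<delta>\<close> the obstacle is circular: a point
  of \<open>RSW \<delta>\<close> lies over the very name \<open>p\<close> of its continuum, and
  admissibility yields names depending continuously on \<open>x\<close> without any choice of their
  values. Hence coordinate 0 is left to the name, coordinate 1 carries a Cantor code of
  \<open>e\<close> and \<open>x\<close> from which they can be read back, and the values of
  \<open>J_omega\<close> start at coordinate 2. A second difficulty is that a small change of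
  \<open>x\<close> moves \<open>r 0\<close>, which moves the thresholds for \<open>r 1\<close>, and
  so on. At distance \<open>h\<close> from the Cantor set each stage can enlarge the error by the
  factor \<open>1/h\<close>; shifting coordinate \<open>k\<close> by \<open>e / h ^ Suc k\<close>
  absorbs all of it. In the other direction \<open>\<delta>\<close> comes with no effectivity, so
  everything specific to it goes into the Cantor space coordinate, used as an oracle. A rational
  ball sees only finitely many bits and an approximate position: it must be small enough to certify
  bit \<open>t\<close> and to stay within the cell that command \<open>t\<close> speaks about. Both
  follow from a radius of at most \<open>2 ^ -t\<close>, because the mesh of the grid named by
  \<open>t\<close> is never smaller than that.\<close>

text \<open>Injectivity is global, the topology is controlled only piece by piece. A countable
  family instead of a sequence lets covers be indexed by products and sums without recoding.\<close>

definition sigma_embedding :: "'a topology \<Rightarrow> 'b topology \<Rightarrow> ('a \<Rightarrow> 'b) \<Rightarrow> bool" where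
  "sigma_embedding X Y f \<longleftrightarrow> inj_on f (topspace X) \<and> f ` topspace X \<subseteq> topspace Y \<and>
     (\<exists>\<F>. countable \<F> \<and> \<Union>\<F> = topspace X \<and> (\<forall>A\<in>\<F>. embedding_map (subtopology X A) Y f))"

lemma embedding_map_image_subset: "embedding_map X Y f \<Longrightarrow> f ` topspace X \<subseteq> topspace Y"
  by (metis embedding_map_def homeomorphic_imp_surjective_map inf.cobounded1 topspace_subtopology)

lemma embedding_map_left_inverse:
  assumes f: "continuous_map X Y f"
    and g: "continuous_map (subtopology Y (f ` topspace X)) X g"
    and gf: "\<And>x. x \<in> topspace X \<Longrightarrow> g (f x) = x"
  shows "embedding_map X Y f"
  unfolding embedding_map_def homeomorphic_map_maps homeomorphic_maps_def
  using assms by (intro exI[of _ g]) (auto simp: continuous_map_in_subtopology)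

lemma embedding_map_inverse:
  assumes "embedding_map X Y f"
  obtains g where "continuous_map (subtopology Y (f ` topspace X)) X g"
    and "\<And>x. x \<in> topspace X \<Longrightarrow> g (f x) = x"
  using assms unfolding embedding_map_def homeomorphic_map_maps homeomorphic_maps_def by blast

lemma embedding_map_subtopology:
  assumes "embedding_map X Y f"
  shows "embedding_map (subtopology X A) Y f"
proof -
  obtain g where g: "continuous_map (subtopology Y (f ` topspace X)) X g"
    and gf: "\<And>x. x \<in> topspace X \<Longrightarrow> g (f x) = x"
    using embedding_map_inverse[OF assms] by metis
  have f: "continuous_map X Y f"
    using assms homeomorphic_imp_continuous_map[of X "subtopology Y (f ` topspace X)" f]
    by (auto simp: embedding_map_def continuous_map_in_subtopology)
  show ?thesis
  proof (rule embedding_map_left_inverse)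
    show "continuous_map (subtopology X A) Y f"
      using f by (rule continuous_map_from_subtopology)
    have "continuous_map (subtopology Y (f ` (topspace X \<inter> A))) X g"
      using g by (rule continuous_map_from_subtopology_mono) blast
    then show "continuous_map (subtopology Y (f ` topspace (subtopology X A))) (subtopology X A) g"
      using gf by (auto simp: continuous_map_in_subtopology)
  qed (use gf in auto)
qed

lemma embedding_map_inj_on: "embedding_map X Y f \<Longrightarrow> inj_on f (topspace X)"
  by (simp add: embedding_map_def homeomorphic_eq_everything_map)

lemma embedding_imp_sigma_embedding: "embedding_map X Y f \<Longrightarrow> sigma_embedding X Y f"
  unfolding sigma_embedding_def
  by (intro conjI exI[of _ "{topspace X}"]) (auto dest: embedding_map_inj_on embedding_map_image_subset)

lemma sigma_embedding_countable_cover: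
  assumes "inj_on f (topspace X)" "countable I" "(\<Union>i\<in>I. A i) = topspace X"
    and "\<And>i. i \<in> I \<Longrightarrow> embedding_map (subtopology X (A i)) Y f"
  shows "sigma_embedding X Y f"
  unfolding sigma_embedding_def
proof (intro conjI exI[of _ "A ` I"])
  show "f ` topspace X \<subseteq> topspace Y"
  proof clarify
    fix x assume x: "x \<in> topspace X"
    then obtain i where i: "i \<in> I" "x \<in> A i" using assms(3) by blast
    show "f x \<in> topspace Y"
      using embedding_map_image_subset[OF assms(4)[OF i(1)]] i x by auto
  qed
qed (use assms in auto)

lemma sigma_embedding_compose:
  assumes f: "sigma_embedding X Y f" and g: "sigma_embedding Y Z g"
  shows "sigma_embedding X Z (g \<circ> f)"
proof -
  obtain \<F> where F: "countable \<F>" "\<Union>\<F> = topspace X" "\<And>A. A \<in> \<F> \<Longrightarrow> embedding_map (subtopology X A) Y f"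
    using f unfolding sigma_embedding_def by blast
  obtain \<G> where G: "countable \<G>" "\<Union>\<G> = topspace Y" "\<And>A. A \<in> \<G> \<Longrightarrow> embedding_map (subtopology Y A) Z g"
    using g unfolding sigma_embedding_def by blast
  have inj: "inj_on f (topspace X)" "f ` topspace X \<subseteq> topspace Y" "inj_on g (topspace Y)"
    using f g unfolding sigma_embedding_def by auto
  show ?thesis
  proof (rule sigma_embedding_countable_cover[where I = "\<F> \<times> \<G>" and A = "\<lambda>(A, B). A \<inter> f -` B"])
    show "inj_on (g \<circ> f) (topspace X)"
      using inj by (intro comp_inj_on) (auto intro: inj_on_subset)
    show "countable (\<F> \<times> \<G>)" using F G by auto
    show "(\<Union>i\<in>\<F> \<times> \<G>. case i of (A, B) \<Rightarrow> A \<inter> f -` B) = topspace X"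
      using F(2) G(2) inj(2) by fastforce
    fix i assume "i \<in> \<F> \<times> \<G>"
    then obtain A B where i: "i = (A, B)" "A \<in> \<F>" "B \<in> \<G>" by auto
    have "embedding_map (subtopology X (A \<inter> f -` B)) (subtopology Y B) f"
      using embedding_map_subtopology[OF F(3)[OF i(2)], of "f -` B"]
      by (auto simp: embedding_map_in_subtopology subtopology_subtopology)
    then show "embedding_map (subtopology X (case i of (A, B) \<Rightarrow> A \<inter> f -` B)) Z (g \<circ> f)"
      using G(3)[OF i(3)] i(1) by (auto intro: embedding_map_compose)
  qed
qed

text \<open>Adding the empty set makes the family nonempty, so that it is the range of a
  sequence.\<close>

lemma countable_cover_sequence:
  assumes "countable \<F>" "\<Union>\<F> = S" "\<forall>A\<in>\<F>. P A" "P {}"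
  obtains F :: "nat \<Rightarrow> 'a set" where "S = (\<Union>n. F n)" "\<forall>n. P (F n)"
proof
  have r: "range (from_nat_into (insert {} \<F>)) = insert {} \<F>"
    using assms(1) by (intro range_from_nat_into) auto
  show "S = (\<Union>n. from_nat_into (insert {} \<F>) n)"
    using r assms(2) by auto
  show "\<forall>n. P (from_nat_into (insert {} \<F>) n)"
  proof
    fix n
    have "from_nat_into (insert {} \<F>) n \<in> insert {} \<F>" using r by (metis rangeI)
    then show "P (from_nat_into (insert {} \<F>) n)" using assms(3,4) by auto
  qed
qed

lemma sigma_continuous_map_countable_cover:
  assumes "f ` topspace X \<subseteq> topspace Y" "countable \<F>" "\<Union>\<F> = topspace X"
    and "\<And>A. A \<in> \<F> \<Longrightarrow> continuous_map (subtopology X A) Y f"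
  shows "sigma_continuous_map X Y f"
proof -
  obtain F :: "nat \<Rightarrow> _ set" where "topspace X = (\<Union>n. F n)" "\<forall>n. continuous_map (subtopology X (F n)) Y f"
    by (rule countable_cover_sequence[OF assms(2,3), where P = "\<lambda>A. continuous_map (subtopology X A) Y f"])
       (use assms(4) in auto)
  then show ?thesis
    unfolding sigma_continuous_map_def using assms(1) by blast
qed

lemma continuous_map_piece:
  assumes "embedding_map (subtopology X A) Y f" "B \<subseteq> A"
  shows "continuous_map (subtopology X B) Y f"
proof -
  have "embedding_map (subtopology (subtopology X A) B) Y f"
    using assms(1) by (rule embedding_map_subtopology)
  then have "embedding_map (subtopology X B) Y f"
    using assms(2) by (simp add: subtopology_subtopology inf.absorb2)
  then show ?thesis
    by (metis continuous_map_in_subtopology embedding_map_def homeomorphic_imp_continuous_map)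
qed

text \<open>\<open>k\<close> only has to undo \<open>f\<close> on \<open>B\<close>; in the
  Schroeder--Bernstein proof it is a map glued from two different parts.\<close>

lemma continuous_map_piece_inverse:
  assumes emb: "embedding_map (subtopology X A) Y f" and "B \<subseteq> A" "B \<subseteq> topspace X"
    and k: "\<And>x. x \<in> B \<Longrightarrow> k (f x) = x"
  shows "continuous_map (subtopology Y (f ` B)) X k"
proof -
  have "embedding_map (subtopology (subtopology X A) B) Y f"
    using emb by (rule embedding_map_subtopology)
  then have *: "embedding_map (subtopology X B) Y f"
    using assms(2) by (simp add: subtopology_subtopology inf.absorb2)
  have B: "topspace (subtopology X B) = B" using assms(3) by auto
  obtain g where g: "continuous_map (subtopology Y (f ` B)) (subtopology X B) g" "\<And>x. x \<in> B \<Longrightarrow> g (f x) = x"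
    using embedding_map_inverse[OF *] unfolding B by metis
  have "continuous_map (subtopology Y (f ` B)) X g"
    using g(1) continuous_map_in_subtopology by blast
  moreover have "g y = k y" if "y \<in> topspace (subtopology Y (f ` B))" for y
    using that g(2) k by auto
  ultimately show ?thesis by (rule continuous_map_eq)
qed

text \<open>The bijection of Schroeder and Bernstein is a union of a restriction of the first injection
  and a restriction of the inverse of the second one, and sigma-continuity is preserved by cutting
  the domain into two arbitrary pieces.\<close>

theorem sigma_embedding_Schroeder_Bernstein:
  assumes f: "sigma_embedding X Y f" and g: "sigma_embedding Y X g"
  shows "sigma_homeomorphic_space X Y"
proof -
  obtain \<F> where F: "countable \<F>" "\<Union>\<F> = topspace X" "\<And>A. A \<in> \<F> \<Longrightarrow> embedding_map (subtopology X A) Y f"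
    using f unfolding sigma_embedding_def by blast
  obtain \<G> where G: "countable \<G>" "\<Union>\<G> = topspace Y" "\<And>A. A \<in> \<G> \<Longrightarrow> embedding_map (subtopology Y A) X g"
    using g unfolding sigma_embedding_def by blast
  have inj: "inj_on f (topspace X)" "f ` topspace X \<subseteq> topspace Y" "inj_on g (topspace Y)" "g ` topspace Y \<subseteq> topspace X"
    using f g unfolding sigma_embedding_def by auto
  \<comment> \<open>Knaster--Tarski: at a fixed point the part of \<open>X\<close> outside
    \<open>S\<close> is exactly the \<open>g\<close>-image of what \<open>f\<close> leaves uncovered
    in \<open>Y\<close>.\<close>
  define S where "S = lfp (\<lambda>S. topspace X - g ` (topspace Y - f ` S))"
  have "mono (\<lambda>S. topspace X - g ` (topspace Y - f ` S))" by (rule monoI) blast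
  then have S: "S = topspace X - g ` (topspace Y - f ` S)"
    unfolding S_def by (rule lfp_unfold)
  define T where "T = topspace Y - f ` S"
  have SX: "S \<subseteq> topspace X" and XS: "topspace X - S = g ` T"
    using S inj(4) by (auto simp: T_def)
  have TY: "T \<subseteq> topspace Y" by (auto simp: T_def)
  have fS: "f ` S \<subseteq> topspace Y" using SX inj(2) by auto
  define gi where "gi = inv_into (topspace Y) g"
  have gi: "gi (g y) = y" if "y \<in> topspace Y" for y
    using that inj(3) by (simp add: gi_def)
  define h where "h x = (if x \<in> S then f x else gi x)" for x
  have hS: "h ` S = f ` S" by (auto simp: h_def)
  have hT: "h (g y) = y" if "y \<in> T" for y
    using that XS gi unfolding h_def T_def by auto
  have hX: "h ` topspace X = topspace Y"
  proof -
    have "topspace X = S \<union> g ` T" using SX XS by auto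
    moreover have "h ` g ` T = T" using hT by force
    ultimately have "h ` topspace X = f ` S \<union> T" using hS by (metis image_Un)
    then show ?thesis using fS by (auto simp: T_def)
  qed
  have hinj: "inj_on h (topspace X)"
  proof (rule inj_onI)
    fix a b assume ab: "a \<in> topspace X" "b \<in> topspace X" "h a = h b"
    have out: "\<exists>y\<in>T. c = g y \<and> h c = y" if "c \<in> topspace X" "c \<notin> S" for c
      using that XS hT by force
    \<comment> \<open>The value of \<open>h\<close> reveals on which side of the cut its argument
      lies, since \<open>T\<close> avoids the image of \<open>S\<close> under
      \<open>f\<close>.\<close>
    have sep: "h c \<in> f ` S \<longleftrightarrow> c \<in> S" if "c \<in> topspace X" for c
    proof
      show "c \<in> S" if "h c \<in> f ` S"
        using out[OF \<open>c \<in> topspace X\<close>] that by (auto simp: T_def)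
    qed (simp add: h_def)
    show "a = b"
    proof (cases "a \<in> S")
      case True
      then have "b \<in> S" using sep ab by metis
      then show ?thesis using True ab inj(1) SX by (auto simp: h_def inj_on_def)
    next
      case False
      then have "b \<notin> S" using sep ab by metis
      then show ?thesis using False out ab by metis
    qed
  qed
  define k where "k = inv_into (topspace X) h"
  have kh: "k (h x) = x" if "x \<in> topspace X" for x
    using that hinj by (simp add: k_def)
  \<comment> \<open>On pieces inside \<open>S\<close> the map \<open>h\<close> is \<open>f\<close>;
    on the \<open>g\<close>-images of pieces of \<open>T\<close> it is the continuous inverse of
    \<open>g\<close>.\<close>
  have "sigma_continuous_map X Y h"
  proof (rule sigma_continuous_map_countable_cover[where \<F> = "(\<lambda>A. A \<inter> S) ` \<F> \<union> (\<lambda>B. g ` (B \<inter> T)) ` \<G>"])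
    show "\<Union> ((\<lambda>A. A \<inter> S) ` \<F> \<union> (\<lambda>B. g ` (B \<inter> T)) ` \<G>) = topspace X"
    proof -
      have "(\<Union>A\<in>\<F>. A \<inter> S) = \<Union>\<F> \<inter> S" by (rule Int_Union2[symmetric])
      moreover have "(\<Union>B\<in>\<G>. g ` (B \<inter> T)) = g ` (\<Union>\<G> \<inter> T)"
        by (simp only: image_UN Int_Union2)
      ultimately have "\<Union> ((\<lambda>A. A \<inter> S) ` \<F> \<union> (\<lambda>B. g ` (B \<inter> T)) ` \<G>) = (\<Union>\<F> \<inter> S) \<union> g ` (\<Union>\<G> \<inter> T)"
        by (simp only: Union_Un_distrib)
      also have "\<dots> = S \<union> g ` T" using TY SX by (simp add: F(2) G(2) inf.absorb2)
      also have "\<dots> = topspace X" using SX by (simp flip: XS add: Un_absorb1)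
      finally show ?thesis .
    qed
    fix A assume "A \<in> (\<lambda>A. A \<inter> S) ` \<F> \<union> (\<lambda>B. g ` (B \<inter> T)) ` \<G>"
    then consider A' where "A' \<in> \<F>" "A = A' \<inter> S" | B where "B \<in> \<G>" "A = g ` (B \<inter> T)" by blast
    then show "continuous_map (subtopology X A) Y h"
    proof cases
      case 1
      have "continuous_map (subtopology X A) Y f"
        using continuous_map_piece[OF F(3)[OF 1(1)]] 1(2) by blast
      then show ?thesis by (rule continuous_map_eq) (auto simp: h_def 1)
    next
      case 2
      then show ?thesis
        using continuous_map_piece_inverse[OF G(3)[OF 2(1)], of "B \<inter> T" h] hT by (auto simp: T_def)
    qed
  qed (use F(1) G(1) hX in simp_all)
  moreover have "sigma_continuous_map Y X k"
  proof (rule sigma_continuous_map_countable_cover[where \<F> = "(\<lambda>A. f ` (A \<inter> S)) ` \<F> \<union> (\<lambda>B. B \<inter> T) ` \<G>"])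
    show "\<Union> ((\<lambda>A. f ` (A \<inter> S)) ` \<F> \<union> (\<lambda>B. B \<inter> T) ` \<G>) = topspace Y"
    proof -
      have "(\<Union>B\<in>\<G>. B \<inter> T) = \<Union>\<G> \<inter> T" by (rule Int_Union2[symmetric])
      moreover have "(\<Union>A\<in>\<F>. f ` (A \<inter> S)) = f ` (\<Union>\<F> \<inter> S)"
        by (simp only: image_UN Int_Union2)
      ultimately have "\<Union> ((\<lambda>A. f ` (A \<inter> S)) ` \<F> \<union> (\<lambda>B. B \<inter> T) ` \<G>) = f ` (\<Union>\<F> \<inter> S) \<union> (\<Union>\<G> \<inter> T)"
        by (simp only: Union_Un_distrib)
      also have "\<dots> = f ` S \<union> T" using TY SX by (simp add: F(2) G(2) inf.absorb2)
      also have "\<dots> = topspace Y" using fS by (simp add: T_def Un_absorb1)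
      finally show ?thesis .
    qed
    show "k ` topspace Y \<subseteq> topspace X"
      using hX kh by (metis image_subsetI imageE)
    fix A assume "A \<in> (\<lambda>A. f ` (A \<inter> S)) ` \<F> \<union> (\<lambda>B. B \<inter> T) ` \<G>"
    then consider A' where "A' \<in> \<F>" "A = f ` (A' \<inter> S)" | B where "B \<in> \<G>" "A = B \<inter> T" by blast
    then show "continuous_map (subtopology Y A) X k"
    proof cases
      case 1
      have "k (f x) = x" if "x \<in> A' \<inter> S" for x
        using that kh[of x] SX by (auto simp: h_def)
      then show ?thesis
        using continuous_map_piece_inverse[OF F(3)[OF 1(1)], of "A' \<inter> S" k] 1(2) SX by auto
    next
      case 2
      have "continuous_map (subtopology Y A) X g"
        using continuous_map_piece[OF G(3)[OF 2(1)]] 2(2) by blast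
      moreover have "g y = k y" if "y \<in> topspace (subtopology Y A)" for y
        using that 2(2) hT kh[of "g y"] inj(4) by (auto simp: T_def)
      ultimately show ?thesis by (rule continuous_map_eq)
    qed
  qed (use F(1) G(1) in simp_all)
  ultimately show ?thesis
    unfolding sigma_homeomorphic_space_def sigma_homeomorphic_map_def
    using hinj hX k_def by (auto simp: bij_betw_def)
qed

section \<open>Disjoint copies of the Cantor space inside itself\<close>

text \<open>The word of \<open>n\<close> zeros and a one is put in front of \<open>x\<close>. For
  different \<open>n\<close> the ranges are disjoint copies of the Cantor space, since the first
  \<open>True\<close> sits at position \<open>n\<close>.\<close>

definition tag :: "nat \<Rightarrow> (nat \<Rightarrow> bool) \<Rightarrow> nat \<Rightarrow> bool" where
  "tag n x i = (if i < n then False else if i = n then True else x (i - Suc n))"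

lemma tag_cancel: "(\<lambda>i. tag n x (i + Suc n)) = x"
  by (auto simp: tag_def)

lemma tag_eq_iff: "tag m x = tag n y \<longleftrightarrow> m = n \<and> x = y"
proof
  assume *: "tag m x = tag n y"
  have "tag m x m" "\<And>i. i < m \<Longrightarrow> \<not> tag m x i" "tag n y n" "\<And>i. i < n \<Longrightarrow> \<not> tag n y i"
    by (auto simp: tag_def)
  then have "m = n" using * by (metis linorder_neqE_nat)
  then show "m = n \<and> x = y" using * tag_cancel by metis
qed auto

lemma continuous_on_tag: "continuous_on S (tag n)"
proof (rule continuous_on_coordinatewise_then_product)
  fix i
  consider "i < n" | "i = n" | "i > n" by linarith
  then show "continuous_on S (\<lambda>x. tag n x i)"
    by cases (auto simp: tag_def intro: continuous_on_product_then_coordinatewise[OF continuous_on_id, of S])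
qed

lemma continuous_on_untag: "continuous_on S (\<lambda>(x :: nat \<Rightarrow> bool) i. x (i + n))"
  by (intro continuous_on_coordinatewise_then_product
      continuous_on_product_then_coordinatewise[OF continuous_on_id, of S])

lemma embedding_map_tag: "embedding_map euclidean euclidean (tag n)"
  by (rule embedding_map_left_inverse[where g = "\<lambda>x i. x (i + Suc n)"])
     (auto simp only: tag_cancel continuous_map_iff_continuous continuous_map_iff_continuous2 continuous_on_tag continuous_on_untag subtopology_UNIV)

text \<open>A Hilbert hotel inside the range of \<open>c\<close>. Points that \<open>f\<close> sends
  outside this range stay put, those inside are moved to copy number 0, and the pieces of the
  complement of \<open>A\<close> move into the copies numbered from 1 on. Distinct copies are
  disjoint, which gives injectivity.\<close>

lemma sigma_embedding_absorb_Cantor_pieces: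
  fixes c :: "(nat \<Rightarrow> bool) \<Rightarrow> 'b" and X :: "'b topology" and Z :: "'a topology"
  assumes c: "embedding_map euclidean X c"
    and f: "embedding_map (subtopology Z A) X f" "A \<subseteq> topspace Z"
    and \<B>: "countable \<B>" "topspace Z - A = \<Union>\<B>"
    and e: "\<And>B. B \<in> \<B> \<Longrightarrow> \<exists>e :: 'a \<Rightarrow> nat \<Rightarrow> bool. embedding_map (subtopology Z B) euclidean e"
  obtains h where "sigma_embedding Z X h"
proof -
  obtain e where e: "\<And>B. B \<in> \<B> \<Longrightarrow> embedding_map (subtopology Z B) (euclidean :: (nat \<Rightarrow> bool) topology) (e B)"
    using e by metis
  have cinj: "inj c" using embedding_map_inj_on[OF c] by simp
  obtain ci where ci: "continuous_map (subtopology X (range c)) euclidean ci" and cic: "\<And>x. ci (c x) = x"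
    using embedding_map_inverse[OF c] by auto
  \<comment> \<open>The members of \<open>\<B>\<close> may overlap; a choice of one member for each
    point makes the map well defined and the pieces disjoint.\<close>
  define \<beta> where "\<beta> z = (SOME B. B \<in> \<B> \<and> z \<in> B)" for z
  have \<beta>: "\<beta> z \<in> \<B> \<and> z \<in> \<beta> z" if "z \<in> topspace Z" "z \<notin> A" for z
    unfolding \<beta>_def by (rule someI_ex) (use that \<B>(2) in auto)
  define h where "h z = (if z \<in> A then if f z \<in> range c then c (tag 0 (ci (f z))) else f z
      else c (tag (Suc (to_nat_on \<B> (\<beta> z))) (e (\<beta> z) z)))" for z
  have ctag: "embedding_map euclidean X (c \<circ> tag n)" for n
    by (rule embedding_map_compose[OF embedding_map_tag c])
  define P where "P i = (case i of None \<Rightarrow> {z \<in> A. f z \<notin> range c}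
     | Some None \<Rightarrow> {z \<in> A. f z \<in> range c}
     | Some (Some B) \<Rightarrow> {z \<in> topspace Z - A. \<beta> z = B})" for i
  have finj: "inj_on f A"
    using embedding_map_inj_on[OF f(1)] f(2) by (simp add: inf.absorb2)
  have einj: "inj_on (e B) B" if "B \<in> \<B>" for B
  proof -
    have "B \<subseteq> topspace Z" using that \<B>(2) by blast
    then show ?thesis using embedding_map_inj_on[OF e[OF that]] by (simp add: inf.absorb2)
  qed
  have "sigma_embedding Z X h"
  proof (rule sigma_embedding_countable_cover[where I = "insert None (insert (Some None) ((\<lambda>B. Some (Some B)) ` \<B>))" and A = P])
    show "inj_on h (topspace Z)"
    proof (rule inj_onI)
      fix y z assume yz: "y \<in> topspace Z" "z \<in> topspace Z" "h y = h z"
      have c_eq: "c a = c b \<longleftrightarrow> a = b" for a b using cinj by (simp add: inj_eq)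
      consider "y \<in> A" "z \<in> A" | "y \<in> A" "z \<notin> A" | "y \<notin> A" "z \<in> A" | "y \<notin> A" "z \<notin> A" by blast
      then show "y = z"
      proof cases
        case 1
        have "h x \<in> range c \<longleftrightarrow> f x \<in> range c" if "x \<in> A" for x
          using that by (auto simp: h_def)
        then have "f y \<in> range c \<longleftrightarrow> f z \<in> range c" using 1 yz(3) by metis
        then have "f y = f z"
          using 1 yz(3) by (auto simp: h_def c_eq tag_eq_iff cic split: if_splits)
        then show ?thesis using finj 1 by (auto simp: inj_on_def)
      next
        case 4
        then have "\<beta> y \<in> \<B>" "y \<in> \<beta> y" "\<beta> z \<in> \<B>" "z \<in> \<beta> z" using \<beta> yz by auto
        moreover have "to_nat_on \<B> (\<beta> y) = to_nat_on \<B> (\<beta> z)" "e (\<beta> y) y = e (\<beta> z) z"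
          using yz(3) 4 by (auto simp: h_def c_eq tag_eq_iff)
        ultimately show ?thesis
          using \<B>(1) einj by (metis inj_onD inj_on_to_nat_on)
      next
        case 2
        then show ?thesis using yz(3) by (auto simp: h_def c_eq tag_eq_iff split: if_splits)
      next
        case 3
        then show ?thesis using yz(3)[symmetric] by (auto simp: h_def c_eq tag_eq_iff split: if_splits)
      qed
    qed
    show "(\<Union>i\<in>insert None (insert (Some None) ((\<lambda>B. Some (Some B)) ` \<B>)). P i) = topspace Z"
    proof -
      have "(\<Union>i\<in>insert None (insert (Some None) ((\<lambda>B. Some (Some B)) ` \<B>)). P i) =
        A \<union> {z \<in> topspace Z - A. \<beta> z \<in> \<B>}"
        by (auto simp: P_def)
      then show ?thesis using f(2) \<beta> by auto
    qed
    fix i assume "i \<in> insert None (insert (Some None) ((\<lambda>B. Some (Some B)) ` \<B>))"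
    then consider "i = None" | "i = Some None" | B where "i = Some (Some B)" "B \<in> \<B>" by blast
    then show "embedding_map (subtopology Z (P i)) X h"
    proof cases
      case 1
      have "embedding_map (subtopology Z (P i)) X f"
        using embedding_map_subtopology[OF f(1), of "P i"] 1
        by (simp add: P_def subtopology_subtopology Collect_conj_eq flip: Int_assoc)
      then show ?thesis
        by (rule embedding_map_eq) (auto simp: h_def P_def 1)
    next
      case 2
      have Pi: "A \<inter> P i = P i" by (auto simp: P_def 2)
      have "embedding_map (subtopology Z (P i)) X f"
        using embedding_map_subtopology[OF f(1), of "P i"]
        by (simp add: subtopology_subtopology Pi)
      then have "embedding_map (subtopology Z (P i)) (subtopology X (range c)) f"
        by (auto simp: embedding_map_in_subtopology P_def 2)
      moreover have "embedding_map (subtopology X (range c)) euclidean ci"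
      proof (rule embedding_map_left_inverse[OF ci])
        have "continuous_map euclidean (subtopology X (range c)) c"
          using c homeomorphic_imp_continuous_map unfolding embedding_map_def by fastforce
        then show "continuous_map (subtopology euclidean (ci ` topspace (subtopology X (range c)))) (subtopology X (range c)) c"
          by (rule continuous_map_from_subtopology)
      qed (use cic in auto)
      ultimately have "embedding_map (subtopology Z (P i)) X ((c \<circ> tag 0) \<circ> (ci \<circ> f))"
        by (intro embedding_map_compose[OF _ ctag] embedding_map_compose)
      then show ?thesis
        by (rule embedding_map_eq) (auto simp: h_def P_def 2)
    next
      case 3
      have Pi: "B \<inter> P i = P i" using \<beta> by (auto simp: P_def 3)
      have "embedding_map (subtopology Z (P i)) euclidean (e B)"
        using embedding_map_subtopology[OF e[OF 3(2)], of "P i"]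
        by (simp add: subtopology_subtopology Pi)
      then have "embedding_map (subtopology Z (P i)) X ((c \<circ> tag (Suc (to_nat_on \<B> B))) \<circ> e B)"
        by (rule embedding_map_compose[OF _ ctag])
      then show ?thesis
        by (rule embedding_map_eq) (auto simp: h_def P_def 3)
    qed
  qed (use \<B>(1) in auto)
  then show thesis by (rule that)
qed

section \<open>Finite dimensional spaces are countable unions of zero-dimensional pieces\<close>

lemma continuous_map_clopen_membership:
  assumes "openin X U" "closedin X U"
  shows "continuous_map X (euclidean :: bool topology) (\<lambda>x. x \<in> U)"
  unfolding continuous_map_def
proof (intro conjI allI impI)
  fix V :: "bool set"
  have U: "U \<subseteq> topspace X" using assms(1) by (rule openin_subset)
  have "V = {} \<or> V = {True} \<or> V = {False} \<or> V = UNIV"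
    by (cases "True \<in> V"; cases "False \<in> V") (auto, (metis (full_types))+)
  moreover have "{x \<in> topspace X. x \<in> U} = U" "{x \<in> topspace X. x \<notin> U} = topspace X - U" using U by auto
  ultimately show "openin X {x \<in> topspace X. (x \<in> U) \<in> V}"
    using assms by (auto simp: closedin_def)
qed auto

text \<open>A point is sent to the list of its memberships in the base sets: clopenness makes every
  entry continuous, the base property makes the map open onto its image, and both the base and the
  Hausdorff property enter injectivity. Positions that number no base set constantly hold
  \<open>False\<close>.\<close>

lemma clopen_base_embedding:
  assumes \<U>: "countable \<U>" "\<And>U. U \<in> \<U> \<Longrightarrow> openin X U \<and> closedin X U"
    and base: "\<And>V x. openin X V \<Longrightarrow> x \<in> V \<Longrightarrow> \<exists>U\<in>\<U>. x \<in> U \<and> U \<subseteq> V"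
    and X: "Hausdorff_space X"
  shows "\<exists>e :: 'a \<Rightarrow> nat \<Rightarrow> bool. embedding_map X euclidean e"
proof
  define e where "e x n \<longleftrightarrow> (\<exists>U\<in>\<U>. to_nat_on \<U> U = n \<and> x \<in> U)" for x n
  have e: "e x (to_nat_on \<U> U) \<longleftrightarrow> x \<in> U" if "U \<in> \<U>" for x U
    unfolding e_def using that \<U>(1) by (metis inj_onD inj_on_to_nat_on)
  have cont: "continuous_map X euclidean e"
    unfolding euclidean_product_topology[symmetric] continuous_map_componentwise_UNIV
  proof
    fix n
    show "continuous_map X euclidean (\<lambda>x. e x n)"
    proof (cases "\<exists>U\<in>\<U>. to_nat_on \<U> U = n")
      case True
      then obtain U where "U \<in> \<U>" "to_nat_on \<U> U = n" by blast
      then have "(\<lambda>x. e x n) = (\<lambda>x. x \<in> U)" using e by auto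
      then show ?thesis using \<U>(2)[OF \<open>U \<in> \<U>\<close>] by (simp add: continuous_map_clopen_membership)
    next
      case False
      then have "(\<lambda>x. e x n) = (\<lambda>x. False)" by (auto simp: e_def)
      then show ?thesis by simp
    qed
  qed
  have inj: "inj_on e (topspace X)"
  proof (rule inj_onI, rule ccontr)
    fix x y assume xy: "x \<in> topspace X" "y \<in> topspace X" "e x = e y" "x \<noteq> y"
    then obtain V where V: "openin X V" "x \<in> V" "y \<notin> V"
      using X unfolding Hausdorff_space_def disjnt_def by blast
    then obtain U where "U \<in> \<U>" "x \<in> U" "U \<subseteq> V" using base by blast
    then show False using e xy(3) V(3) by (metis subsetD)
  qed
  have "open_map X (subtopology euclidean (e ` topspace X)) e"
    unfolding open_map_def
  proof (intro allI impI)
    fix V assume V: "openin X V"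
    have "e ` V = e ` topspace X \<inter> (\<Union>U\<in>{U\<in>\<U>. U \<subseteq> V}. {y. y (to_nat_on \<U> U)})" (is "?l = ?r")
    proof
      show "?l \<subseteq> ?r"
      proof clarify
        fix x assume "x \<in> V"
        moreover obtain U where "U \<in> \<U>" "x \<in> U" "U \<subseteq> V" using base V \<open>x \<in> V\<close> by blast
        ultimately show "e x \<in> ?r" using e openin_subset[OF V] by auto
      qed
      show "?r \<subseteq> ?l" using e by auto
    qed
    moreover have "open {y :: nat \<Rightarrow> bool. y n}" for n
    proof -
      have "open ((\<lambda>y :: nat \<Rightarrow> bool. y n) -` {True})"
        using open_vimage[OF open_discrete continuous_on_product_coordinates[of n]] by blast
      then show ?thesis by (simp add: vimage_def)
    qed
    then have "open (\<Union>U\<in>{U\<in>\<U>. U \<subseteq> V}. {y :: nat \<Rightarrow> bool. y (to_nat_on \<U> U)})"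
      by (intro open_UN) simp
    ultimately show "openin (subtopology euclidean (e ` topspace X)) (e ` V)"
      by (simp add: openin_open_Int)
  qed
  then show "embedding_map X euclidean e"
    unfolding embedding_map_def
    by (intro bijective_open_imp_homeomorphic_map) (use cont inj in \<open>auto simp: continuous_map_in_subtopology\<close>)
qed

text \<open>Removing the frontiers of the members of a suitable countable base leaves a space with a countable
  clopen base; the frontiers have smaller dimension.\<close>

lemma dim_le_imp_countable_union_Cantor_embeddable:
  assumes "X dim_le n" "second_countable X" "Hausdorff_space X"
  shows "\<exists>\<F>. countable \<F> \<and> \<Union>\<F> = topspace X \<and>
    (\<forall>A\<in>\<F>. \<exists>e :: 'a \<Rightarrow> nat \<Rightarrow> bool. embedding_map (subtopology X A) euclidean e)"
  using assms
proof (induction rule: dimension_le.induct)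
  case (1 n X)
  define good where "good U \<F> \<longleftrightarrow> openin X U \<and> countable \<F> \<and> \<Union>\<F> = X frontier_of U \<and>
      (\<forall>A\<in>\<F>. \<exists>e :: 'a \<Rightarrow> nat \<Rightarrow> bool. embedding_map (subtopology X A) euclidean e)" for U \<F>
  have good: "\<exists>U. a \<in> U \<and> U \<subseteq> V \<and> (\<exists>\<F>. good U \<F>)" if V: "openin X V" "a \<in> V" for V a
  proof -
    obtain U where U: "a \<in> U" "U \<subseteq> V" "openin X U"
      and IH: "second_countable (subtopology X (X frontier_of U)) \<Longrightarrow> Hausdorff_space (subtopology X (X frontier_of U)) \<Longrightarrow>
        \<exists>\<F>. countable \<F> \<and> \<Union>\<F> = topspace (subtopology X (X frontier_of U)) \<and>
        (\<forall>A\<in>\<F>. \<exists>e :: 'a \<Rightarrow> nat \<Rightarrow> bool. embedding_map (subtopology (subtopology X (X frontier_of U)) A) euclidean e)"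
      using "1.IH"[OF V] by blast
    have fr: "X frontier_of U \<subseteq> topspace X" by (rule frontier_of_subset_topspace)
    obtain \<F> where F: "countable \<F>" "\<Union>\<F> = X frontier_of U"
      "\<And>A. A \<in> \<F> \<Longrightarrow> \<exists>e :: 'a \<Rightarrow> nat \<Rightarrow> bool. embedding_map (subtopology (subtopology X (X frontier_of U)) A) euclidean e"
      using IH second_countable_subtopology Hausdorff_space_subtopology "1.prems" fr by (metis topspace_subtopology_subset)
    have "subtopology (subtopology X (X frontier_of U)) A = subtopology X A" if "A \<in> \<F>" for A
      using that F(2) by (auto simp: subtopology_subtopology intro: arg_cong[where f = "subtopology X"])
    then have "good U \<F>" using F U(3) unfolding good_def by metis
    then show ?thesis using U by blast
  qed
  obtain \<B> where B: "countable \<B>" "\<And>V. V \<in> \<B> \<Longrightarrow> openin X V"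
    "\<And>U x. openin X U \<Longrightarrow> x \<in> U \<Longrightarrow> \<exists>V \<in> \<B>. x \<in> V \<and> V \<subseteq> U"
    using "1.prems"(1) unfolding second_countable_def by metis
  \<comment> \<open>The sets \<open>U\<close> supplied by the dimension hypothesis need not be
    countably many. Choosing one for every pair of base sets that has one in between gives a
    countable family that is still a base.\<close>
  define I where "I = {(B, C) \<in> \<B> \<times> \<B>. \<exists>U \<F>. B \<subseteq> U \<and> U \<subseteq> C \<and> good U \<F>}"
  have cI: "countable I"
    by (rule countable_subset[of _ "\<B> \<times> \<B>"]) (use B(1) in \<open>auto simp: I_def\<close>)
  have "\<forall>i\<in>I. \<exists>U \<F>. fst i \<subseteq> U \<and> U \<subseteq> snd i \<and> good U \<F>" by (auto simp: I_def)
  then obtain U \<F> where UF: "\<And>i. i \<in> I \<Longrightarrow> fst i \<subseteq> U i \<and> U i \<subseteq> snd i \<and> good (U i) (\<F> i)" by metis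
  have base: "\<exists>i\<in>I. x \<in> U i \<and> U i \<subseteq> V" if V: "openin X V" "x \<in> V" for V x
  proof -
    obtain C where C: "C \<in> \<B>" "x \<in> C" "C \<subseteq> V" using B(3) V by blast
    obtain U' \<F>' where U': "x \<in> U'" "U' \<subseteq> C" "good U' \<F>'" using good[OF B(2)[OF C(1)] C(2)] by blast
    have "openin X U'" using U'(3) by (simp add: good_def)
    then obtain B' where B': "B' \<in> \<B>" "x \<in> B'" "B' \<subseteq> U'" using B(3) U'(1) by metis
    have "(B', C) \<in> I" unfolding I_def using B'(1,3) C(1) U'(2,3) by blast
    then show ?thesis using UF[of "(B', C)"] B'(2) C(3) by (intro bexI[of _ "(B', C)"]) auto
  qed
  define R where "R = topspace X - (\<Union>i\<in>I. X frontier_of U i)"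
  have "\<exists>e :: 'a \<Rightarrow> nat \<Rightarrow> bool. embedding_map (subtopology X R) euclidean e"
  proof (rule clopen_base_embedding[where \<U> = "(\<lambda>i. R \<inter> U i) ` I"])
    show "countable ((\<lambda>i. R \<inter> U i) ` I)" using cI by simp
    show "Hausdorff_space (subtopology X R)" using "1.prems"(2) by (rule Hausdorff_space_subtopology)
    show "\<exists>W\<in>(\<lambda>i. R \<inter> U i) ` I. x \<in> W \<and> W \<subseteq> V" if V: "openin (subtopology X R) V" "x \<in> V" for V x
    proof -
      obtain V' where V': "openin X V'" "V = V' \<inter> R" using V(1) unfolding openin_subtopology by blast
      then obtain i where i: "i \<in> I" "x \<in> U i" "U i \<subseteq> V'" using base[of V' x] V(2) by blast
      show ?thesis
        by (rule bexI[of _ "R \<inter> U i"]) (use i V V' in auto)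
    qed
    fix W assume "W \<in> (\<lambda>i. R \<inter> U i) ` I"
    then obtain i where i: "i \<in> I" "W = R \<inter> U i" by blast
    have op: "openin X (U i)" using UF[OF i(1)] by (simp add: good_def)
    \<comment> \<open>Without the frontier the closure of \<open>U i\<close> adds no point, so its
      trace on \<open>R\<close> is clopen.\<close>
    have "R \<inter> X closure_of U i = R \<inter> U i"
    proof -
      have "R \<inter> X frontier_of U i = {}" using i(1) unfolding R_def by blast
      then have "R \<inter> X closure_of U i \<subseteq> U i"
        unfolding frontier_of_def interior_of_openin[OF op] by blast
      then show ?thesis using closure_of_subset[OF openin_subset[OF op]] by blast
    qed
    then have "W = X closure_of U i \<inter> R" using i(2) by blast
    then have "closedin (subtopology X R) W"
      unfolding closedin_subtopology using closedin_closure_of by blast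
    moreover have "openin (subtopology X R) W"
      unfolding i(2) using op by (rule openin_subtopology_Int2)
    ultimately show "openin (subtopology X R) W \<and> closedin (subtopology X R) W" by blast
  qed
  moreover have "countable (insert R (\<Union>i\<in>I. \<F> i))"
    using cI UF unfolding good_def by (intro countable_insert countable_UN) blast+
  moreover have "\<Union> (insert R (\<Union>i\<in>I. \<F> i)) = topspace X"
  proof -
    have "\<Union>(\<F> i) = X frontier_of U i" if "i \<in> I" for i
      using UF[OF that] by (simp add: good_def)
    moreover have "\<Union>(\<Union>i\<in>I. \<F> i) = (\<Union>i\<in>I. \<Union>(\<F> i))" by blast
    ultimately have "(\<Union>(\<Union>i\<in>I. \<F> i)) = (\<Union>i\<in>I. X frontier_of U i)" by simp
    moreover have "(\<Union>i\<in>I. X frontier_of U i) \<subseteq> topspace X"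
      by (intro UN_least frontier_of_subset_topspace)
    ultimately show ?thesis
      unfolding R_def Union_insert by blast
  qed
  moreover have "\<exists>e :: 'a \<Rightarrow> nat \<Rightarrow> bool. embedding_map (subtopology X A) euclidean e" if A: "A \<in> (\<Union>i\<in>I. \<F> i)" for A
  proof -
    obtain i where "i \<in> I" "A \<in> \<F> i" using A by blast
    then show ?thesis using UF[of i] unfolding good_def by blast
  qed
  ultimately show ?case by (intro exI[of _ "insert R (\<Union>i\<in>I. \<F> i)"]) blast
qed

text \<open>Total boundedness: the balls of radius \<open>1 / Suc n\<close> around finite nets, for
  all \<open>n\<close>, form a countable base. It makes the frontier argument applicable to
  subspaces of the compactification.\<close>

lemma compact_metrizable_imp_second_countable:
  assumes "compact_space X" "metrizable_space X"
  shows "second_countable X"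
proof -
  obtain M d where "Metric_space M d" and X: "X = Metric_space.mtopology M d"
    using assms(2) unfolding metrizable_space_def by blast
  interpret Metric_space M d by fact
  have "\<exists>K. finite K \<and> K \<subseteq> M \<and> M \<subseteq> (\<Union>x\<in>K. mball x (1 / real (Suc n)))" for n
  proof -
    have "mtotally_bounded M"
      using assms(1) X by (simp add: compact_space_eq_mcomplete_mtotally_bounded)
    then show ?thesis unfolding mtotally_bounded_def by simp
  qed
  then obtain K where K: "\<And>n. finite (K n)" "\<And>n. K n \<subseteq> M" "\<And>n. M \<subseteq> (\<Union>x\<in>K n. mball x (1 / real (Suc n)))"
    by metis
  define \<B> where "\<B> = (\<Union>n. (\<lambda>x. mball x (1 / real (Suc n))) ` K n)"
  show ?thesis
    unfolding second_countable_def
  proof (intro exI[of _ \<B>] conjI allI impI)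
    show "countable \<B>" unfolding \<B>_def using K(1) by (auto intro: countable_finite)
    show "\<forall>V\<in>\<B>. openin X V" by (auto simp: \<B>_def X)
    fix U x assume "openin X U \<and> x \<in> U"
    then obtain r where r: "r > 0" "mball x r \<subseteq> U" and x: "x \<in> M" "x \<in> U"
      unfolding X openin_mtopology by blast
    obtain n where n: "1 / real (Suc n) < r / 2"
      using r(1) nat_approx_posE[of "r/2"] by auto
    obtain y where y: "y \<in> K n" "x \<in> mball y (1 / real (Suc n))" using K(3)[of n] x(1) by blast
    have "mball y (1 / real (Suc n)) \<subseteq> mball x r"
    proof
      fix z assume z: "z \<in> mball y (1 / real (Suc n))"
      have "d x z \<le> d x y + d y z" using x z y by (intro triangle) auto
      also have "\<dots> < r" using y(2) z n by (auto simp: commute)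
      finally show "z \<in> mball x r" using x z by auto
    qed
    then show "\<exists>V\<in>\<B>. x \<in> V \<and> V \<subseteq> U"
      using y r by (intro bexI[of _ "mball y (1 / real (Suc n))"]) (auto simp: \<B>_def)
  qed
qed

section \<open>The Cantor set\<close>

definition cantor_point :: "(nat \<Rightarrow> bool) \<Rightarrow> real" where
  "cantor_point x = (\<Sum>n. (if x n then 2 else 0) / 3 ^ Suc n)"

lemma cantor_set_eq_range: "cantor_set = range cantor_point"
  by (simp add: cantor_set_def cantor_point_def[abs_def])

lemma sums_two_thirds_powers: "(\<lambda>n. 2 / 3 ^ Suc n :: real) sums 1"
  using sums_mult[OF geometric_sums[of "1/3::real"], of "2/3"]
  by (simp add: power_divide)

lemma summable_cantor_point: "summable (\<lambda>n. (if x n then 2 else 0) / 3 ^ Suc n :: real)"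
  by (rule summable_comparison_test'[OF sums_summable[OF sums_two_thirds_powers]]) auto

lemma cantor_point_bounds: "0 \<le> cantor_point x" "cantor_point x \<le> 1"
proof -
  show "0 \<le> cantor_point x"
    unfolding cantor_point_def by (intro suminf_nonneg summable_cantor_point) auto
  have "cantor_point x \<le> (\<Sum>n. 2 / 3 ^ Suc n)"
    unfolding cantor_point_def
    by (intro suminf_le summable_cantor_point sums_summable[OF sums_two_thirds_powers]) auto
  then show "cantor_point x \<le> 1"
    using sums_unique[OF sums_two_thirds_powers] by simp
qed

text \<open>The self-similarity of the Cantor set; the distance estimate and injectivity are
  inductions along this equation.\<close>

lemma cantor_point_rec:
  "cantor_point x = (if x 0 then 2 else 0) / 3 + cantor_point (\<lambda>n. x (Suc n)) / 3"
proof -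
  have "cantor_point x = (\<Sum>n. (if x (Suc n) then 2 else 0) / 3 ^ Suc (Suc n)) + (if x 0 then 2 else 0) / 3"
    unfolding cantor_point_def using suminf_split_head[OF summable_cantor_point[of x]] by simp
  also have "(\<Sum>n. (if x (Suc n) then 2 else 0) / 3 ^ Suc (Suc n)) = cantor_point (\<lambda>n. x (Suc n)) / 3"
    unfolding cantor_point_def
    by (subst suminf_divide[OF summable_cantor_point, symmetric]) (simp add: field_simps)
  finally show ?thesis by simp
qed

lemma cantor_point_dist_le:
  "(\<And>i. i < n \<Longrightarrow> x i = y i) \<Longrightarrow> \<bar>cantor_point x - cantor_point y\<bar> \<le> (1/3) ^ n"
proof (induction n arbitrary: x y)
  case 0
  then show ?case using cantor_point_bounds[of x] cantor_point_bounds[of y] by auto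
next
  case (Suc n)
  have "\<bar>cantor_point (\<lambda>n. x (Suc n)) - cantor_point (\<lambda>n. y (Suc n))\<bar> \<le> (1/3) ^ n"
    by (rule Suc.IH) (use Suc.prems in auto)
  moreover have "x 0 = y 0" using Suc.prems by simp
  then have eq: "cantor_point x - cantor_point y =
      (cantor_point (\<lambda>n. x (Suc n)) - cantor_point (\<lambda>n. y (Suc n))) / 3"
    using cantor_point_rec[of x] cantor_point_rec[of y] by (simp add: diff_divide_distrib)
  ultimately show ?case unfolding eq by simp
qed

text \<open>The first bit is visible in the value, which is at most 1/3 for \<open>False\<close> and
  at least 2/3 for \<open>True\<close>; shifting then yields the other bits.\<close>

lemma inj_cantor_point: "inj cantor_point"
proof (rule injI, rule ext)
  have "x 0 = y 0 \<and> cantor_point (\<lambda>n. x (Suc n)) = cantor_point (\<lambda>n. y (Suc n))"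
    if "cantor_point x = cantor_point y" for x y
    using that cantor_point_rec[of x] cantor_point_rec[of y]
      cantor_point_bounds[of "\<lambda>n. x (Suc n)"] cantor_point_bounds[of "\<lambda>n. y (Suc n)"]
    by (auto split: if_splits)
  note step = this
  fix x y n assume "cantor_point x = cantor_point y"
  then show "x n = y n"
  proof (induction n arbitrary: x y)
    case (Suc n)
    show ?case using Suc.IH[of "\<lambda>n. x (Suc n)" "\<lambda>n. y (Suc n)"] step[OF Suc.prems] by simp
  qed (use step in auto)
qed

lemma open_coordinate_eq: "open {y :: nat \<Rightarrow> bool. y i = b}"
proof -
  have "{y :: nat \<Rightarrow> bool. y i = b} = (\<lambda>y. y i) -` {b}" by auto
  then show ?thesis
    using open_vimage[OF open_discrete continuous_on_product_coordinates[of i]] by metis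
qed

lemma open_cylinder: "open {y :: nat \<Rightarrow> bool. \<forall>i<n. y i = x i}"
proof -
  have "{y :: nat \<Rightarrow> bool. \<forall>i<n. y i = x i} = (\<Inter>i\<in>{..<n}. {y. y i = x i})" by auto
  then show ?thesis by (simp only:) (intro open_INT ballI open_coordinate_eq finite_lessThan)
qed

text \<open>Exact agreement in finitely many coordinates keeps a point in a basic neighbourhood, for
  any coordinate space. For bits this gives neighbourhoods; for reals it turns coordinatewise
  stabilization into convergence.\<close>

lemma open_contains_cylinder:
  fixes V :: "(nat \<Rightarrow> 'b::topological_space) set"
  assumes "open V" "x \<in> V"
  obtains n where "{y. \<forall>i<n. y i = x i} \<subseteq> V"
proof -
  obtain X where X: "x \<in> Pi\<^sub>E UNIV X" "finite {i. X i \<noteq> UNIV}" "Pi\<^sub>E UNIV X \<subseteq> V"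
    using product_topology_open_contains_basis[of "\<lambda>_::nat. euclidean :: 'b topology" UNIV V x] assms
    unfolding open_fun_def by auto
  obtain n where n: "\<And>i. X i \<noteq> UNIV \<Longrightarrow> i < n"
    using X(2) unfolding finite_nat_set_iff_bounded by auto
  have "y \<in> V" if "\<forall>i<n. y i = x i" for y
  proof -
    have "y i \<in> X i" for i
      using that n[of i] X(1) by (cases "i < n") (auto simp: PiE_iff)
    then show ?thesis using X(3) by (auto simp: PiE_iff)
  qed
  then show thesis using that by blast
qed

lemma continuous_on_cantor_point: "continuous_on S cantor_point"
proof -
  have "\<exists>A. open A \<and> x \<in> A \<and> (\<forall>y\<in>UNIV. y \<in> A \<longrightarrow> cantor_point y \<in> B)"
    if B: "open B" "cantor_point x \<in> B" for x B
  proof -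
    obtain e where e: "e > 0" "\<And>t. dist t (cantor_point x) < e \<Longrightarrow> t \<in> B"
      using B unfolding open_dist by blast
    obtain n where n: "(1/3 :: real) ^ n < e" using real_arch_pow_inv[OF e(1), of "1/3"] by auto
    have "cantor_point y \<in> B" if y: "\<forall>i<n. y i = x i" for y
    proof (rule e(2))
      have "\<bar>cantor_point y - cantor_point x\<bar> \<le> (1/3) ^ n" by (rule cantor_point_dist_le) (use y in simp)
      then show "dist (cantor_point y) (cantor_point x) < e" using n by (simp add: dist_real_def)
    qed
    then show ?thesis using open_cylinder[of n x] by (intro exI[of _ "{y. \<forall>i<n. y i = x i}"]) blast
  qed
  then have "continuous_on UNIV cantor_point"
    unfolding continuous_on_topological by blast
  then show ?thesis by (rule continuous_on_subset) simp
qed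

lemma compact_PiE_UNIV:
  "compact (Pi\<^sub>E UNIV (\<lambda>_. K) :: ('i \<Rightarrow> 'b::topological_space) set)" if "compact K"
proof -
  have "compactin (product_topology (\<lambda>_::'i. euclidean) UNIV) (Pi\<^sub>E UNIV (\<lambda>_. K))"
    using that by (subst compactin_PiE) auto
  then show ?thesis by (simp add: euclidean_product_topology)
qed

lemma compact_Cantor_space: "compact (UNIV :: (nat \<Rightarrow> bool) set)"
proof -
  have "compact (UNIV :: bool set)" by (rule finite_imp_compact) simp
  then show ?thesis using compact_PiE_UNIV[of "UNIV :: bool set", where 'i = nat] by simp
qed

definition cantor_code :: "real \<Rightarrow> nat \<Rightarrow> bool" where
  "cantor_code = inv cantor_point"

lemma cantor_code_point [simp]: "cantor_code (cantor_point x) = x"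
  by (simp add: cantor_code_def inj_cantor_point)

lemma cantor_point_code: "p \<in> cantor_set \<Longrightarrow> cantor_point (cantor_code p) = p"
  by (auto simp: cantor_set_eq_range)

lemma continuous_on_cantor_code: "continuous_on cantor_set cantor_code"
proof -
  obtain g where g: "homeomorphism UNIV cantor_set cantor_point g"
    using homeomorphism_compact[OF compact_Cantor_space continuous_on_cantor_point cantor_set_eq_range[symmetric] inj_cantor_point]
    by blast
  have "cantor_code p = g p" if "p \<in> cantor_set" for p
    using that homeomorphism_apply1[OF g] by (auto simp: cantor_set_eq_range)
  then show ?thesis
    using homeomorphism_cont2[OF g] by (simp cong: continuous_on_cong)
qed

lemma compact_cantor_set: "compact cantor_set"
  unfolding cantor_set_eq_range
  by (intro compact_continuous_image continuous_on_cantor_point compact_Cantor_space)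

lemma cantor_set_subset: "cantor_set \<subseteq> {0..1}"
  by (auto simp: cantor_set_eq_range cantor_point_bounds)

lemma zero_in_cantor_set: "0 \<in> cantor_set"
  unfolding cantor_set_eq_range by (rule range_eqI[of _ _ "\<lambda>_. False"]) (simp add: cantor_point_def)

text \<open>On an interval inside the Cantor set each code bit would be continuous, hence constant
  by connectedness, although distinct points differ in some bit.\<close>

lemma cantor_set_gap:
  assumes "a < b"
  obtains t where "a < t" "t < b" "t \<notin> cantor_set"
proof (rule ccontr)
  assume "\<not> thesis"
  then have sub: "{a<..<b} \<subseteq> cantor_set"
    using that by (meson greaterThanLessThan_iff subsetI)
  obtain p q where pq: "a < p" "p < q" "q < b" using dense assms by metis
  then have pqC: "p \<in> cantor_set" "q \<in> cantor_set" using sub by auto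
  have "cantor_code p \<noteq> cantor_code q" using pq pqC cantor_point_code by (metis less_irrefl)
  then obtain n where n: "cantor_code p n \<noteq> cantor_code q n" by blast
  have "continuous_on {a<..<b} (\<lambda>t. cantor_code t n)"
    using continuous_on_product_then_coordinatewise[OF continuous_on_subset[OF continuous_on_cantor_code sub]] .
  then have "connected ((\<lambda>t. cantor_code t n) ` {a<..<b})"
    by (rule connected_continuous_image) simp
  moreover have "(\<lambda>t. cantor_code t n) ` {a<..<b} = UNIV"
  proof -
    have "cantor_code p n \<in> (\<lambda>t. cantor_code t n) ` {a<..<b}" "cantor_code q n \<in> (\<lambda>t. cantor_code t n) ` {a<..<b}"
      using pq by auto
    then have "True \<in> (\<lambda>t. cantor_code t n) ` {a<..<b}" "False \<in> (\<lambda>t. cantor_code t n) ` {a<..<b}"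
      using n by (metis (full_types))+
    then show ?thesis unfolding UNIV_bool by blast
  qed
  ultimately have "connected (UNIV :: bool set)" by simp
  then show False
    using connectedD[of UNIV "{True}" "{False}"] open_discrete by blast
qed

section \<open>Lower semicontinuous functions given by rational balls\<close>

lemma cantor_dist_nonneg: "0 \<le> cantor_dist x y"
  by (simp add: cantor_dist_def)

lemma cantor_dist_commute: "cantor_dist x y = cantor_dist y x"
  by (simp add: cantor_dist_def eq_commute)

lemma cantor_dist_le:
  assumes "\<And>i. i < n \<Longrightarrow> x i = y i"
  shows "cantor_dist x y \<le> (1/2) ^ n"
proof (cases "x = y")
  case False
  then obtain m where "x m \<noteq> y m" by blast
  then have "x (LEAST m. x m \<noteq> y m) \<noteq> y (LEAST m. x m \<noteq> y m)" by (rule LeastI)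
  then have "n \<le> (LEAST m. x m \<noteq> y m)" using assms by (meson not_le)
  then show ?thesis using False by (simp add: cantor_dist_def power_decreasing)
qed (simp add: cantor_dist_def)

lemma cantor_dist_less_imp_agree:
  assumes "cantor_dist x y < (1/2) ^ n" "i \<le> n"
  shows "x i = y i"
proof (rule ccontr)
  assume *: "x i \<noteq> y i"
  then have "(LEAST m. x m \<noteq> y m) \<le> n" using Least_le[of "\<lambda>m. x m \<noteq> y m" i] assms(2) by simp
  then have "(1/2 :: real) ^ n \<le> (1/2) ^ (LEAST m. x m \<noteq> y m)" by (rule power_decreasing) auto
  moreover have "x \<noteq> y" using * by blast
  ultimately show False using assms(1) by (simp add: cantor_dist_def)
qed

lemma cantor_dist_less_iff: "cantor_dist x y < (1/2) ^ n \<longleftrightarrow> (\<forall>i\<le>n. x i = y i)"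
proof
  assume "\<forall>i\<le>n. x i = y i"
  then have "cantor_dist x y \<le> (1/2) ^ Suc n" by (intro cantor_dist_le) simp
  also have "\<dots> < (1/2) ^ n" by simp
  finally show "cantor_dist x y < (1/2) ^ n" .
qed (use cantor_dist_less_imp_agree in blast)

text \<open>The ultrametric argument: if both distances on the right were below
  \<open>(1/2) ^ n\<close>, the three sequences would agree up to bit \<open>n\<close>, where
  \<open>x\<close> and \<open>z\<close> differ.\<close>

lemma cantor_dist_triangle: "cantor_dist x z \<le> cantor_dist x y + cantor_dist y z"
proof (cases "x = z")
  case False
  define n where "n = (LEAST m. x m \<noteq> z m)"
  have n: "cantor_dist x z = (1/2) ^ n" using False by (simp add: cantor_dist_def n_def)
  then have "\<not> cantor_dist x z < (1/2) ^ n" by simp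
  then have "\<not> (cantor_dist x y < (1/2) ^ n \<and> cantor_dist y z < (1/2) ^ n)"
    unfolding cantor_dist_less_iff by auto
  then show ?thesis using n cantor_dist_nonneg[of x y] cantor_dist_nonneg[of y z] by auto
qed (simp add: cantor_dist_nonneg cantor_dist_def)

lemma cantor_dist_Lipschitz: "\<bar>cantor_dist x c - cantor_dist y c\<bar> \<le> cantor_dist x y"
  using cantor_dist_triangle[of x c y] cantor_dist_triangle[of y c x] cantor_dist_commute[of x y] by simp

lemma cantor_dist_open_ball:
  assumes "0 < e"
  obtains A where "open A" "x \<in> A" "\<And>y. y \<in> A \<Longrightarrow> cantor_dist x y < e"
proof -
  obtain n where n: "(1/2 :: real) ^ n < e" using real_arch_pow_inv[OF assms, of "1/2"] by auto
  show thesis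
  proof (rule that[of "{y. \<forall>i<n. y i = x i}"])
    fix y assume "y \<in> {y. \<forall>i<n. y i = x i}"
    then have "cantor_dist x y \<le> (1/2) ^ n" by (intro cantor_dist_le) simp
    then show "cantor_dist x y < e" using n by simp
  qed (use open_cylinder in auto)
qed

lemma continuous_on_cantor_dist: "continuous_on S (\<lambda>x. cantor_dist x c)"
proof -
  have "\<exists>A. open A \<and> x \<in> A \<and> (\<forall>y\<in>UNIV. y \<in> A \<longrightarrow> cantor_dist y c \<in> B)"
    if B: "open B" "cantor_dist x c \<in> B" for x B
  proof -
    obtain e where e: "e > 0" "\<And>t. dist t (cantor_dist x c) < e \<Longrightarrow> t \<in> B"
      using B unfolding open_dist by blast
    obtain A where A: "open A" "x \<in> A" "\<And>y. y \<in> A \<Longrightarrow> cantor_dist x y < e"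
      using cantor_dist_open_ball[OF e(1)] by metis
    have "cantor_dist y c \<in> B" if "y \<in> A" for y
    proof (rule e(2))
      show "dist (cantor_dist y c) (cantor_dist x c) < e"
        using A(3)[OF that] cantor_dist_Lipschitz[of y c x] cantor_dist_commute[of x y]
        by (simp add: dist_real_def)
    qed
    then show ?thesis using A by (intro exI[of _ A]) simp
  qed
  then have "continuous_on UNIV (\<lambda>x. cantor_dist x c)"
    unfolding continuous_on_topological by blast
  then show ?thesis by (rule continuous_on_subset) simp
qed

definition ball_word :: "nat \<Rightarrow> nat \<Rightarrow> bool" where
  "ball_word i = cantor_center (list_decode (fst (prod_decode i)))"

definition ball_center :: "nat \<Rightarrow> nat \<Rightarrow> real" where
  "ball_center i = cube_center (list_decode (fst (prod_decode (snd (prod_decode i)))))"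

definition ball_radius :: "nat \<Rightarrow> real" where
  "ball_radius i = (let d = snd (prod_decode (snd (prod_decode i)))
     in real (Suc (fst (prod_decode d))) / real (Suc (snd (prod_decode d))))"

lemma rational_ball_eq: "rational_ball k i = open_ball k (ball_word i) (ball_center i) (ball_radius i)"
  by (simp add: rational_ball_def ball_word_def ball_center_def ball_radius_def Let_def split: prod.split)

lemma mem_rational_ball_iff:
  assumes "r \<in> hilbert_cube"
  shows "(x, map r [0..<k]) \<in> rational_ball k i \<longleftrightarrow>
    cantor_dist x (ball_word i) < ball_radius i \<and> (\<forall>j<k. \<bar>r j - ball_center i j\<bar> < ball_radius i)"
  using assms by (auto simp: rational_ball_eq open_ball_def hilbert_cube_def Pi_iff)

text \<open>Replaces the supremum by a condition on each pair in \<open>V\<close>;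
  \<open>0 \<le> t\<close> takes care of the inserted 0.\<close>

lemma J_le_iff:
  assumes "r \<in> hilbert_cube" "0 \<le> t"
  shows "J k V (x, map r [0..<k]) \<le> t \<longleftrightarrow>
    (\<forall>(i, q)\<in>V. cantor_dist x (ball_word i) < ball_radius i \<and> (\<forall>j<k. \<bar>r j - ball_center i j\<bar> < ball_radius i)
       \<longrightarrow> min \<bar>real_of_rat q\<bar> 1 \<le> t)"
proof -
  have "bdd_above (insert 0 {min \<bar>real_of_rat q\<bar> 1 | i q. (i, q) \<in> V \<and> (x, map r [0..<k]) \<in> rational_ball k i})"
    by (rule bdd_aboveI[of _ 1]) auto
  then show ?thesis
    unfolding J_def using assms by (subst cSup_le_iff) (auto simp: mem_rational_ball_iff)
qed

lemma J_bounds: "0 \<le> J k V z" "J k V z \<le> 1"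
proof -
  have "bdd_above (insert 0 {min \<bar>real_of_rat q\<bar> 1 | i q. (i, q) \<in> V \<and> z \<in> rational_ball k i})"
    by (rule bdd_aboveI[of _ 1]) auto
  then show "0 \<le> J k V z" unfolding J_def by (intro cSup_upper) auto
  show "J k V z \<le> 1" unfolding J_def by (intro cSup_least) auto
qed

lemma J_omega_in_hilbert_cube: "J_omega V x \<in> hilbert_cube"
  by (auto simp: hilbert_cube_def J_omega.simps[of V x] J_bounds)

lemma J_omega_rec: "J_omega V x k = J k (V k) (x, map (J_omega V x) [0..<k])"
  by (simp add: J_omega.simps[of V x k])

text \<open>For \<open>h = 0\<close> this says that \<open>r\<close> lies above the lower semicontinuous functions \<open>J\<close>;
  a positive \<open>h\<close> replaces the indicator function of a rational ball by the continuous function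
  that grows with slope \<open>1/h\<close> from the boundary of the ball and is cut off at 1. The
  denominator \<open>h\<close> is multiplied out, which makes the condition closed in all variables.\<close>

definition lies_above :: "(nat \<Rightarrow> (nat \<times> rat) set) \<Rightarrow> (nat \<Rightarrow> bool) \<Rightarrow> real \<Rightarrow> (nat \<Rightarrow> real) \<Rightarrow> bool" where
  "lies_above V x h r \<longleftrightarrow> (\<forall>k. \<forall>(i, q)\<in>V k.
     min \<bar>real_of_rat q\<bar> 1 \<le> r k \<or>
     min \<bar>real_of_rat q\<bar> 1 * (ball_radius i - cantor_dist x (ball_word i)) \<le> r k * h \<or>
     (\<exists>j<k. min \<bar>real_of_rat q\<bar> 1 * (ball_radius i - \<bar>r j - ball_center i j\<bar>) \<le> r k * h))"

lemma lies_above_zero_iff: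
  assumes r: "r \<in> hilbert_cube"
  shows "lies_above V x 0 r \<longleftrightarrow> (\<forall>k. J k (V k) (x, map r [0..<k]) \<le> r k)"
proof -
  have rk: "0 \<le> r k" for k using r by (auto simp: hilbert_cube_def)
  \<comment> \<open>A product with a positive \<open>a\<close> is at most 0 only if the other factor
    is, which means lying outside the ball. For \<open>a = 0\<close> the first disjunct already
    holds.\<close>
  have "a \<le> r k \<or> a * b \<le> r k * 0 \<or> (\<exists>j<k. a * c j \<le> r k * 0) \<longleftrightarrow> (0 < b \<and> (\<forall>j<k. 0 < c j) \<longrightarrow> a \<le> r k)"
    if "0 \<le> a" for a b :: real and k and c :: "nat \<Rightarrow> real"
  proof (cases "a = 0")
    case False
    then show ?thesis using that by (auto simp: mult_le_0_iff not_less)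
  qed (use rk in simp)
  then have "lies_above V x 0 r \<longleftrightarrow> (\<forall>k. \<forall>(i, q)\<in>V k.
     0 < ball_radius i - cantor_dist x (ball_word i) \<and> (\<forall>j<k. 0 < ball_radius i - \<bar>r j - ball_center i j\<bar>) \<longrightarrow>
     min \<bar>real_of_rat q\<bar> 1 \<le> r k)"
    unfolding lies_above_def by simp
  then show ?thesis using J_le_iff[OF r rk] by simp
qed

lemma lies_above_mono:
  assumes "lies_above V x h r" "h \<le> h'" "r \<in> hilbert_cube"
  shows "lies_above V x h' r"
proof -
  have "r k * h \<le> r k * h'" for k
    using assms(2,3) by (intro mult_left_mono) (auto simp: hilbert_cube_def)
  then show ?thesis using assms(1) unfolding lies_above_def by (fast intro: order_trans)
qed

text \<open>Raising coordinate \<open>n\<close> changes the arguments of all later conditions in an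
  uncontrolled way, so the later coordinates are set to 1, where the first disjunct always holds.
  Earlier conditions are untouched, and in condition \<open>n\<close> only the right-hand sides
  grow.\<close>

lemma lies_above_raise:
  assumes "lies_above V x h r" and "0 \<le> h"
    and "\<And>j. j < n \<Longrightarrow> s j = r j" "r n \<le> s n" "\<And>j. j > n \<Longrightarrow> s j = 1"
  shows "lies_above V x h s"
  unfolding lies_above_def
proof (intro allI ballI, clarify)
  fix k i q assume "(i, q) \<in> V k" and n1: "\<not> min \<bar>real_of_rat q\<bar> 1 \<le> s k"
    and n2: "\<not> (\<exists>j<k. min \<bar>real_of_rat q\<bar> 1 * (ball_radius i - \<bar>s j - ball_center i j\<bar>) \<le> s k * h)"
  have k: "k \<le> n" using n1 assms(5)[of k] by (cases "k \<le> n") (auto simp: not_le)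
  have "r k \<le> s k" using k assms(3)[of k] assms(4) by (cases "k = n") auto
  then have le: "r k * h \<le> s k * h" using assms(2) by (rule mult_right_mono)
  have "s j = r j" if "j < k" for j using assms(3) that k by simp
  then have "\<not> (\<exists>j<k. min \<bar>real_of_rat q\<bar> 1 * (ball_radius i - \<bar>r j - ball_center i j\<bar>) \<le> r k * h)"
    using n2 le by (metis order_trans)
  moreover have "\<not> min \<bar>real_of_rat q\<bar> 1 \<le> r k" using n1 \<open>r k \<le> s k\<close> by linarith
  ultimately have "min \<bar>real_of_rat q\<bar> 1 * (ball_radius i - cantor_dist x (ball_word i)) \<le> r k * h"
    using assms(1) \<open>(i, q) \<in> V k\<close> unfolding lies_above_def by blast
  then show "min \<bar>real_of_rat q\<bar> 1 * (ball_radius i - cantor_dist x (ball_word i)) \<le> s k * h"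
    using le by simp
qed

text \<open>The shifts are chosen so that \<open>s k * h\<close> exceeds \<open>r k * h\<close> by
  exactly \<open>e / h ^ k\<close> when the cap at 1 is inactive. This dominates the change
  \<open>e\<close> of the parameter and, as \<open>h \<le> 1\<close>, every shift
  \<open>e / h ^ Suc j\<close> with \<open>j < k\<close>; the factor \<open>a \<le> 1\<close> does
  not enlarge these changes. Where the cap is active the first disjunct holds.\<close>

lemma lies_above_perturb:
  assumes above: "lies_above V x h r" and h: "0 < h" "h \<le> 1" and r: "r \<in> hilbert_cube"
    and e: "0 < e" "cantor_dist x y \<le> e"
  shows "lies_above V y h (\<lambda>k. min 1 (r k + e / h ^ Suc k))"
  unfolding lies_above_def
proof (intro allI ballI, clarify)
  fix k i q assume V: "(i, q) \<in> V k"
  define a where "a = min \<bar>real_of_rat q\<bar> 1"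
  define s where "s k = min 1 (r k + e / h ^ Suc k)" for k
  assume n1: "\<not> min \<bar>real_of_rat q\<bar> 1 \<le> min 1 (r k + e / h ^ Suc k)"
    and n2: "\<not> (\<exists>j<k. min \<bar>real_of_rat q\<bar> 1 * (ball_radius i - \<bar>min 1 (r j + e / h ^ Suc j) - ball_center i j\<bar>) \<le> min 1 (r k + e / h ^ Suc k) * h)"
  have a: "0 \<le> a" "a \<le> 1" by (auto simp: a_def)
  have "\<not> a \<le> s k" using n1 by (simp add: a_def s_def)
  moreover have "0 < e / h ^ Suc k" using h e by simp
  ultimately have sk: "s k = r k + e / h ^ Suc k" "r k \<le> s k" "\<not> a \<le> r k"
    using a unfolding s_def by linarith+
  have skh: "s k * h = r k * h + e / h ^ k" using h by (simp add: sk field_simps)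
  have pert: "a * b' \<le> s k * h" if "a * b \<le> r k * h" "b' \<le> b + e / h ^ k" for b b'
  proof -
    have "a * b' \<le> a * (b + e / h ^ k)" using that(2) a(1) by (rule mult_left_mono)
    also have "\<dots> \<le> r k * h + 1 * (e / h ^ k)"
      using that(1) a e h by (simp add: distrib_left) (intro add_mono, simp, intro divide_right_mono mult_left_le_one_le, auto)
    finally show ?thesis by (simp add: skh)
  qed
  have step: "e / h ^ j \<le> e / h ^ k" if "j \<le> k" for j
    using that h e by (intro divide_left_mono power_decreasing) auto
  have srd: "\<bar>s j - r j\<bar> \<le> e / h ^ k" if "j < k" for j
  proof -
    have "r j \<le> 1" "0 \<le> r j" using r by (auto simp: hilbert_cube_def)
    moreover have "0 \<le> e / h ^ Suc j" using e h by simp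
    ultimately have "\<bar>s j - r j\<bar> \<le> e / h ^ Suc j" by (auto simp: s_def min_def)
    also have "\<dots> \<le> e / h ^ k" using that by (intro step) simp
    finally show ?thesis .
  qed
  have "\<not> (\<exists>j<k. a * (ball_radius i - \<bar>r j - ball_center i j\<bar>) \<le> r k * h)"
  proof clarify
    fix j assume j: "j < k" "a * (ball_radius i - \<bar>r j - ball_center i j\<bar>) \<le> r k * h"
    have "a * (ball_radius i - \<bar>s j - ball_center i j\<bar>) \<le> s k * h"
      by (rule pert[OF j(2)]) (use srd[OF j(1)] in linarith)
    then show False using n2 j(1) by (auto simp: a_def s_def)
  qed
  then have "a * (ball_radius i - cantor_dist x (ball_word i)) \<le> r k * h"
    using above V sk(3) unfolding lies_above_def a_def by blast
  moreover have "ball_radius i - cantor_dist y (ball_word i) \<le> ball_radius i - cantor_dist x (ball_word i) + e / h ^ k"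
    using cantor_dist_Lipschitz[of x "ball_word i" y] e(2) step[of 0] by simp
  ultimately have "a * (ball_radius i - cantor_dist y (ball_word i)) \<le> s k * h" by (rule pert)
  then show "min \<bar>real_of_rat q\<bar> 1 * (ball_radius i - cantor_dist y (ball_word i)) \<le> min 1 (r k + e / h ^ Suc k) * h"
    by (simp add: a_def s_def)
qed

lemma continuous_on_coordinate:
  assumes "continuous_on S f"
  shows "continuous_on S (\<lambda>p. f p i)"
  using continuous_on_product_then_coordinatewise[OF assms] .

lemma closed_Collect_lies_above:
  fixes f :: "'a::topological_space \<Rightarrow> nat \<Rightarrow> bool"
  assumes [continuous_intros]: "continuous_on UNIV f" "continuous_on UNIV h" "continuous_on UNIV r"
  shows "closed {p. lies_above V (f p) (h p) (r p)}"
proof -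
  define P where "P k e p \<longleftrightarrow> (case e of (i, q) \<Rightarrow>
     min \<bar>real_of_rat q\<bar> 1 \<le> r p k \<or>
     min \<bar>real_of_rat q\<bar> 1 * (ball_radius i - cantor_dist (f p) (ball_word i)) \<le> r p k * h p \<or>
     (\<exists>j<k. min \<bar>real_of_rat q\<bar> 1 * (ball_radius i - \<bar>r p j - ball_center i j\<bar>) \<le> r p k * h p))" for k e p
  have [continuous_intros]: "continuous_on UNIV (\<lambda>p. r p j)" for j
    by (rule continuous_on_coordinate) fact
  have [continuous_intros]: "continuous_on UNIV (\<lambda>p. cantor_dist (f p) c)" for c
    by (rule continuous_on_compose2[OF continuous_on_cantor_dist[of UNIV]]) (use assms in auto)
  have cl: "closed {p. P k (i, q) p}" for k i q
  proof -
    have "closed (\<Union>j\<in>{..<k}. {p. min \<bar>real_of_rat q\<bar> 1 * (ball_radius i - \<bar>r p j - ball_center i j\<bar>) \<le> r p k * h p})"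
      by (intro closed_UN closed_Collect_le continuous_intros ballI) auto
    moreover have "(\<Union>j\<in>{..<k}. {p. min \<bar>real_of_rat q\<bar> 1 * (ball_radius i - \<bar>r p j - ball_center i j\<bar>) \<le> r p k * h p})
      = {p. \<exists>j<k. min \<bar>real_of_rat q\<bar> 1 * (ball_radius i - \<bar>r p j - ball_center i j\<bar>) \<le> r p k * h p}" by blast
    ultimately show ?thesis
      unfolding P_def prod.case by (intro closed_Collect_disj closed_Collect_le continuous_intros) simp
  qed
  have "{p. lies_above V (f p) (h p) (r p)} = (\<Inter>k. \<Inter>e\<in>V k. {p. P k e p})"
    unfolding lies_above_def P_def by auto
  then show ?thesis using cl by (auto intro!: closed_INT)
qed

section \<open>A continuous family of continua\<close>

lemma compact_hilbert_cube: "compact hilbert_cube"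
proof -
  have "hilbert_cube = Pi\<^sub>E UNIV (\<lambda>_. {0..1})" by (auto simp: hilbert_cube_def)
  then show ?thesis using compact_PiE_UNIV[of "{0..1::real}", where 'i = nat] by simp
qed

text \<open>The tube lemma in the form used below: a condition on all points of compact fibres is
  open if the set of violations is closed.\<close>

lemma closedin_projection:
  assumes "closedin (top_of_set (S \<times> T)) G" "compact T"
  shows "closedin (top_of_set S) (fst ` G)"
proof -
  have "compact_space (top_of_set T)" using assms(2) by (simp add: compact_space_subtopology)
  then have "closed_map (prod_topology (top_of_set S) (top_of_set T)) (top_of_set S) fst"
    by (rule Abstract_Topological_Spaces.closed_map_fst)
  moreover have "prod_topology (top_of_set S) (top_of_set T) = top_of_set (S \<times> T)"
    by (simp add: prod_topology_subtopology_eu)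
  ultimately show ?thesis using assms(1) by (simp add: closed_map_def)
qed

text \<open>Coordinate 0 is the position over which the section is taken, coordinate 1 is a constant
  label that will encode the parameters, and the remaining coordinates form the point
  \<open>r\<close> above the functions. The distance to the Cantor set serves as the parameter
  \<open>h\<close>.\<close>

definition epigraph_continuum :: "(nat \<Rightarrow> (nat \<times> rat) set) \<Rightarrow> real \<Rightarrow> (nat \<Rightarrow> bool) \<Rightarrow> (nat \<Rightarrow> real) set" where
  "epigraph_continuum V c x =
     {z \<in> hilbert_cube. z 1 = c \<and> lies_above V x (infdist (z 0) cantor_set) (\<lambda>k. z (Suc (Suc k)))}"

definition cons2 :: "real \<Rightarrow> real \<Rightarrow> (nat \<Rightarrow> real) \<Rightarrow> nat \<Rightarrow> real" where
  "cons2 t c r i = (case i of 0 \<Rightarrow> t | Suc 0 \<Rightarrow> c | Suc (Suc k) \<Rightarrow> r k)"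

lemma cons2_simps [simp]:
  "cons2 t c r 0 = t" "cons2 t c r (Suc 0) = c" "cons2 t c r (Suc (Suc k)) = r k"
  by (simp_all add: cons2_def)

lemma nat_cases2: obtains "i = 0" | "i = Suc 0" | k where "i = Suc (Suc k)"
  by (metis not0_implies_Suc)

lemma cons2_eta: "cons2 (z 0) (z 1) (\<lambda>k. z (Suc (Suc k))) = z"
proof
  fix i show "cons2 (z 0) (z 1) (\<lambda>k. z (Suc (Suc k))) i = z i"
    by (rule nat_cases2[of i]) auto
qed

lemma all_nat2: "(\<forall>i. P i) \<longleftrightarrow> P 0 \<and> P (Suc 0) \<and> (\<forall>k. P (Suc (Suc k)))"
  by (metis nat_cases2)

lemma cons2_in_hilbert_cube: "cons2 t c r \<in> hilbert_cube \<longleftrightarrow> t \<in> {0..1} \<and> c \<in> {0..1} \<and> r \<in> hilbert_cube"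
  using all_nat2[of "\<lambda>i. cons2 t c r i \<in> {0..1}"] by (auto simp: hilbert_cube_def Pi_iff)

lemma continuous_on_cons2:
  assumes "continuous_on S t" "continuous_on S c" "continuous_on S r"
  shows "continuous_on S (\<lambda>p. cons2 (t p) (c p) (r p))"
proof (rule continuous_on_coordinatewise_then_product)
  fix i
  show "continuous_on S (\<lambda>p. cons2 (t p) (c p) (r p) i)"
    by (rule nat_cases2[of i]) (use assms in \<open>auto intro: continuous_on_coordinate\<close>)
qed

lemma mem_epigraph_continuum:
  "cons2 t c r \<in> epigraph_continuum V c' x \<longleftrightarrow>
    c = c' \<and> t \<in> {0..1} \<and> c \<in> {0..1} \<and> r \<in> hilbert_cube \<and> lies_above V x (infdist t cantor_set) r"
  by (auto simp: epigraph_continuum_def cons2_in_hilbert_cube)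

lemma epigraph_continuum_cons2:
  assumes "z \<in> epigraph_continuum V c x"
  obtains t r where "z = cons2 t c r" "t \<in> {0..1}" "r \<in> hilbert_cube" "lies_above V x (infdist t cantor_set) r"
proof (rule that[of "z 0" "\<lambda>k. z (Suc (Suc k))"])
  show "z = cons2 (z 0) c (\<lambda>k. z (Suc (Suc k)))"
    using cons2_eta[of z] assms by (simp add: epigraph_continuum_def)
qed (use assms in \<open>auto simp: epigraph_continuum_def hilbert_cube_def\<close>)

lemma lies_above_one: "lies_above V x h (\<lambda>_. 1)"
  by (auto simp: lies_above_def)

lemma closed_epigraph_continuum_graph:
  assumes c: "continuous_on UNIV c"
  shows "closed {(x, z). z \<in> epigraph_continuum V (c x) x}"
proof -
  have coord: "continuous_on UNIV (\<lambda>p :: (nat \<Rightarrow> bool) \<times> (nat \<Rightarrow> real). snd p i)" for i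
    by (rule continuous_on_coordinate[OF continuous_on_snd[OF continuous_on_id]])
  have cf: "continuous_on UNIV (\<lambda>p :: (nat \<Rightarrow> bool) \<times> (nat \<Rightarrow> real). c (fst p))"
    by (rule continuous_on_compose2[OF c]) (auto intro: continuous_intros)
  have "closed {p :: (nat \<Rightarrow> bool) \<times> (nat \<Rightarrow> real). snd p \<in> hilbert_cube}"
    using closed_vimage[OF compact_imp_closed[OF compact_hilbert_cube], of "snd :: (nat \<Rightarrow> bool) \<times> (nat \<Rightarrow> real) \<Rightarrow> _"]
    by (simp add: continuous_on_snd vimage_def)
  moreover have "closed {p :: (nat \<Rightarrow> bool) \<times> (nat \<Rightarrow> real). snd p 1 = c (fst p)}"
    by (rule closed_Collect_eq[OF coord cf])
  moreover have "closed {p :: (nat \<Rightarrow> bool) \<times> (nat \<Rightarrow> real). lies_above V (fst p) (infdist (snd p 0) cantor_set) (\<lambda>k. snd p (Suc (Suc k)))}"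
    by (intro closed_Collect_lies_above continuous_on_infdist continuous_on_coordinatewise_then_product coord continuous_intros)
  ultimately have "closed ({p :: (nat \<Rightarrow> bool) \<times> (nat \<Rightarrow> real). snd p \<in> hilbert_cube} \<inter> {p. snd p 1 = c (fst p)} \<inter>
      {p. lies_above V (fst p) (infdist (snd p 0) cantor_set) (\<lambda>k. snd p (Suc (Suc k)))})"
    by (intro closed_Int)
  moreover have "{(x, z). z \<in> epigraph_continuum V (c x) x} = {p. snd p \<in> hilbert_cube} \<inter> {p. snd p 1 = c (fst p)} \<inter>
      {p. lies_above V (fst p) (infdist (snd p 0) cantor_set) (\<lambda>k. snd p (Suc (Suc k)))}"
    by (auto simp: epigraph_continuum_def)
  ultimately show ?thesis by simp
qed

lemma compact_epigraph_continuum: "compact (epigraph_continuum V c x)"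
proof -
  have "closed {(x, z). z \<in> epigraph_continuum V c x}"
    by (rule closed_epigraph_continuum_graph) simp
  then have "closed ((\<lambda>z. (x, z)) -` {(x, z). z \<in> epigraph_continuum V c x})"
    by (rule closed_vimage) (intro continuous_intros)
  then have "closed (epigraph_continuum V c x)" by (simp add: vimage_def)
  then have "compact (hilbert_cube \<inter> epigraph_continuum V c x)"
    using compact_hilbert_cube by (intro compact_Int_closed)
  moreover have "hilbert_cube \<inter> epigraph_continuum V c x = epigraph_continuum V c x"
    by (auto simp: epigraph_continuum_def)
  ultimately show ?thesis by simp
qed

text \<open>Raising the coordinates of a point to 1, starting from the last ones, stays above the functions;
  the point is the limit of the points obtained by raising all but finitely many coordinates.\<close>

lemma connected_epigraph_continuum:
  assumes c: "c \<in> {0..1}"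
  shows "connected (epigraph_continuum V c x)"
proof -
  define K where "K = epigraph_continuum V c x"
  define b where "b = cons2 0 c (\<lambda>_. 1)"
  define C where "C = connected_component_set K b"
  have one: "(\<lambda>_. 1) \<in> hilbert_cube" by (simp add: hilbert_cube_def)
  have b: "b \<in> K" using c one by (simp add: K_def b_def mem_epigraph_continuum lies_above_one)
  have join: "q \<in> C" if "p \<in> C" "connected A" "A \<subseteq> K" "p \<in> A" "q \<in> A" for p q A
  proof -
    have "connected_component K p q" using that(2-5) unfolding connected_component_def by blast
    moreover have "connected_component K b p" using that(1) by (simp add: C_def)
    ultimately have "connected_component K b q" by (rule connected_component_trans[rotated])
    then show ?thesis by (simp add: C_def)
  qed
  have "z \<in> C" if "z \<in> K" for z
  proof (rule ccontr)
    assume "z \<notin> C"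
    obtain t r where z: "z = cons2 t c r" and t: "t \<in> {0..1}" and r: "r \<in> hilbert_cube"
      and ab: "lies_above V x (infdist t cantor_set) r"
      using epigraph_continuum_cons2[of z V c x] \<open>z \<in> K\<close> unfolding K_def by blast
    have r01: "0 \<le> r k" "r k \<le> 1" for k using r by (auto simp: hilbert_cube_def Pi_iff)
    \<comment> \<open>Lowering \<open>s\<close> from 1 to \<open>r n\<close> is a path in
      \<open>K\<close> from \<open>w n 1\<close> to \<open>w (Suc n) 1\<close>; the point
      \<open>w 0 1\<close> is joined to \<open>b\<close> by moving coordinate 0 with all entries of
      \<open>r\<close> equal to 1.\<close>
    define w where "w n s = cons2 t c (\<lambda>k. if k < n then r k else if k = n then s else 1)" for n s
    have wK: "w n s \<in> K" if "s \<in> {r n..1}" for n s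
    proof -
      have "(\<lambda>k. if k < n then r k else if k = n then s else 1) \<in> hilbert_cube"
        using that r01 by (auto simp: hilbert_cube_def Pi_iff intro: order_trans[OF r01(1)])
      moreover have "lies_above V x (infdist t cantor_set) (\<lambda>k. if k < n then r k else if k = n then s else 1)"
        by (rule lies_above_raise[OF ab, of n]) (use that in \<open>auto simp: infdist_nonneg\<close>)
      ultimately show ?thesis using t c by (simp add: w_def K_def mem_epigraph_continuum)
    qed
    have wcont: "continuous_on S (w n)" for S n
      unfolding w_def
    proof (intro continuous_on_cons2 continuous_on_const continuous_on_coordinatewise_then_product)
      fix k show "continuous_on S (\<lambda>s. if k < n then r k else if k = n then s else 1)"
        by (cases "k < n"; cases "k = n") (auto intro: continuous_intros)
    qed
    have wC: "w n 1 \<in> C" for n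
    proof (induction n)
      case 0
      have w0: "w 0 1 = cons2 t c (\<lambda>_. 1)"
        unfolding w_def by (rule arg_cong[where f = "cons2 t c"]) auto
      show ?case
      proof (rule join[of b "(\<lambda>s. cons2 s c (\<lambda>_. 1)) ` {0..1}"])
        show "b \<in> C" using b by (simp add: C_def connected_component_refl)
        show "connected ((\<lambda>s. cons2 s c (\<lambda>_. 1)) ` {0..1})"
          by (intro connected_continuous_image continuous_on_cons2 continuous_intros) auto
        show "(\<lambda>s. cons2 s c (\<lambda>_. 1)) ` {0..1} \<subseteq> K"
          using c one by (auto simp: K_def mem_epigraph_continuum lies_above_one)
      qed (use t in \<open>auto simp: b_def w0\<close>)
    next
      case (Suc n)
      have "w (Suc n) 1 = w n (r n)"
        unfolding w_def by (rule arg_cong[where f = "cons2 t c"]) (auto simp: less_Suc_eq)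
      moreover have "w n (r n) \<in> C"
      proof (rule join[OF Suc, of "w n ` {r n..1}"])
        show "connected (w n ` {r n..1})" by (intro connected_continuous_image wcont) simp
        show "w n ` {r n..1} \<subseteq> K" using wK by blast
      qed (use r01 in auto)
      ultimately show ?case by simp
    qed
    \<comment> \<open>The points \<open>w n 1\<close> agree with \<open>z\<close> on longer and
      longer initial segments, so the closed component must contain \<open>z\<close>.\<close>
    have "closed C"
      unfolding C_def K_def
      by (intro closed_connected_component compact_imp_closed compact_epigraph_continuum)
    then have "open (- C)" by (rule open_Compl)
    then obtain n where n: "{y. \<forall>i<n. y i = z i} \<subseteq> - C"
      using open_contains_cylinder[of "- C" z] \<open>z \<notin> C\<close> by blast
    have "w n 1 i = z i" if "i < n" for i
      by (rule nat_cases2[of i]) (use that in \<open>auto simp: w_def z\<close>)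
    then show False using n wC[of n] by blast
  qed
  moreover have "C \<subseteq> K" by (simp add: C_def connected_component_subset)
  ultimately have "K = C" by blast
  moreover have "connected C" by (simp add: C_def connected_connected_component)
  ultimately show ?thesis by (simp add: K_def)
qed

text \<open>The upper half of Vietoris continuity: the parameters whose continuum leaves
  \<open>U\<close> are the projection of a closed set along the compact cube.\<close>

lemma open_epigraph_continuum_subset:
  assumes c: "continuous_on UNIV c" and U: "openin (top_of_set hilbert_cube) U"
  shows "open {x. epigraph_continuum V (c x) x \<subseteq> U}"
proof -
  obtain U' where U': "open U'" "U = hilbert_cube \<inter> U'" using U by (auto simp: openin_open)
  define G where "G = {(x, z). z \<in> epigraph_continuum V (c x) x} \<inter> (UNIV \<times> - U')"
  have "closed G"
    unfolding G_def using closed_epigraph_continuum_graph[OF c] U'(1)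
    by (intro closed_Int closed_Times) auto
  moreover have "G \<subseteq> UNIV \<times> hilbert_cube" by (auto simp: G_def epigraph_continuum_def)
  ultimately have "closedin (top_of_set (UNIV \<times> hilbert_cube)) G" by (simp add: closed_subset)
  then have "closedin (top_of_set UNIV) (fst ` G)" using compact_hilbert_cube by (rule closedin_projection)
  then have "closed (fst ` G)" by simp
  moreover have "- (fst ` G) = {x. epigraph_continuum V (c x) x \<subseteq> U}"
  proof -
    have "x \<in> fst ` G \<longleftrightarrow> \<not> epigraph_continuum V (c x) x \<subseteq> U" for x
    proof -
      have "x \<in> fst ` G \<longleftrightarrow> (\<exists>z. (x, z) \<in> G)" by force
      also have "\<dots> \<longleftrightarrow> (\<exists>z. z \<in> epigraph_continuum V (c x) x \<and> z \<notin> U')" by (simp add: G_def)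
      also have "\<dots> \<longleftrightarrow> \<not> epigraph_continuum V (c x) x \<subseteq> U" by (auto simp: U' epigraph_continuum_def)
      finally show ?thesis .
    qed
    then show ?thesis by blast
  qed
  ultimately show ?thesis by (metis open_Compl)
qed

lemma infdist_cantor_set_eq_0_iff: "infdist t cantor_set = 0 \<longleftrightarrow> t \<in> cantor_set"
  using in_closed_iff_infdist_zero[OF compact_imp_closed[OF compact_cantor_set]] zero_in_cantor_set by blast

text \<open>At a point over the Cantor set the first coordinate is first moved into a nearby gap.
  There the approximating functions vary continuously with the parameter, and raising the
  remaining coordinates a little compensates for their change.\<close>

lemma open_epigraph_continuum_meets:
  assumes c: "continuous_on UNIV c" "\<And>x. c x \<in> {0..1}" and U: "openin (top_of_set hilbert_cube) U"
  shows "open {x. epigraph_continuum V (c x) x \<inter> U \<noteq> {}}"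
proof (rule Topological_Spaces.openI)
  obtain U' where U': "open U'" "U = hilbert_cube \<inter> U'" using U by (auto simp: openin_open)
  fix x assume "x \<in> {x. epigraph_continuum V (c x) x \<inter> U \<noteq> {}}"
  then obtain z where z: "z \<in> epigraph_continuum V (c x) x" "z \<in> U'" using U'(2) by blast
  obtain t0 r where zz: "z = cons2 t0 (c x) r" and t0: "t0 \<in> {0..1}" and r: "r \<in> hilbert_cube"
    and ab0: "lies_above V x (infdist t0 cantor_set) r"
    using epigraph_continuum_cons2[OF z(1)] by metis
  obtain t where t: "t \<in> {0..1}" "t \<notin> cantor_set" "cons2 t (c x) r \<in> U'" "lies_above V x (infdist t cantor_set) r"
  proof (cases "t0 \<in> cantor_set")
    case False
    then show thesis using that t0 ab0 z zz by blast
  next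
    case True
    have "open ((\<lambda>s. cons2 s (c x) r) -` U')"
      by (intro open_vimage[OF U'(1)] continuous_on_cons2 continuous_intros)
    moreover have "t0 \<in> (\<lambda>s. cons2 s (c x) r) -` U'" using z zz by simp
    ultimately obtain e where e: "e > 0" "ball t0 e \<subseteq> (\<lambda>s. cons2 s (c x) r) -` U'"
      by (meson open_contains_ball)
    have "max 0 (t0 - e) < min 1 (t0 + e)" using t0 e(1) by auto
    then obtain s where s: "max 0 (t0 - e) < s" "s < min 1 (t0 + e)" "s \<notin> cantor_set"
      using cantor_set_gap by metis
    have "s \<in> ball t0 e" using s by (auto simp: dist_real_def)
    then have "cons2 s (c x) r \<in> U'" using e(2) by blast
    moreover have "s \<in> {0..1}" using s by simp
    moreover have "infdist t0 cantor_set \<le> infdist s cantor_set"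
      using True infdist_cantor_set_eq_0_iff[of t0] infdist_nonneg[of s cantor_set] by linarith
    then have "lies_above V x (infdist s cantor_set) r" using ab0 r lies_above_mono by blast
    ultimately show thesis using that s(3) by blast
  qed
  define h where "h = infdist t cantor_set"
  have h: "0 < h" "h \<le> 1"
  proof -
    show "0 < h" using t(2) infdist_cantor_set_eq_0_iff[of t] infdist_nonneg[of t cantor_set] unfolding h_def by linarith
    have "h \<le> dist t 0" unfolding h_def by (intro infdist_le zero_in_cantor_set)
    then show "h \<le> 1" using t(1) by (simp add: dist_real_def)
  qed
  \<comment> \<open>The candidate over \<open>y\<close> with shift \<open>e\<close>, continuous in
    the pair \<open>(y, e)\<close> and equal to the given point at \<open>(x, 0)\<close>. One small
    positive shift \<open>d / 2\<close> therefore serves for all \<open>y\<close> within distance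
    \<open>d / 2\<close> of \<open>x\<close>.\<close>
  define Z where "Z p = cons2 t (c (fst p)) (\<lambda>k. min 1 (r k + snd p / h ^ Suc k))" for p
  have "continuous_on UNIV Z"
    unfolding Z_def
  proof (intro continuous_on_cons2 continuous_on_const continuous_on_coordinatewise_then_product)
    show "continuous_on UNIV (\<lambda>p. c (fst p))"
      by (rule continuous_on_compose2[OF c(1)]) (auto intro: continuous_intros)
    show "continuous_on UNIV (\<lambda>p. min 1 (r k + snd p / h ^ Suc k))" for k
      using h by (intro continuous_intros) auto
  qed
  then have "open (Z -` U')" using U'(1) by (intro open_vimage)
  moreover have "(x, 0) \<in> Z -` U'"
  proof -
    have "r k \<le> 1" for k using r by (auto simp: hilbert_cube_def)
    then have "(\<lambda>k. min 1 (r k)) = r" by (simp add: min_absorb2)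
    then show ?thesis using t(3) by (simp add: Z_def)
  qed
  ultimately obtain A B where AB: "open A" "open B" "x \<in> A" "0 \<in> B" "A \<times> B \<subseteq> Z -` U'"
    by (metis mem_Sigma_iff open_prod_elim)
  obtain d where d: "d > 0" "ball 0 d \<subseteq> B" using AB(2,4) by (meson open_contains_ball)
  then have "d / 2 \<in> B" by (auto simp: subset_iff dist_real_def)
  obtain A' where A': "open A'" "x \<in> A'" "\<And>y. y \<in> A' \<Longrightarrow> cantor_dist x y < d / 2"
    using cantor_dist_open_ball[OF half_gt_zero[OF d(1)], of x] by metis
  show "\<exists>T. open T \<and> x \<in> T \<and> T \<subseteq> {x. epigraph_continuum V (c x) x \<inter> U \<noteq> {}}"
  proof (intro exI[of _ "A \<inter> A'"] conjI subsetI CollectI)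
    fix y assume y: "y \<in> A \<inter> A'"
    have "Z (y, d / 2) \<in> U'" using y AB(5) \<open>d / 2 \<in> B\<close> by blast
    moreover have "Z (y, d / 2) \<in> epigraph_continuum V (c y) y"
    proof -
      have "lies_above V y h (\<lambda>k. min 1 (r k + (d / 2) / h ^ Suc k))"
        using t(4) h r d(1) A'(3)[of y] y unfolding h_def by (intro lies_above_perturb) auto
      moreover have "(\<lambda>k. min 1 (r k + (d / 2) / h ^ Suc k)) \<in> hilbert_cube"
        unfolding hilbert_cube_def
      proof (intro Pi_I)
        fix k
        have "0 \<le> r k" using r by (auto simp: hilbert_cube_def)
        moreover have "0 \<le> (d / 2) / h ^ Suc k" using d(1) h by simp
        ultimately show "min 1 (r k + (d / 2) / h ^ Suc k) \<in> {0..1}" by auto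
      qed
      ultimately show ?thesis using t(1) c(2) by (simp add: Z_def mem_epigraph_continuum h_def)
    qed
    ultimately show "epigraph_continuum V (c y) y \<inter> U \<noteq> {}"
      unfolding U'(2) by (auto simp: epigraph_continuum_def)
  qed (use AB A' in auto)
qed

section \<open>Embeddings into the Rubin--Schori--Walsh space\<close>

lemma embedding_map_top_of_set:
  assumes "continuous_on S f" "f ` S \<subseteq> T" "continuous_on (f ` S) g" "\<And>x. x \<in> S \<Longrightarrow> g (f x) = x"
  shows "embedding_map (top_of_set S) (top_of_set T) f"
proof (rule embedding_map_left_inverse[where g = g])
  show "continuous_map (top_of_set S) (top_of_set T) f"
    using assms(1,2) by (auto simp: continuous_map_in_subtopology)
  have "T \<inter> f ` S = f ` S" "g ` f ` S \<subseteq> S" using assms(2,4) by auto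
  then show "continuous_map (subtopology (top_of_set T) (f ` topspace (top_of_set S))) (top_of_set S) g"
    using assms(3) by (simp add: subtopology_subtopology continuous_map_in_subtopology image_subset_iff_funcset)
qed (use assms(4) in simp)

section \<open>Recognizing leftmost points and continuity into the hyperspace\<close>

lemma leftmost_eqI:
  assumes "m \<in> P" "\<And>z n. z \<in> P \<Longrightarrow> (\<And>i. i < n \<Longrightarrow> z i = m i) \<Longrightarrow> m n \<le> z n"
  shows "leftmost P = m"
proof
  fix n show "leftmost P n = m n"
  proof (induction n rule: less_induct)
    case (less n)
    have "leftmost P n = (LEAST t. t \<in> (\<lambda>z. z n) ` {z \<in> P. \<forall>i<n. z i = m i})"
      unfolding leftmost.simps[of P n] using less by (simp cong: conj_cong)
    also have "\<dots> = m n"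
      by (rule Least_equality) (use assms in auto)
    finally show ?case .
  qed
qed

lemma topspace_vietoris_subcontinua: "topspace (vietoris_subcontinua X) = subcontinua X"
proof -
  have "K \<subseteq> topspace X" if "K \<in> subcontinua X" for K
    using that compactin_subset_topspace by (auto simp: subcontinua_def)
  then have "subcontinua X = {K \<in> subcontinua X. K \<subseteq> topspace X}" by blast
  then show ?thesis
    unfolding vietoris_subcontinua_def topology_generated_by_topspace by blast
qed

lemma continuous_map_crossing_continua:
  assumes "\<And>x. x \<in> topspace X \<Longrightarrow> f x \<subseteq> hilbert_cube \<and> compact (f x) \<and> connected (f x) \<and>
      (\<exists>z\<in>f x. z 0 = 0) \<and> (\<exists>z\<in>f x. z 0 = 1)"
    and up: "\<And>U. openin (top_of_set hilbert_cube) U \<Longrightarrow> openin X {x \<in> topspace X. f x \<subseteq> U}"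
    and lo: "\<And>U. openin (top_of_set hilbert_cube) U \<Longrightarrow> openin X {x \<in> topspace X. f x \<inter> U \<noteq> {}}"
  shows "continuous_map X crossing_continua f"
proof -
  have sub: "f x \<in> subcontinua (top_of_set hilbert_cube)" if "x \<in> topspace X" for x
    using assms(1)[OF that] by (auto simp: subcontinua_def compactin_subtopology connectedin_subtopology)
  have "continuous_map X (vietoris_subcontinua (top_of_set hilbert_cube)) f"
    unfolding vietoris_subcontinua_def
  proof (rule continuous_on_generated_topo)
    show "f ` topspace X \<subseteq> \<Union> ({{K \<in> subcontinua (top_of_set hilbert_cube). K \<subseteq> U} | U. openin (top_of_set hilbert_cube) U} \<union>
      {{K \<in> subcontinua (top_of_set hilbert_cube). K \<inter> U \<noteq> {}} | U. openin (top_of_set hilbert_cube) U})"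
      using sub topspace_vietoris_subcontinua[of "top_of_set hilbert_cube"]
      unfolding vietoris_subcontinua_def topology_generated_by_topspace by blast
    fix Q assume "Q \<in> {{K \<in> subcontinua (top_of_set hilbert_cube). K \<subseteq> U} | U. openin (top_of_set hilbert_cube) U} \<union>
      {{K \<in> subcontinua (top_of_set hilbert_cube). K \<inter> U \<noteq> {}} | U. openin (top_of_set hilbert_cube) U}"
    then consider U where "openin (top_of_set hilbert_cube) U" "Q = {K \<in> subcontinua (top_of_set hilbert_cube). K \<subseteq> U}"
      | U where "openin (top_of_set hilbert_cube) U" "Q = {K \<in> subcontinua (top_of_set hilbert_cube). K \<inter> U \<noteq> {}}" by blast
    then show "openin X (f -` Q \<inter> topspace X)"
    proof cases
      case 1
      then have "f -` Q \<inter> topspace X = {x \<in> topspace X. f x \<subseteq> U}" using sub by blast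
      then show ?thesis using up[OF 1(1)] by simp
    next
      case 2
      then have "f -` Q \<inter> topspace X = {x \<in> topspace X. f x \<inter> U \<noteq> {}}" using sub by blast
      then show ?thesis using lo[OF 2(1)] by simp
    qed
  qed
  then show ?thesis
    unfolding crossing_continua_def using assms(1) by (auto simp: continuous_map_in_subtopology)
qed

lemma infdist_cantor_set_zero: "t \<in> cantor_set \<Longrightarrow> infdist t cantor_set = 0"
  by simp

text \<open>Over the Cantor set \<open>h\<close> is 0, so the section consists of the
  \<open>r\<close> above all \<open>J\<close>, and \<open>J_omega\<close> satisfies these
  inequalities with equality. A competitor with the same coordinates before \<open>k\<close> feeds
  the same argument into \<open>J k\<close>. On the right \<open>p\<close> occurs only as coordinate
  0.\<close>

lemma leftmost_epigraph_continuum: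
  assumes p: "p \<in> cantor_set" and c: "c \<in> {0..1}"
  shows "leftmost (epigraph_continuum V c x \<inter> {z. z 0 = p}) = cons2 p c (J_omega V x)"
proof (rule leftmost_eqI)
  have p01: "p \<in> {0..1}" using p cantor_set_subset by blast
  have "lies_above V x 0 (J_omega V x)"
    unfolding lies_above_zero_iff[OF J_omega_in_hilbert_cube] by (simp flip: J_omega_rec)
  then show "cons2 p c (J_omega V x) \<in> epigraph_continuum V c x \<inter> {z. z 0 = p}"
    using p01 c infdist_cantor_set_zero[OF p] J_omega_in_hilbert_cube by (simp add: mem_epigraph_continuum)
  fix z n assume z: "z \<in> epigraph_continuum V c x \<inter> {z. z 0 = p}"
    and eq: "\<And>i. i < n \<Longrightarrow> z i = cons2 p c (J_omega V x) i"
  obtain r where r: "z = cons2 p c r" "r \<in> hilbert_cube" "lies_above V x 0 r"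
    using z infdist_cantor_set_zero[OF p] by (auto elim!: epigraph_continuum_cons2)
  show "cons2 p c (J_omega V x) n \<le> z n"
  proof (rule nat_cases2[of n])
    fix k assume k: "n = Suc (Suc k)"
    have "r j = J_omega V x j" if "j < k" for j
      using eq[of "Suc (Suc j)"] that k r(1) by simp
    then have "map r [0..<k] = map (J_omega V x) [0..<k]" by simp
    then have "J_omega V x k \<le> r k"
      using r(3) unfolding lies_above_zero_iff[OF r(2)] J_omega_rec[of V x k] by metis
    then show ?thesis by (simp add: k r(1))
  qed (simp_all add: r(1))
qed

lemma continuous_on_discrete_domain: "continuous_on UNIV (f :: 'a::discrete_topology \<Rightarrow> 'b::topological_space)"
  by (simp add: continuous_on_open_vimage open_discrete)

text \<open>Admissibility names the continua continuously by points \<open>g x\<close> of the Cantor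
  set; by the previous computation the leftmost point over this name has the required form, whatever
  the name is.\<close>

lemma J_omega_in_RSW:
  assumes \<delta>: "total_cantor_representation crossing_continua \<delta>"
    and c: "continuous_on UNIV c" "\<And>x. c x \<in> {0..1}"
  obtains g where "continuous_on UNIV g" "\<And>x. cons2 (g x) (c x) (J_omega V x) \<in> RSW \<delta>"
proof -
  define K where "K x = epigraph_continuum V (c x) x" for x
  \<comment> \<open>Admissibility speaks about subsets of Baire space, so the family is pulled back
    along \<open>d\<close>, and the names are pulled back along the section \<open>b\<close> of
    \<open>d\<close> below.\<close>
  define d where "d y n \<longleftrightarrow> y n \<noteq> 0" for y :: "nat \<Rightarrow> nat" and n
  have "continuous_map euclidean crossing_continua K"
  proof (rule continuous_map_crossing_continua)
    fix x
    have "cons2 t (c x) (\<lambda>_. 1) \<in> K x" if "t \<in> {0..1}" for t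
      using that c(2) by (simp add: K_def mem_epigraph_continuum lies_above_one hilbert_cube_def)
    from this[of 0] this[of 1]
    have "(\<exists>z\<in>K x. z 0 = 0) \<and> (\<exists>z\<in>K x. z 0 = 1)" by (metis atLeastAtMost_iff cons2_simps(1) order_refl zero_le_one)
    then show "K x \<subseteq> hilbert_cube \<and> compact (K x) \<and> connected (K x) \<and> (\<exists>z\<in>K x. z 0 = 0) \<and> (\<exists>z\<in>K x. z 0 = 1)"
      using compact_epigraph_continuum[of V "c x" x] connected_epigraph_continuum[OF c(2)[of x], of V x]
      unfolding K_def by (simp add: epigraph_continuum_def[of V] subset_iff)
  qed (use open_epigraph_continuum_subset[OF c(1)] open_epigraph_continuum_meets[OF c] in \<open>simp_all add: K_def\<close>)
  moreover have "continuous_on UNIV d"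
  proof (rule continuous_on_coordinatewise_then_product)
    fix n show "continuous_on UNIV (\<lambda>y. d y n)"
      unfolding d_def
      using continuous_on_compose2[OF continuous_on_discrete_domain[of "\<lambda>m :: nat. m \<noteq> 0"] continuous_on_product_coordinates[of n]] by simp
  qed
  then have "continuous_map (top_of_set UNIV) euclidean d" by simp
  ultimately have "continuous_map (top_of_set UNIV) crossing_continua (K \<circ> d)"
    by (rule continuous_map_compose[rotated])
  moreover have "\<forall>(D :: (nat \<Rightarrow> nat) set) f. continuous_map (top_of_set D) crossing_continua f \<longrightarrow>
      (\<exists>g. continuous_map (top_of_set D) (top_of_set cantor_set) g \<and> (\<forall>d\<in>D. f d = \<delta> (g d)))"
    using \<delta> unfolding total_cantor_representation_def by (elim conjE)
  ultimately have "\<exists>g. continuous_map (top_of_set UNIV) (top_of_set cantor_set) g \<and> (\<forall>y\<in>UNIV. (K \<circ> d) y = \<delta> (g y))"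
    by (elim allE impE)
  then obtain g' where g': "continuous_map (top_of_set UNIV) (top_of_set cantor_set) g'" "\<And>y. K (d y) = \<delta> (g' y)"
    by auto
  define b where "b x n = (if x n then 1 else 0 :: nat)" for x :: "nat \<Rightarrow> bool" and n
  have db: "d (b x) = x" for x by (rule ext) (simp add: d_def b_def)
  have contb: "continuous_on UNIV b"
  proof (rule continuous_on_coordinatewise_then_product)
    fix n show "continuous_on UNIV (\<lambda>x. b x n)"
      unfolding b_def
      using continuous_on_compose2[OF continuous_on_discrete_domain[of "\<lambda>m :: bool. if m then 1 else 0 :: nat"] continuous_on_product_coordinates[of n]] by simp
  qed
  have g'C: "g' y \<in> cantor_set" for y using g'(1) by (auto simp: continuous_map_in_subtopology)
  have "continuous_on UNIV g'" using g'(1) by (simp add: continuous_map_in_subtopology)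
  then have "continuous_on UNIV (\<lambda>x. g' (b x))"
    using contb by (rule continuous_on_compose2) simp
  moreover have "cons2 (g' (b x)) (c x) (J_omega V x) \<in> RSW \<delta>" for x
  proof -
    have "\<delta> (g' (b x)) = epigraph_continuum V (c x) x" using g'(2)[of "b x"] by (simp add: db K_def)
    then have "leftmost (\<delta> (g' (b x)) \<inter> {z. z 0 = g' (b x)}) = cons2 (g' (b x)) (c x) (J_omega V x)"
      using leftmost_epigraph_continuum[OF g'C c(2)] by simp
    then show ?thesis unfolding RSW_def using g'C[of "b x"] by force
  qed
  ultimately show thesis by (rule that)
qed

lemma continuous_on_cantor_code_compose:
  assumes "continuous_on S f" "f ` S \<subseteq> cantor_set"
  shows "continuous_on S (\<lambda>p. cantor_code (f p))"
  using continuous_on_compose2[OF continuous_on_cantor_code assms] .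

text \<open>The index \<open>e\<close> cuts the space into countably many pieces. The label in
  coordinate 1 determines \<open>e\<close> and \<open>x\<close>, which gives global injectivity and
  a continuous inverse on each piece. Although \<open>J_omega\<close> may be discontinuous in
  \<open>x\<close>, the map is continuous, because \<open>r\<close> is already part of the
  point.\<close>

lemma sigma_embedding_omega_CEA_RSW:
  assumes \<delta>: "total_cantor_representation crossing_continua \<delta>"
  obtains f where "sigma_embedding (top_of_set (omega_CEA W)) (top_of_set (RSW \<delta>)) f"
proof -
  have "\<exists>g. continuous_on UNIV g \<and> (\<forall>x. cons2 (g x) (cantor_point (tag e x)) (J_omega (W e) x) \<in> RSW \<delta>)" for e
  proof (rule J_omega_in_RSW[OF \<delta>, where c = "\<lambda>x. cantor_point (tag e x)" and V = "W e"])
    show "continuous_on UNIV (\<lambda>x. cantor_point (tag e x))"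
      by (rule continuous_on_compose2[OF continuous_on_cantor_point continuous_on_tag]) auto
  qed (auto simp: cantor_point_bounds)
  then obtain g where g: "\<And>e. continuous_on UNIV (g e)"
    "\<And>e x. cons2 (g e x) (cantor_point (tag e x)) (J_omega (W e) x) \<in> RSW \<delta>" by metis
  define f where "f = (\<lambda>(e, x, r). cons2 (g e x) (cantor_point (tag e x)) r)"
  have f: "f (e, x, r) = cons2 (g e x) (cantor_point (tag e x)) r" for e x r by (simp add: f_def)
  define k where "k e z = (e, (\<lambda>i. cantor_code (z (Suc 0)) (i + Suc e)), (\<lambda>i. z (Suc (Suc i))))" for e :: nat and z :: "nat \<Rightarrow> real"
  have kf: "k e (f (e, x, r)) = (e, x, r)" for e x r
    using tag_cancel[of e x] by (simp add: k_def f)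
  have "sigma_embedding (top_of_set (omega_CEA W)) (top_of_set (RSW \<delta>)) f"
  proof (rule sigma_embedding_countable_cover[where I = UNIV and A = "\<lambda>e. omega_CEA W \<inter> {p. fst p = e}"])
    show "inj_on f (topspace (top_of_set (omega_CEA W)))"
    proof (rule inj_onI)
      fix p q assume "f p = f q"
      moreover obtain e x r e' x' r' where pq: "p = (e, x, r)" "q = (e', x', r')" by (metis prod_cases3)
      ultimately have "cantor_point (tag e x) = cantor_point (tag e' x')"
        unfolding f pq by (metis cons2_simps(2))
      then have "e = e'" using inj_cantor_point by (simp add: inj_eq tag_eq_iff)
      then show "p = q" using \<open>f p = f q\<close> kf[of e x r] kf[of e' x' r'] pq by metis
    qed
    fix e :: nat
    define S where "S = omega_CEA W \<inter> {p. fst p = e}"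
    have SJ: "\<exists>x. p = (e, x, J_omega (W e) x)" if "p \<in> S" for p
      using that by (cases p) (auto simp: S_def omega_CEA_def)
    have "embedding_map (top_of_set S) (top_of_set (RSW \<delta>)) f"
    proof (rule embedding_map_top_of_set[where g = "k e"])
      have "continuous_on S (\<lambda>p. cons2 (g e (fst (snd p))) (cantor_point (tag e (fst (snd p)))) (snd (snd p)))"
      proof (rule continuous_on_cons2)
        show "continuous_on S (\<lambda>p. g e (fst (snd p)))"
          by (rule continuous_on_compose2[OF g(1) continuous_on_fst[OF continuous_on_snd[OF continuous_on_id]]]) simp
        have "continuous_on S (\<lambda>p. tag e (fst (snd p)))"
          by (rule continuous_on_compose2[OF continuous_on_tag[of UNIV] continuous_on_fst[OF continuous_on_snd[OF continuous_on_id]]]) simp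
        then show "continuous_on S (\<lambda>p. cantor_point (tag e (fst (snd p))))"
          by (rule continuous_on_compose2[OF continuous_on_cantor_point[of UNIV]]) auto
      qed (intro continuous_intros)
      then show "continuous_on S f"
        by (rule continuous_on_cong[THEN iffD1, rotated -1]) (auto simp: f_def S_def split: prod.split)
      show "f ` S \<subseteq> RSW \<delta>" using SJ g(2) f by force
      show "k e (f p) = p" if "p \<in> S" for p using SJ[OF that] kf by blast
      have sub: "(\<lambda>z. z (Suc 0)) ` f ` S \<subseteq> cantor_set"
        using SJ f unfolding cantor_set_eq_range by force
      have "continuous_on (f ` S) (\<lambda>z. cantor_code (z (Suc 0)))"
        by (rule continuous_on_cantor_code_compose[OF _ sub])
           (rule continuous_on_coordinate[OF continuous_on_id])
      then have "continuous_on (f ` S) (\<lambda>z i. cantor_code (z (Suc 0)) (i + Suc e))"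
        by (intro continuous_on_coordinatewise_then_product) (rule continuous_on_coordinate)
      moreover have "continuous_on (f ` S) (\<lambda>z i. z (Suc (Suc i)))"
        by (intro continuous_on_coordinatewise_then_product) (rule continuous_on_coordinate[OF continuous_on_id])
      ultimately show "continuous_on (f ` S) (k e)"
        unfolding k_def by (intro continuous_on_Pair continuous_on_const)
    qed
    then show "embedding_map (subtopology (top_of_set (omega_CEA W)) (omega_CEA W \<inter> {p. fst p = e})) (top_of_set (RSW \<delta>)) f"
      by (simp add: S_def subtopology_subtopology)
  qed auto
  then show thesis by (rule that)
qed

text \<open>With empty c.e. sets all values of \<open>J_omega\<close> are 0, and the label
  coordinate alone carries \<open>x\<close>.\<close>

lemma Cantor_space_embeds_in_RSW:
  assumes \<delta>: "total_cantor_representation crossing_continua \<delta>"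
  obtains c :: "(nat \<Rightarrow> bool) \<Rightarrow> nat \<Rightarrow> real" where "embedding_map euclidean (top_of_set (RSW \<delta>)) c"
proof -
  define V :: "nat \<Rightarrow> (nat \<times> rat) set" where "V = (\<lambda>_. {})"
  have J0: "J_omega V x = (\<lambda>_. 0)" for x
    by (rule ext, subst J_omega_rec) (simp add: J_def V_def)
  obtain g where g: "continuous_on UNIV g" "\<And>x. cons2 (g x) (cantor_point x) (J_omega V x) \<in> RSW \<delta>"
    by (rule J_omega_in_RSW[OF \<delta>, where c = cantor_point and V = V])
       (auto simp: cantor_point_bounds continuous_on_cantor_point)
  have "embedding_map (top_of_set UNIV) (top_of_set (RSW \<delta>)) (\<lambda>x. cons2 (g x) (cantor_point x) (\<lambda>_. 0))"
  proof (rule embedding_map_top_of_set[where g = "\<lambda>z. cantor_code (z (Suc 0))"])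
    show "continuous_on UNIV (\<lambda>x. cons2 (g x) (cantor_point x) (\<lambda>_. 0))"
      by (intro continuous_on_cons2 g(1) continuous_on_cantor_point continuous_on_const)
    show "range (\<lambda>x. cons2 (g x) (cantor_point x) (\<lambda>_. 0)) \<subseteq> RSW \<delta>" using g(2) by (auto simp: J0)
    show "continuous_on (range (\<lambda>x. cons2 (g x) (cantor_point x) (\<lambda>_. 0))) (\<lambda>z. cantor_code (z (Suc 0)))"
      by (rule continuous_on_cantor_code_compose[OF continuous_on_coordinate[OF continuous_on_id]])
         (auto simp: cantor_set_eq_range)
  qed simp
  then show thesis using that by simp
qed

text \<open>On the image of \<open>Y\<close> the embedding is inverted; every finite dimensional
  part of the remainder is cut into pieces that embed in the Cantor space, ready to be absorbed by
  the copy \<open>c\<close>.\<close>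

lemma sigma_embedding_Lelek_compactification:
  fixes X :: "'a topology" and Y :: "'b topology" and c :: "(nat \<Rightarrow> bool) \<Rightarrow> 'b"
  assumes lelek: "lelek_compactification Y X \<iota>" and c: "embedding_map euclidean Y c"
  obtains f where "sigma_embedding X Y f"
proof -
  have emb: "embedding_map Y X \<iota>" and sc: "second_countable X" and haus: "Hausdorff_space X"
    and cd: "countable_dimensional_space (subtopology X (topspace X - \<iota> ` topspace Y))"
    using lelek compact_metrizable_imp_second_countable metrizable_imp_Hausdorff_space
    unfolding lelek_compactification_def by blast+
  define A where "A = \<iota> ` topspace Y"
  have AX: "A \<subseteq> topspace X" using embedding_map_image_subset[OF emb] by (simp add: A_def)
  obtain \<kappa> where \<kappa>: "continuous_map (subtopology X A) Y \<kappa>" "\<And>y. y \<in> topspace Y \<Longrightarrow> \<kappa> (\<iota> y) = y"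
    using embedding_map_inverse[OF emb] unfolding A_def by metis
  have emb_\<kappa>: "embedding_map (subtopology X A) Y \<kappa>"
  proof (rule embedding_map_left_inverse[OF \<kappa>(1), where g = \<iota>])
    have "continuous_map Y X \<iota>" using emb continuous_map_piece[of Y UNIV X \<iota> UNIV] by simp
    then have "continuous_map Y (subtopology X A) \<iota>" by (simp add: continuous_map_in_subtopology A_def)
    then show "continuous_map (subtopology Y (\<kappa> ` topspace (subtopology X A))) (subtopology X A) \<iota>"
      by (rule continuous_map_from_subtopology)
  qed (use \<kappa>(2) in \<open>auto simp: A_def\<close>)
  obtain F :: "nat \<Rightarrow> 'a set" where F: "topspace X - A = (\<Union>n. F n)"
    "\<And>n. finite_dimensional_space (subtopology (subtopology X (topspace X - A)) (F n))"
  proof -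
    have "topspace (subtopology X (topspace X - A)) = topspace X - A" by auto
    then show thesis
      using cd that unfolding countable_dimensional_space_def A_def[symmetric] by metis
  qed
  have Fsub: "F n \<subseteq> topspace X - A" for n using F(1) by blast
  have subF: "subtopology (subtopology X (topspace X - A)) (F n) = subtopology X (F n)" for n
    using Fsub[of n] by (simp add: subtopology_subtopology inf.absorb2)
  have "\<exists>\<F>. countable \<F> \<and> \<Union>\<F> = F n \<and>
      (\<forall>B\<in>\<F>. \<exists>e :: 'a \<Rightarrow> nat \<Rightarrow> bool. embedding_map (subtopology X B) euclidean e)" for n
  proof -
    obtain d where "subtopology X (F n) dim_le d"
      using F(2)[of n] unfolding subF finite_dimensional_space_def by blast
    then have "\<exists>\<F>. countable \<F> \<and> \<Union>\<F> = topspace (subtopology X (F n)) \<and>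
        (\<forall>B\<in>\<F>. \<exists>e :: 'a \<Rightarrow> nat \<Rightarrow> bool. embedding_map (subtopology (subtopology X (F n)) B) euclidean e)"
      using second_countable_subtopology[OF sc] Hausdorff_space_subtopology[OF haus]
      by (rule dim_le_imp_countable_union_Cantor_embeddable)
    then obtain \<F> where \<F>: "countable \<F>" "\<Union>\<F> = topspace (subtopology X (F n))"
      "\<And>B. B \<in> \<F> \<Longrightarrow> \<exists>e :: 'a \<Rightarrow> nat \<Rightarrow> bool. embedding_map (subtopology (subtopology X (F n)) B) euclidean e"
      by metis
    have U: "\<Union>\<F> = F n" using \<F>(2) Fsub[of n] by auto
    have "subtopology (subtopology X (F n)) B = subtopology X B" if "B \<in> \<F>" for B
    proof -
      have "F n \<inter> B = B" unfolding U[symmetric] using that by blast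
      then show ?thesis by (simp add: subtopology_subtopology)
    qed
    then show ?thesis using \<F>(1,3) U by metis
  qed
  then obtain \<F> where \<F>: "\<And>n. countable (\<F> n)" "\<And>n. \<Union>(\<F> n) = F n"
    "\<And>n B. B \<in> \<F> n \<Longrightarrow> \<exists>e :: 'a \<Rightarrow> nat \<Rightarrow> bool. embedding_map (subtopology X B) euclidean e"
    by metis
  have "\<Union>(\<Union>n. \<F> n) = (\<Union>n. \<Union>(\<F> n))" by blast
  then have cover: "topspace X - A = \<Union>(\<Union>n. \<F> n)" unfolding F(1) \<F>(2) by (rule sym)
  have "countable (\<Union>n. \<F> n)" using \<F>(1) by simp
  from c emb_\<kappa> AX this cover show thesis
  proof (rule sigma_embedding_absorb_Cantor_pieces)
    fix B assume "B \<in> (\<Union>n. \<F> n)"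
    then obtain n where "B \<in> \<F> n" by blast
    then show "\<exists>e :: 'a \<Rightarrow> nat \<Rightarrow> bool. embedding_map (subtopology X B) euclidean e" by (rule \<F>(3))
  qed (rule that)
qed

section \<open>Computable functions\<close>

inductive_cases computes_elims:
  "computes Zero xs y" "computes Succ xs y" "computes (Proj i) xs y" "computes (Comp f gs) xs y"
  "computes (PrimRec f g) (0 # xs) y" "computes (PrimRec f g) (Suc n # xs) y" "computes (Mu f) xs y"

text \<open>Needed to argue backwards from a halting search: a program that outputs 1 cannot also
  output 0. For \<open>Mu\<close>, the larger of two results would force the test at the smaller one
  to give both 0 and a successor.\<close>

lemma computes_deterministic: "computes f xs y \<Longrightarrow> computes f xs z \<Longrightarrow> y = z"
proof (induction arbitrary: z rule: computes.induct)
  case (comp xs gs ys f w)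
  obtain ys' where ys': "list_all2 (\<lambda>g y. computes g xs y) gs ys'" "computes f ys' z"
    using comp.prems by (rule computes_elims(4))
  have "ys = ys'"
    using comp.IH(1) ys'(1) by (auto simp: list_all2_conv_all_nth intro: nth_equalityI)
  then show ?case using comp.IH(2) ys'(2) by blast
next
  case (prim_rec_0 f xs y g)
  show ?case using prim_rec_0.prems by (rule computes_elims(5)) (rule prim_rec_0.IH)
next
  case (prim_rec_Suc f g n xs y w)
  obtain y' where y': "computes (PrimRec f g) (n # xs) y'" "computes g (n # y' # xs) z"
    using prim_rec_Suc.prems by (rule computes_elims(6))
  have "y = y'" using y'(1) by (rule prim_rec_Suc.IH(1))
  then show ?case using y'(2) prim_rec_Suc.IH(2) by blast
next
  case (mu f n xs)
  have z: "computes f (z # xs) 0" "\<forall>m<z. \<exists>y. computes f (m # xs) (Suc y)"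
    using mu.prems by (rule computes_elims(7), simp)+
  consider "n = z" | "n < z" | "z < n" by linarith
  then show ?case
  proof cases
    case 2
    then show ?thesis using z(2) mu.IH(1) by fastforce
  next
    case 3
    then show ?thesis using z(1) mu.IH(2) by fastforce
  qed
qed (auto elim: computes_elims)

text \<open>Values on lists of other lengths are unconstrained, so HOL functions such as
  \<open>nth\<close> and \<open>tl\<close> can be used directly.\<close>

definition total_recursive :: "nat \<Rightarrow> (nat list \<Rightarrow> nat) \<Rightarrow> bool" where
  "total_recursive n F \<longleftrightarrow> (\<exists>f. \<forall>xs. length xs = n \<longrightarrow> computes f xs (F xs))"

lemma total_recursive_cong:
  assumes "total_recursive n F" "\<And>xs. length xs = n \<Longrightarrow> F xs = G xs"
  shows "total_recursive n G"
  using assms unfolding total_recursive_def by metis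

lemma total_recursive_proj: "i < n \<Longrightarrow> total_recursive n (\<lambda>xs. xs ! i)"
  unfolding total_recursive_def by (intro exI[of _ "Proj i"]) (auto intro: computes.proj)

lemma total_recursive_proj_tl: "i < n \<Longrightarrow> total_recursive (Suc n) (\<lambda>xs. tl xs ! i)"
  by (rule total_recursive_cong[OF total_recursive_proj[of "Suc i"]]) (auto simp: nth_tl)

lemma total_recursive_comp:
  assumes F: "total_recursive (length Gs) F" and Gs: "\<And>G. G \<in> set Gs \<Longrightarrow> total_recursive n G"
  shows "total_recursive n (\<lambda>xs. F (map (\<lambda>G. G xs) Gs))"
proof -
  obtain f where f: "\<And>xs. length xs = length Gs \<Longrightarrow> computes f xs (F xs)"
    using F unfolding total_recursive_def by blast
  obtain g where g: "\<And>G xs. G \<in> set Gs \<Longrightarrow> length xs = n \<Longrightarrow> computes (g G) xs (G xs)"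
    using Gs unfolding total_recursive_def by metis
  have "computes (Comp f (map g Gs)) xs (F (map (\<lambda>G. G xs) Gs))" if "length xs = n" for xs
    by (rule computes.comp[where ys = "map (\<lambda>G. G xs) Gs"])
       (use that f g in \<open>auto simp: list_all2_conv_all_nth\<close>)
  then show ?thesis unfolding total_recursive_def by blast
qed

lemma total_recursive_prim_rec:
  assumes F: "total_recursive n F" and G: "total_recursive (Suc (Suc n)) G" and A: "total_recursive n A"
  shows "total_recursive n (\<lambda>xs. rec_nat (F xs) (\<lambda>m y. G (m # y # xs)) (A xs))"
proof -
  obtain f where f: "\<And>xs. length xs = n \<Longrightarrow> computes f xs (F xs)"
    using F unfolding total_recursive_def by blast
  obtain g where g: "\<And>xs. length xs = Suc (Suc n) \<Longrightarrow> computes g xs (G xs)"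
    using G unfolding total_recursive_def by blast
  have "computes (PrimRec f g) (a # xs) (rec_nat (F xs) (\<lambda>m y. G (m # y # xs)) a)" if "length xs = n" for a xs
    by (induction a) (use that f g in \<open>auto intro: computes.prim_rec_0 computes.prim_rec_Suc\<close>)
  then have "total_recursive (Suc n) (\<lambda>xs. rec_nat (F (tl xs)) (\<lambda>m y. G (m # y # tl xs)) (hd xs))"
    unfolding total_recursive_def by (intro exI[of _ "PrimRec f g"]) (auto simp: length_Suc_conv)
  \<comment> \<open>Composition with \<open>A\<close> and all projections puts the computed
    recursion argument in front of the parameters.\<close>
  then have "total_recursive n (\<lambda>xs. (\<lambda>xs. rec_nat (F (tl xs)) (\<lambda>m y. G (m # y # tl xs)) (hd xs))
      (map (\<lambda>H. H xs) (A # map (\<lambda>i xs. xs ! i) [0..<n])))"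
    using A by (intro total_recursive_comp) (auto intro: total_recursive_proj)
  then show ?thesis
    by (rule total_recursive_cong) (auto simp: comp_def map_nth)
qed

lemma total_recursive_Suc:
  assumes "total_recursive n F" shows "total_recursive n (\<lambda>xs. Suc (F xs))"
proof -
  have "total_recursive (length [F]) (\<lambda>xs. Suc (xs ! 0))"
    unfolding total_recursive_def
    by (intro exI[of _ Succ]) (auto simp: length_Suc_conv intro: computes.succ)
  from total_recursive_comp[OF this, of n] assms show ?thesis by simp
qed

lemma total_recursive_const: "total_recursive n (\<lambda>_. c)"
proof (induction c)
  case 0
  show ?case unfolding total_recursive_def by (intro exI[of _ Zero]) (auto intro: computes.zero)
qed (rule total_recursive_Suc)

lemma total_recursive_pred:
  assumes "total_recursive n F" shows "total_recursive n (\<lambda>xs. F xs - 1)"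
proof -
  have "total_recursive n (\<lambda>xs. rec_nat 0 (\<lambda>m y. (m # y # xs) ! 0) (F xs))"
    by (rule total_recursive_prim_rec[OF total_recursive_const total_recursive_proj assms]) simp
  moreover have "rec_nat 0 (\<lambda>m y. (m # y # xs) ! 0) k = k - 1" for xs k by (cases k) auto
  ultimately show ?thesis by (simp only:)
qed

lemma total_recursive_add:
  assumes "total_recursive n F" "total_recursive n G" shows "total_recursive n (\<lambda>xs. F xs + G xs)"
proof -
  have "total_recursive n (\<lambda>xs. rec_nat (F xs) (\<lambda>m y. Suc ((m # y # xs) ! 1)) (G xs))"
    by (rule total_recursive_prim_rec[OF assms(1) total_recursive_Suc[OF total_recursive_proj] assms(2)]) simp
  moreover have "rec_nat a (\<lambda>m y. Suc ((m # y # xs) ! 1)) k = a + k" for xs a k by (induction k) auto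
  ultimately show ?thesis by (simp only:)
qed

lemma total_recursive_diff:
  assumes "total_recursive n F" "total_recursive n G" shows "total_recursive n (\<lambda>xs. F xs - G xs)"
proof -
  have "total_recursive n (\<lambda>xs. rec_nat (F xs) (\<lambda>m y. (m # y # xs) ! 1 - 1) (G xs))"
    by (rule total_recursive_prim_rec[OF assms(1) total_recursive_pred[OF total_recursive_proj] assms(2)]) simp
  moreover have "rec_nat a (\<lambda>m y. (m # y # xs) ! 1 - 1) k = a - k" for xs a k by (induction k) auto
  ultimately show ?thesis by (simp only:)
qed

text \<open>The step function of a primitive recursion receives the counter and the accumulator
  before the parameters; this recovers functions of the parameters alone.\<close>

lemma total_recursive_drop2:
  assumes "total_recursive n F" shows "total_recursive (Suc (Suc n)) (\<lambda>xs. F (drop 2 xs))"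
proof -
  have "total_recursive (Suc (Suc n)) (\<lambda>xs. F (map (\<lambda>H. H xs) (map (\<lambda>i xs. xs ! Suc (Suc i)) [0..<n])))"
    by (rule total_recursive_comp) (use assms in \<open>auto intro: total_recursive_proj\<close>)
  then show ?thesis
  proof (rule total_recursive_cong)
    fix xs :: "nat list" assume "length xs = Suc (Suc n)"
    then have "map (\<lambda>H. H xs) (map (\<lambda>i xs. xs ! Suc (Suc i)) [0..<n]) = drop 2 xs"
      by (intro nth_equalityI) auto
    then show "F (map (\<lambda>H. H xs) (map (\<lambda>i xs. xs ! Suc (Suc i)) [0..<n])) = F (drop 2 xs)" by simp
  qed
qed

lemma total_recursive_mult:
  assumes "total_recursive n F" "total_recursive n G" shows "total_recursive n (\<lambda>xs. F xs * G xs)"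
proof -
  have "total_recursive n (\<lambda>xs. rec_nat 0 (\<lambda>m y. (m # y # xs) ! 1 + F (drop 2 (m # y # xs))) (G xs))"
    by (rule total_recursive_prim_rec[OF total_recursive_const total_recursive_add[OF total_recursive_proj total_recursive_drop2[OF assms(1)]] assms(2)]) simp
  moreover have "rec_nat 0 (\<lambda>m y. (m # y # xs) ! 1 + F (drop 2 (m # y # xs))) k = F xs * k" for xs k
    by (induction k) auto
  ultimately show ?thesis by (simp only:)
qed

lemma total_recursive_power2:
  assumes "total_recursive n F" shows "total_recursive n (\<lambda>xs. 2 ^ F xs)"
proof -
  have "total_recursive n (\<lambda>xs. rec_nat 1 (\<lambda>m y. (m # y # xs) ! 1 + (m # y # xs) ! 1) (F xs))"
    by (rule total_recursive_prim_rec[OF total_recursive_const total_recursive_add[OF total_recursive_proj total_recursive_proj] assms]) simp_all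
  moreover have "rec_nat 1 (\<lambda>m y. (m # y # xs) ! 1 + (m # y # xs) ! 1) k = (2 ^ k :: nat)" for xs k
    by (induction k) auto
  ultimately show ?thesis by (simp only:)
qed

lemma total_recursive_mod2:
  assumes "total_recursive n F" shows "total_recursive n (\<lambda>xs. F xs mod 2)"
proof -
  have "total_recursive n (\<lambda>xs. rec_nat 0 (\<lambda>m y. 1 - (m # y # xs) ! 1) (F xs))"
    by (rule total_recursive_prim_rec[OF total_recursive_const total_recursive_diff[OF total_recursive_const total_recursive_proj] assms]) simp
  moreover have "rec_nat 0 (\<lambda>m y. 1 - (m # y # xs) ! 1) k = k mod 2" for xs k
    by (induction k) (auto simp: mod_Suc)
  ultimately show ?thesis by (simp only:)
qed

text \<open>\<open>k div 2\<close> counts the odd numbers below \<open>k\<close>, so the recursion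
  adds \<open>m mod 2\<close> at step \<open>m\<close>.\<close>

lemma total_recursive_div2:
  assumes "total_recursive n F" shows "total_recursive n (\<lambda>xs. F xs div 2)"
proof -
  have "total_recursive n (\<lambda>xs. rec_nat 0 (\<lambda>m y. (m # y # xs) ! 1 + (m # y # xs) ! 0 mod 2) (F xs))"
    by (rule total_recursive_prim_rec[OF total_recursive_const total_recursive_add[OF total_recursive_proj total_recursive_mod2[OF total_recursive_proj]] assms]) simp_all
  moreover have "rec_nat 0 (\<lambda>m y. (m # y # xs) ! 1 + (m # y # xs) ! 0 mod 2) k = k div 2" for xs k
  proof (induction k)
    case (Suc k)
    then show ?case by simp presburger
  qed simp
  ultimately show ?thesis by (simp only:)
qed

text \<open>The value 0 stands for truth, as required by the minimization operator.\<close>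

definition decidable :: "nat \<Rightarrow> (nat list \<Rightarrow> bool) \<Rightarrow> bool" where
  "decidable n P \<longleftrightarrow> total_recursive n (\<lambda>xs. if P xs then 0 else 1)"

text \<open>Truncated subtraction gives 0 exactly in the true case, and \<open>1 - (1 - _)\<close>
  turns every positive value into 1.\<close>

lemma decidable_le:
  assumes "total_recursive n F" "total_recursive n G" shows "decidable n (\<lambda>xs. F xs \<le> G xs)"
  unfolding decidable_def
  by (rule total_recursive_cong[of n "\<lambda>xs. 1 - (1 - (F xs - G xs))"])
     (auto intro!: total_recursive_diff total_recursive_const assms)

lemma decidable_not:
  assumes "decidable n P" shows "decidable n (\<lambda>xs. \<not> P xs)"
  unfolding decidable_def
  by (rule total_recursive_cong[of n "\<lambda>xs. 1 - (if P xs then 0 else 1)"])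
     (use assms in \<open>auto intro!: total_recursive_diff total_recursive_const simp: decidable_def\<close>)

lemma decidable_disj:
  assumes "decidable n P" "decidable n Q" shows "decidable n (\<lambda>xs. P xs \<or> Q xs)"
  unfolding decidable_def
  by (rule total_recursive_cong[of n "\<lambda>xs. (if P xs then 0 else 1) * (if Q xs then 0 else 1)"])
     (use assms in \<open>auto intro!: total_recursive_mult simp: decidable_def\<close>)

lemma decidable_conj:
  assumes "decidable n P" "decidable n Q" shows "decidable n (\<lambda>xs. P xs \<and> Q xs)"
  using decidable_not[OF decidable_disj[OF decidable_not[OF assms(1)] decidable_not[OF assms(2)]]] by simp

lemma decidable_less:
  assumes "total_recursive n F" "total_recursive n G" shows "decidable n (\<lambda>xs. F xs < G xs)"
  using decidable_le[OF total_recursive_Suc[OF assms(1)] assms(2)] by (simp add: Suc_le_eq)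

lemma decidable_eq:
  assumes "total_recursive n F" "total_recursive n G" shows "decidable n (\<lambda>xs. F xs = G xs)"
  using decidable_conj[OF decidable_le[OF assms] decidable_le[OF assms(2,1)]] by (simp add: eq_iff)

lemma decidable_even:
  assumes "total_recursive n F" shows "decidable n (\<lambda>xs. even (F xs))"
  using decidable_eq[OF total_recursive_mod2[OF assms] total_recursive_const[of n 0]] by (simp add: even_iff_mod_2_eq_zero)

lemma total_recursive_if:
  assumes "decidable n P" "total_recursive n F" "total_recursive n G"
  shows "total_recursive n (\<lambda>xs. if P xs then F xs else G xs)"
  by (rule total_recursive_cong[of n "\<lambda>xs. F xs * (1 - (if P xs then 0 else 1)) + G xs * (if P xs then 0 else 1)"])
     (use assms in \<open>auto intro!: total_recursive_mult total_recursive_add total_recursive_diff total_recursive_const simp: decidable_def\<close>)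

text \<open>Drops the accumulator but keeps the counter, as the step function of a bounded
  quantifier requires.\<close>

lemma total_recursive_remove_second:
  assumes "total_recursive (Suc n) F" shows "total_recursive (Suc (Suc n)) (\<lambda>xs. F (hd xs # drop 2 xs))"
proof -
  have "total_recursive (Suc (Suc n)) (\<lambda>xs. F (map (\<lambda>H. H xs) ((\<lambda>xs. xs ! 0) # map (\<lambda>i xs. xs ! Suc (Suc i)) [0..<n])))"
    by (rule total_recursive_comp) (use assms in \<open>auto intro: total_recursive_proj\<close>)
  then show ?thesis
  proof (rule total_recursive_cong)
    fix xs :: "nat list" assume "length xs = Suc (Suc n)"
    then obtain a b ys where "xs = a # b # ys" "length ys = n" by (auto simp: length_Suc_conv)
    then have "map (\<lambda>H. H xs) ((\<lambda>xs. xs ! 0) # map (\<lambda>i xs. xs ! Suc (Suc i)) [0..<n]) = hd xs # drop 2 xs"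
      by (auto simp: comp_def map_nth)
    then show "F (map (\<lambda>H. H xs) ((\<lambda>xs. xs ! 0) # map (\<lambda>i xs. xs ! Suc (Suc i)) [0..<n])) = F (hd xs # drop 2 xs)" by simp
  qed
qed

lemma decidable_ball_less:
  assumes "total_recursive n F" and P: "decidable (Suc n) (\<lambda>ys. P (ys ! 0) (tl ys))"
  shows "decidable n (\<lambda>xs. \<forall>j<F xs. P j xs)"
proof -
  define p where "p ys = (if P (ys ! 0) (tl ys) then 0 else 1 :: nat)" for ys
  have p: "total_recursive (Suc n) p" using P unfolding p_def decidable_def .
  \<comment> \<open>The accumulator stays 0 while the predicate holds and is fixed at 1 after the
    first failure.\<close>
  have "total_recursive n (\<lambda>xs. rec_nat 0 (\<lambda>m y. 1 - (1 - ((m # y # xs) ! 1 + p (hd (m # y # xs) # drop 2 (m # y # xs))))) (F xs))"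
    by (rule total_recursive_prim_rec[OF total_recursive_const _ assms(1)])
       (auto intro!: total_recursive_diff total_recursive_const total_recursive_add total_recursive_proj total_recursive_remove_second[OF p])
  moreover have "rec_nat 0 (\<lambda>m y. 1 - (1 - ((m # y # xs) ! 1 + p (hd (m # y # xs) # drop 2 (m # y # xs))))) k = (if \<forall>j<k. P j xs then 0 else 1)" for xs k
    by (induction k) (auto simp: p_def less_Suc_eq)
  ultimately show ?thesis unfolding decidable_def by (simp only:)
qed

section \<open>Primitive recursive decoding of pairs and lists\<close>

text \<open>The number of the diagonal of the pairing function that contains \<open>n\<close>. It
  grows by at most 1 when \<open>n\<close> does, which makes it primitive recursive, and both
  components of \<open>prod_decode\<close> are arithmetic expressions in it.\<close>

fun diagonal_index :: "nat \<Rightarrow> nat" where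
  "diagonal_index 0 = 0"
| "diagonal_index (Suc n) = (if triangle (Suc (diagonal_index n)) \<le> Suc n then Suc (diagonal_index n) else diagonal_index n)"

lemma diagonal_index_bounds: "triangle (diagonal_index n) \<le> n \<and> n < triangle (Suc (diagonal_index n))"
  by (induction n) auto

lemma prod_decode_diagonal_index:
  "fst (prod_decode n) = n - triangle (diagonal_index n)"
  "snd (prod_decode n) = diagonal_index n - (n - triangle (diagonal_index n))"
proof -
  define k m where "k = diagonal_index n" and "m = n - triangle k"
  have "n = triangle k + m" "m \<le> k"
    using diagonal_index_bounds[of n] by (auto simp: k_def m_def)
  then have "prod_decode n = (m, k - m)"
    by (simp add: prod_decode_triangle_add prod_decode_aux.simps)
  then show "fst (prod_decode n) = n - triangle (diagonal_index n)"
    "snd (prod_decode n) = diagonal_index n - (n - triangle (diagonal_index n))"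
    by (simp_all add: k_def m_def)
qed

lemma total_recursive_triangle:
  assumes "total_recursive n F" shows "total_recursive n (\<lambda>xs. triangle (F xs))"
  unfolding triangle_def
  by (intro total_recursive_div2 total_recursive_mult total_recursive_Suc assms)

lemma total_recursive_diagonal_index:
  assumes "total_recursive n F" shows "total_recursive n (\<lambda>xs. diagonal_index (F xs))"
proof -
  have "total_recursive n (\<lambda>xs. rec_nat 0 (\<lambda>m y. if triangle (Suc ((m # y # xs) ! 1)) \<le> Suc ((m # y # xs) ! 0)
      then Suc ((m # y # xs) ! 1) else (m # y # xs) ! 1) (F xs))"
    by (rule total_recursive_prim_rec[OF total_recursive_const _ assms])
       (auto intro!: total_recursive_if decidable_le total_recursive_triangle total_recursive_Suc total_recursive_proj simp del: triangle_Suc)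
  moreover have "rec_nat 0 (\<lambda>m y. if triangle (Suc ((m # y # xs) ! 1)) \<le> Suc ((m # y # xs) ! 0)
      then Suc ((m # y # xs) ! 1) else (m # y # xs) ! 1) k = diagonal_index k" for xs k
    by (induction k) auto
  ultimately show ?thesis by (simp only:)
qed

lemma total_recursive_fst_prod_decode:
  assumes "total_recursive n F" shows "total_recursive n (\<lambda>xs. fst (prod_decode (F xs)))"
  unfolding prod_decode_diagonal_index
  by (intro total_recursive_diff total_recursive_triangle total_recursive_diagonal_index assms)

lemma total_recursive_snd_prod_decode:
  assumes "total_recursive n F" shows "total_recursive n (\<lambda>xs. snd (prod_decode (F xs)))"
  unfolding prod_decode_diagonal_index
  by (intro total_recursive_diff total_recursive_triangle total_recursive_diagonal_index assms)

text \<open>A nonempty list is coded as the successor of the code of the pair of head and tail, so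
  this takes the tail \<open>t\<close> times and then the head. As \<open>0 - 1 = 0\<close> decodes
  to \<open>(0, 0)\<close>, entries beyond the end are 0.\<close>

definition code_nth :: "nat \<Rightarrow> nat \<Rightarrow> nat" where
  "code_nth a t = fst (prod_decode (rec_nat a (\<lambda>_ y. snd (prod_decode (y - 1))) t - 1))"

lemma prod_decode_0: "prod_decode 0 = (0, 0)"
  using prod_encode_inverse[of "(0, 0)"] by (simp add: prod_encode_def)

lemma code_nth_eq: "code_nth a t = (if t < length (list_decode a) then list_decode a ! t else 0)"
proof -
  have tl: "list_decode (snd (prod_decode (y - Suc 0))) = tl (list_decode y)" for y
    by (cases y) (auto simp: prod_decode_0 split: prod.split)
  have "list_decode (rec_nat a (\<lambda>_ y. snd (prod_decode (y - 1))) t) = drop t (list_decode a)"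
    by (induction t) (auto simp: tl drop_Suc tl_drop)
  moreover have "fst (prod_decode (y - Suc 0)) = (if list_decode y = [] then 0 else hd (list_decode y))" for y
    by (cases y) (auto simp: prod_decode_0 split: prod.split)
  ultimately show ?thesis by (simp add: code_nth_def hd_drop_conv_nth)
qed

lemma odd_code_nth_iff: "odd (code_nth a t) \<longleftrightarrow> cantor_center (list_decode a) t"
  by (simp add: code_nth_eq cantor_center_def)

lemma total_recursive_code_nth:
  assumes "total_recursive n F" "total_recursive n G" shows "total_recursive n (\<lambda>xs. code_nth (F xs) (G xs))"
proof -
  have "total_recursive n (\<lambda>xs. rec_nat (F xs) (\<lambda>m y. snd (prod_decode ((m # y # xs) ! 1 - 1))) (G xs))"
    by (rule total_recursive_prim_rec[OF assms(1) _ assms(2)])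
       (auto intro!: total_recursive_snd_prod_decode total_recursive_pred total_recursive_proj simp del: One_nat_def)
  then have "total_recursive n (\<lambda>xs. rec_nat (F xs) (\<lambda>m y. snd (prod_decode (y - 1))) (G xs))" by simp
  then show ?thesis
    unfolding code_nth_def by (intro total_recursive_fst_prod_decode total_recursive_pred)
qed

text \<open>An existential quantifier over a decidable predicate is an unbounded search; the witness
  comes first because \<open>Mu\<close> prepends its search variable.\<close>

lemma decidable_imp_halts:
  assumes "decidable 4 P"
  obtains f where "\<And>a b c. halts f [a, b, c] \<longleftrightarrow> (\<exists>t. P [t, a, b, c])"
proof -
  obtain g where g: "\<And>xs. length xs = 4 \<Longrightarrow> computes g xs (if P xs then 0 else 1)"
    using assms unfolding decidable_def total_recursive_def by blast
  show thesis
  proof (rule that[of "Mu g"])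
    fix a b c
    have g4: "computes g [t, a, b, c] (if P [t, a, b, c] then 0 else 1)" for t by (rule g) simp
    show "halts (Mu g) [a, b, c] \<longleftrightarrow> (\<exists>t. P [t, a, b, c])"
    proof
      assume "halts (Mu g) [a, b, c]"
      then obtain t where "computes g [t, a, b, c] 0"
        unfolding halts_def by (auto elim: computes_elims(7))
      then show "\<exists>t. P [t, a, b, c]"
        using computes_deterministic[OF g4[of t]] by (metis zero_neq_one)
    next
      assume ex: "\<exists>t. P [t, a, b, c]"
      define t where "t = (LEAST t. P [t, a, b, c])"
      have "P [t, a, b, c]" unfolding t_def using ex by (rule LeastI_ex)
      moreover have "\<not> P [m, a, b, c]" if "m < t" for m using that not_less_Least unfolding t_def by blast
      ultimately have "computes (Mu g) [a, b, c] t"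
        using g4 by (intro computes.mu) (metis, metis One_nat_def)
      then show "halts (Mu g) [a, b, c]" unfolding halts_def by blast
    qed
  qed
qed

section \<open>Leftmost points are uniformly left-c.e.\<close>

text \<open>The truncation occurring in \<open>cube_center\<close>. It is 1-Lipschitz, so it
  preserves the grid estimates.\<close>

definition clamp :: "real \<Rightarrow> real" where
  "clamp a = max 0 (min 1 a)"

lemma clamp_Lipschitz: "\<bar>clamp a - clamp b\<bar> \<le> \<bar>a - b\<bar>"
  by (auto simp: clamp_def max_def min_def)

lemma clamp_id: "0 \<le> a \<Longrightarrow> a \<le> 1 \<Longrightarrow> clamp a = a"
  by (auto simp: clamp_def)

lemma nat_to_rat_surj_eq:
  "nat_to_rat_surj l = Fract (int_decode (fst (prod_decode l))) (int_decode (snd (prod_decode l)))"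
  by (simp add: nat_to_rat_surj_def split: prod.split)

lemma int_decode_even: "even n \<Longrightarrow> int_decode n = int (n div 2)"
  by (simp add: int_decode_def sum_decode_def)

lemma abs_int_decode: "\<bar>int_decode n\<bar> = int (Suc n div 2)"
  by (auto simp: int_decode_def sum_decode_def elim!: evenE oddE)

lemma real_of_rat_Fract: "real_of_rat (Fract a b) = real_of_int a / real_of_int b"
  by (cases "b = 0") (auto simp: of_rat_rat rat_number_collapse)

text \<open>The fraction coded by \<open>v\<close> differs from \<open>d / N\<close> by at most
  \<open>1 / N\<close>, with denominators multiplied out. Even codes are those of nonnegative
  integers, namely of half the code; the factor 2 cancels, so no integer has to be decoded. The test
  fails for \<open>v = 0\<close>.\<close>

definition near_grid_point :: "nat \<Rightarrow> nat \<Rightarrow> nat \<Rightarrow> bool" where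
  "near_grid_point v d N \<longleftrightarrow> even (fst (prod_decode v)) \<and> even (snd (prod_decode v)) \<and> 0 < snd (prod_decode v) \<and>
     fst (prod_decode v) * N \<le> Suc d * snd (prod_decode v) \<and>
     d * snd (prod_decode v) \<le> fst (prod_decode v) * N + snd (prod_decode v)"

lemma near_grid_point_imp:
  assumes "near_grid_point v d N" "0 < N"
  shows "\<bar>real_of_rat (nat_to_rat_surj v) - real d / real N\<bar> \<le> 1 / real N"
proof -
  obtain x y where v: "prod_decode v = (2 * x, 2 * y)"
    using assms(1) unfolding near_grid_point_def by (metis evenE prod.collapse)
  have y: "0 < real y" and N: "0 < real N" using assms v by (auto simp: near_grid_point_def)
  have "x * N \<le> Suc d * y" "d * y \<le> x * N + y" using assms(1) v by (auto simp: near_grid_point_def)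
  then have "real (x * N) \<le> real (Suc d * y)" "real (d * y) \<le> real (x * N + y)" by (simp_all only: of_nat_le_iff)
  then have *: "real x * real N \<le> (real d + 1) * real y" "real d * real y \<le> real x * real N + real y"
    by (simp_all add: algebra_simps)
  have "real_of_rat (nat_to_rat_surj v) = real x / real y"
    by (simp add: nat_to_rat_surj_eq v int_decode_even real_of_rat_Fract)
  moreover have "real x / real y \<le> (real d + 1) / real N"
    using * y N by (simp add: divide_le_eq pos_le_divide_eq field_simps)
  moreover have "real d / real N \<le> real x / real y + 1 / real N"
    using * y N by (simp add: field_simps)
  ultimately show ?thesis by (simp add: abs_le_iff add_divide_distrib)
qed

text \<open>The absolute value of the integer coded by \<open>n\<close> is
  \<open>Suc n div 2\<close>. The exceptional case is a zero denominator, for which the rational is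
  0 by convention.\<close>

lemma abs_nat_to_rat_surj_le_iff:
  assumes "0 < N"
  shows "\<bar>real_of_rat (nat_to_rat_surj l)\<bar> * real N \<le> real A \<longleftrightarrow>
    snd (prod_decode l) = 0 \<or> Suc (fst (prod_decode l)) div 2 * N \<le> A * (Suc (snd (prod_decode l)) div 2)"
proof -
  define a b where "a = Suc (fst (prod_decode l)) div 2" and "b = Suc (snd (prod_decode l)) div 2"
  have "\<bar>real_of_rat (nat_to_rat_surj l)\<bar> = real_of_int \<bar>int_decode (fst (prod_decode l))\<bar> / real_of_int \<bar>int_decode (snd (prod_decode l))\<bar>"
    by (simp add: nat_to_rat_surj_eq real_of_rat_Fract)
  then have *: "\<bar>real_of_rat (nat_to_rat_surj l)\<bar> = real a / real b"
    by (simp only: abs_int_decode a_def b_def of_int_of_nat_eq)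
  show ?thesis
  proof (cases "snd (prod_decode l) = 0")
    case False
    then have "0 < real b" by (simp add: b_def)
    then have "real a / real b * real N \<le> real A \<longleftrightarrow> real (a * N) \<le> real (A * b)"
      by (simp add: field_simps)
    then show ?thesis using False * by (simp only: of_nat_le_iff a_def[symmetric] b_def[symmetric] simp_thms)
  qed (use * in \<open>simp add: b_def\<close>)
qed

text \<open>The number \<open>t\<close> codes the tuple of the dimension, a cell of a grid of mesh \<open>1 / scale\<close>,
  the scale, the numerator of a lower bound \<open>value / scale\<close> that is claimed to hold on the cell,
  and a cylinder of the Cantor space.\<close>

definition cmd_dim :: "nat \<Rightarrow> nat" where "cmd_dim t = fst (prod_decode t)"
definition cmd_cell :: "nat \<Rightarrow> nat" where "cmd_cell t = fst (prod_decode (snd (prod_decode t)))"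
definition cmd_scale :: "nat \<Rightarrow> nat" where
  "cmd_scale t = Suc (fst (prod_decode (snd (prod_decode (snd (prod_decode t))))))"
definition cmd_value :: "nat \<Rightarrow> nat" where
  "cmd_value t = fst (prod_decode (snd (prod_decode (snd (prod_decode (snd (prod_decode t)))))))"
definition cmd_cylinder :: "nat \<Rightarrow> nat" where
  "cmd_cylinder t = snd (prod_decode (snd (prod_decode (snd (prod_decode (snd (prod_decode t)))))))"

lemmas cmd_defs = cmd_dim_def cmd_cell_def cmd_scale_def cmd_value_def cmd_cylinder_def

lemma fst_prod_decode_le: "fst (prod_decode n) \<le> n"
  using le_prod_encode_1[of "fst (prod_decode n)" "snd (prod_decode n)"] by simp

lemma snd_prod_decode_le: "snd (prod_decode n) \<le> n"
  using le_prod_encode_2[of "snd (prod_decode n)" "fst (prod_decode n)"] by simp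

text \<open>A ball of radius at most \<open>2 ^ -t\<close>, which is what fixes bit
  \<open>t\<close>, is thus automatically no wider than the mesh of the grid in command
  \<open>t\<close>.\<close>

lemma cmd_scale_le: "cmd_scale t \<le> 2 ^ t"
proof -
  have "fst (prod_decode (snd (prod_decode (snd (prod_decode t))))) \<le> t"
    by (meson fst_prod_decode_le snd_prod_decode_le le_trans)
  also have "t < 2 ^ t" by (rule less_exp)
  finally show ?thesis by (simp add: cmd_scale_def)
qed

text \<open>The command \<open>t\<close> is found in the word of the center of the \<open>i\<close>-th ball, and this ball is
  so small that it fixes the bit \<open>t\<close> and is contained in a neighbourhood of the cell of the command.\<close>

definition authorizes :: "nat \<Rightarrow> nat \<Rightarrow> nat \<Rightarrow> bool" where
  "authorizes t k i \<longleftrightarrow> cmd_dim t = k \<and> odd (code_nth (fst (prod_decode i)) t) \<and>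
     Suc (fst (prod_decode (snd (prod_decode (snd (prod_decode i)))))) * 2 ^ t
       \<le> Suc (snd (prod_decode (snd (prod_decode (snd (prod_decode i)))))) \<and>
     (\<forall>j<k. near_grid_point (code_nth (fst (prod_decode (snd (prod_decode i)))) j) (code_nth (cmd_cell t) j) (cmd_scale t))"

definition command_set :: "nat \<Rightarrow> (nat \<times> rat) set" where
  "command_set k = {(i, q). \<exists>t. authorizes t k i \<and> \<bar>real_of_rat q\<bar> * real (cmd_scale t) \<le> real (cmd_value t)}"

text \<open>The command \<open>t\<close> is the only unbounded quantifier; the rest is integer
  arithmetic and a quantifier bounded by \<open>k\<close>.\<close>

lemma uniformly_ce_command_set: "uniformly_ce command_set"
proof -
  note rec_intros = total_recursive_add total_recursive_mult total_recursive_power2 total_recursive_div2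
    total_recursive_Suc total_recursive_fst_prod_decode total_recursive_snd_prod_decode total_recursive_code_nth
    decidable_conj decidable_disj decidable_not decidable_even decidable_eq decidable_le decidable_less
    total_recursive_proj total_recursive_proj_tl total_recursive_const
  have "decidable 4 (\<lambda>xs. authorizes (xs ! 0) (xs ! 1) (xs ! 2) \<and>
      (snd (prod_decode (xs ! 3)) = 0 \<or>
       Suc (fst (prod_decode (xs ! 3))) div 2 * cmd_scale (xs ! 0) \<le> cmd_value (xs ! 0) * (Suc (snd (prod_decode (xs ! 3))) div 2)))"
    unfolding authorizes_def near_grid_point_def cmd_defs
    by (intro rec_intros decidable_ball_less) simp_all
  then obtain f where f: "\<And>k i l. halts f [k, i, l] \<longleftrightarrow> (\<exists>t. authorizes ([t, k, i, l] ! 0) ([t, k, i, l] ! 1) ([t, k, i, l] ! 2) \<and>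
      (snd (prod_decode ([t, k, i, l] ! 3)) = 0 \<or>
       Suc (fst (prod_decode ([t, k, i, l] ! 3))) div 2 * cmd_scale ([t, k, i, l] ! 0)
         \<le> cmd_value ([t, k, i, l] ! 0) * (Suc (snd (prod_decode ([t, k, i, l] ! 3))) div 2)))"
    by (rule decidable_imp_halts) blast
  have "(i, nat_to_rat_surj l) \<in> command_set k \<longleftrightarrow> halts f [k, i, l]" for k i l
    using abs_nat_to_rat_surj_le_iff[of "cmd_scale _" l] unfolding f
    by (simp add: command_set_def cmd_scale_def[of "_"] numeral_2_eq_2 numeral_3_eq_3)
  then show ?thesis unfolding uniformly_ce_def by blast
qed

section \<open>Leftmost points of compact sets\<close>

text \<open>Compactness gives the minimum at every stage, so each initial segment of
  \<open>leftmost P\<close> is shared by a point of \<open>P\<close>; as \<open>P\<close> is closed,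
  the whole sequence belongs to it.\<close>

lemma leftmost_attained:
  assumes P: "compact P" "P \<noteq> {}"
  shows leftmost_in: "leftmost P \<in> P"
    and leftmost_le: "\<And>w k. w \<in> P \<Longrightarrow> (\<And>i. i < k \<Longrightarrow> w i = leftmost P i) \<Longrightarrow> leftmost P k \<le> w k"
proof -
  define A where "A n = {z \<in> P. \<forall>i<n. z i = leftmost P i}" for n
  have step: "(\<exists>z\<in>A n. z n = leftmost P n) \<and> (\<forall>z\<in>A n. leftmost P n \<le> z n)" if ne: "A n \<noteq> {}" for n
  proof -
    have "A n = P \<inter> (\<Inter>i\<in>{..<n}. {z. z i = leftmost P i})" by (auto simp: A_def)
    moreover have "closed {z :: nat \<Rightarrow> real. z i = leftmost P i}" for i
      by (intro closed_Collect_eq continuous_on_product_coordinates continuous_on_const)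
    ultimately have "compact (A n)" using P(1) by (auto intro!: compact_Int_closed closed_INT)
    then obtain z where z: "z \<in> A n" "\<forall>y\<in>A n. z n \<le> y n"
      using continuous_attains_inf[OF _ ne continuous_on_subset[OF continuous_on_product_coordinates]] by blast
    have "leftmost P n = (LEAST t. t \<in> (\<lambda>z. z n) ` A n)"
      unfolding A_def by (rule leftmost.simps)
    also have "\<dots> = z n" by (rule Least_equality) (use z in auto)
    finally show ?thesis using z by auto
  qed
  have ne: "A n \<noteq> {}" for n
  proof (induction n)
    case 0
    then show ?case using P(2) by (simp add: A_def)
  next
    case (Suc n)
    then obtain z where "z \<in> A n" "z n = leftmost P n" using step by blast
    then have "z \<in> A (Suc n)" by (auto simp: A_def less_Suc_eq)
    then show ?case by blast
  qed
  show "leftmost P \<in> P"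
  proof (rule ccontr)
    assume "leftmost P \<notin> P"
    moreover have "open (- P)" using P(1) by (intro open_Compl compact_imp_closed)
    ultimately obtain n where n: "{y. \<forall>i<n. y i = leftmost P i} \<subseteq> - P"
      using open_contains_cylinder[of "- P" "leftmost P"] by blast
    obtain z where "z \<in> A n" using ne by blast
    then show False using n by (auto simp: A_def)
  qed
  fix w k assume "w \<in> P" "\<And>i. i < k \<Longrightarrow> w i = leftmost P i"
  then have "w \<in> A k" by (auto simp: A_def)
  then show "leftmost P k \<le> w k" using step[OF ne] by blast
qed

lemma J_omega_unique:
  assumes "\<And>k. r k = J k (V k) (x, map r [0..<k])"
  shows "r = J_omega V x"
proof
  fix k show "r k = J_omega V x k"
  proof (induction k rule: less_induct)
    case (less k)
    then have eq: "map r [0..<k] = map (J_omega V x) [0..<k]" by simp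
    show ?case unfolding assms[of k] J_omega_rec[of V x k] eq by (rule refl)
  qed
qed

text \<open>Of the radius \<open>2 / N\<close>, one half is for the distance between the ball center
  and the grid point, the other for the radius of the ball. The grid point is truncated because ball
  centers are.\<close>

definition grid_cell :: "nat \<Rightarrow> nat \<Rightarrow> nat \<Rightarrow> (nat \<Rightarrow> real) set" where
  "grid_cell k d N = {w. \<forall>j<k. \<bar>w j - clamp (real (code_nth d j) / real N)\<bar> \<le> 2 / real N}"

definition coded_cylinder :: "nat \<Rightarrow> (nat \<Rightarrow> bool) set" where
  "coded_cylinder s = {y. \<forall>i<length (list_decode s). y i = odd (list_decode s ! i)}"

lemma clopen_coded_cylinder: "open (coded_cylinder s)" "closed (coded_cylinder s)"
proof -
  show "open (coded_cylinder s)" unfolding coded_cylinder_def by (rule open_cylinder)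
  have "- coded_cylinder s = (\<Union>i\<in>{..<length (list_decode s)}. {y. y i = even (list_decode s ! i)})"
    by (auto simp: coded_cylinder_def)
  then have "open (- coded_cylinder s)" by (simp only:) (intro open_UN ballI open_coordinate_eq)
  then show "closed (coded_cylinder s)" by (simp only: open_closed double_complement)
qed

lemma open_contains_coded_cylinder:
  assumes "open V" "x \<in> V"
  obtains s where "x \<in> coded_cylinder s" "coded_cylinder s \<subseteq> V"
proof -
  obtain n where n: "{y. \<forall>i<n. y i = x i} \<subseteq> V" using open_contains_cylinder[OF assms] .
  have "coded_cylinder (list_encode (map (\<lambda>i. of_bool (x i)) [0..<n])) = {y. \<forall>i<n. y i = x i}"
    by (auto simp: coded_cylinder_def)
  then show thesis using n that[of "list_encode (map (\<lambda>i. of_bool (x i)) [0..<n])"] by blast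
qed

text \<open>A closed subset of the product of the Cantor space with the Hilbert cube, seen as a family of
  compact sets \<open>P x\<close>. The function \<open>true_commands\<close> lists the valid commands, so that the leftmost points become
  uniformly left-c.e. relative to it.\<close>

locale closed_family =
  fixes P :: "(nat \<Rightarrow> bool) \<Rightarrow> (nat \<Rightarrow> real) set"
  assumes closed_graph: "closed {(x, w). w \<in> P x}"
    and subset_cube: "P x \<subseteq> hilbert_cube"
    and nonempty: "P x \<noteq> {}"
begin

definition guaranteed :: "nat \<Rightarrow> nat \<Rightarrow> nat \<Rightarrow> nat \<Rightarrow> (nat \<Rightarrow> bool) set" where
  "guaranteed k d N A = {x. \<forall>w \<in> P x. w \<in> grid_cell k d N \<longrightarrow> real A / real N < w k}"

text \<open>Being guaranteed is only an open condition on \<open>x\<close>. Relative to a cylinder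
  inside the open set it becomes clopen, so every bit is continuous; as each point of an open set
  has such a cylinder, no bound is lost.\<close>

definition true_commands :: "(nat \<Rightarrow> bool) \<Rightarrow> nat \<Rightarrow> bool" where
  "true_commands x t \<longleftrightarrow> x \<in> coded_cylinder (cmd_cylinder t) \<and>
     coded_cylinder (cmd_cylinder t) \<subseteq> guaranteed (cmd_dim t) (cmd_cell t) (cmd_scale t) (cmd_value t)"

lemma compact_P: "compact (P x)"
proof -
  have "closed ((\<lambda>w. (x, w)) -` {(x, w). w \<in> P x})"
    using closed_graph by (rule closed_vimage) (intro continuous_intros)
  then have "closed (P x)" by (simp add: vimage_def)
  then have "compact (hilbert_cube \<inter> P x)" by (intro compact_Int_closed compact_hilbert_cube)
  then show ?thesis using subset_cube[of x] by (simp add: inf.absorb2)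
qed

text \<open>The violations form a closed set because the cell is closed and the bound is strict;
  they are projected along the compact cube.\<close>

lemma open_guaranteed: "open (guaranteed k d N A)"
proof -
  define G where "G = {(x, w). w \<in> P x} \<inter> {p. (\<forall>j<k. \<bar>snd p j - clamp (real (code_nth d j) / real N)\<bar> \<le> 2 / real N)} \<inter> {p. snd p k \<le> real A / real N}"
  have coord: "continuous_on UNIV (\<lambda>p :: (nat \<Rightarrow> bool) \<times> (nat \<Rightarrow> real). snd p i)" for i
    by (rule continuous_on_coordinate[OF continuous_on_snd[OF continuous_on_id]])
  have "{p :: (nat \<Rightarrow> bool) \<times> (nat \<Rightarrow> real). (\<forall>j<k. \<bar>snd p j - clamp (real (code_nth d j) / real N)\<bar> \<le> 2 / real N)} =
      (\<Inter>j\<in>{..<k}. {p. \<bar>snd p j - clamp (real (code_nth d j) / real N)\<bar> \<le> 2 / real N})" by blast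
  also have "closed \<dots>"
    by (intro closed_INT ballI closed_Collect_le continuous_on_rabs continuous_on_diff coord continuous_on_const)
  finally have cell: "closed {p :: (nat \<Rightarrow> bool) \<times> (nat \<Rightarrow> real). \<forall>j<k. \<bar>snd p j - clamp (real (code_nth d j) / real N)\<bar> \<le> 2 / real N}" .
  have "closed {p :: (nat \<Rightarrow> bool) \<times> (nat \<Rightarrow> real). snd p k \<le> real A / real N}"
    by (intro closed_Collect_le coord continuous_on_const)
  then have "closed G" unfolding G_def by (intro closed_Int closed_graph cell)
  moreover have "G \<subseteq> UNIV \<times> hilbert_cube" using subset_cube by (auto simp: G_def)
  ultimately have "closedin (top_of_set (UNIV \<times> hilbert_cube)) G" by (simp add: closed_subset)
  then have "closedin (top_of_set UNIV) (fst ` G)" using compact_hilbert_cube by (rule closedin_projection)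
  then have "closed (fst ` G)" by simp
  moreover have "- (fst ` G) = guaranteed k d N A"
  proof -
    have "x \<in> fst ` G \<longleftrightarrow> x \<notin> guaranteed k d N A" for x
    proof -
      have "x \<in> fst ` G \<longleftrightarrow> (\<exists>w. (x, w) \<in> G)" by force
      also have "\<dots> \<longleftrightarrow> x \<notin> guaranteed k d N A" by (auto simp: G_def guaranteed_def grid_cell_def not_less)
      finally show ?thesis .
    qed
    then show ?thesis by blast
  qed
  ultimately show ?thesis by (metis open_Compl)
qed

lemma continuous_on_true_commands: "continuous_on UNIV true_commands"
proof (rule continuous_on_coordinatewise_then_product)
  fix t
  show "continuous_on UNIV (\<lambda>x. true_commands x t)"
  proof (cases "coded_cylinder (cmd_cylinder t) \<subseteq> guaranteed (cmd_dim t) (cmd_cell t) (cmd_scale t) (cmd_value t)")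
    case True
    then have eq: "(\<lambda>x. true_commands x t) = (\<lambda>x. x \<in> coded_cylinder (cmd_cylinder t))" by (auto simp: true_commands_def)
    show ?thesis
      unfolding eq using continuous_map_clopen_membership[of euclidean "coded_cylinder (cmd_cylinder t)"] clopen_coded_cylinder by simp
  next
    case False
    then have eq: "(\<lambda>x. true_commands x t) = (\<lambda>x. False)" by (auto simp: true_commands_def)
    show ?thesis unfolding eq by simp
  qed
qed

text \<open>A ball authorizing \<open>t\<close> has radius at most \<open>2 ^ -t\<close>, so the bit
  \<open>t\<close> in the word of its center is also a bit of \<open>true_commands x\<close>, and
  the command is valid at \<open>x\<close>. The same radius puts \<open>r\<close> into the cell of
  the command, hence its bound applies to \<open>r k\<close>.\<close>

lemma command_set_sound:
  assumes r: "r \<in> P x"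
  shows "J k (command_set k) (true_commands x, map r [0..<k]) \<le> r k"
proof -
  have rc: "r \<in> hilbert_cube" using r subset_cube by blast
  have rk: "0 \<le> r k" using rc by (auto simp: hilbert_cube_def)
  show ?thesis
    unfolding J_le_iff[OF rc rk]
  proof clarify
    fix i q assume iq: "(i, q) \<in> command_set k" and d: "cantor_dist (true_commands x) (ball_word i) < ball_radius i"
      and b: "\<forall>j<k. \<bar>r j - ball_center i j\<bar> < ball_radius i"
    obtain t where t: "authorizes t k i" "\<bar>real_of_rat q\<bar> * real (cmd_scale t) \<le> real (cmd_value t)"
      using iq by (auto simp: command_set_def)
    define N where "N = cmd_scale t"
    have N: "0 < real N" "real N \<le> 2 ^ t"
    proof -
      have "real N \<le> real (2 ^ t)" unfolding N_def of_nat_le_iff by (rule cmd_scale_le)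
      then show "real N \<le> 2 ^ t" by simp
    qed (simp add: N_def cmd_scale_def)
    have "ball_radius i \<le> (1/2) ^ t"
    proof -
      define m n where "m = fst (prod_decode (snd (prod_decode (snd (prod_decode i)))))"
        and "n = snd (prod_decode (snd (prod_decode (snd (prod_decode i)))))"
      have "Suc m * 2 ^ t \<le> Suc n" using t(1) by (simp add: authorizes_def m_def n_def)
      then have "real (Suc m * 2 ^ t) \<le> real (Suc n)" by (simp only: of_nat_le_iff)
      then have "real (Suc m) * 2 ^ t \<le> real (Suc n)" by (simp only: of_nat_mult of_nat_power of_nat_numeral)
      then have "real (Suc m) / real (Suc n) \<le> 1 / 2 ^ t" by (simp add: pos_divide_le_eq pos_le_divide_eq del: of_nat_Suc)
      then have "real (Suc m) / real (Suc n) \<le> (1/2) ^ t" by (simp add: power_divide)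
      then show ?thesis by (simp add: ball_radius_def Let_def m_def n_def)
    qed
    then have "cantor_dist (true_commands x) (ball_word i) < (1/2) ^ t" using d by simp
    then have "true_commands x t = ball_word i t" by (rule cantor_dist_less_imp_agree) simp
    then have "true_commands x t" using t(1) by (simp add: authorizes_def ball_word_def odd_code_nth_iff)
    then have x: "x \<in> guaranteed (cmd_dim t) (cmd_cell t) (cmd_scale t) (cmd_value t)"
      by (auto simp: true_commands_def)
    have "r \<in> grid_cell k (cmd_cell t) N"
      unfolding grid_cell_def
    proof (intro CollectI allI impI)
      fix j assume j: "j < k"
      define v where "v = code_nth (fst (prod_decode (snd (prod_decode i)))) j"
      have near: "near_grid_point v (code_nth (cmd_cell t) j) N"
        using t(1) j by (simp add: authorizes_def v_def N_def)
      \<comment> \<open>A nonzero entry cannot be the default value beyond the end of the list, so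
        the center coordinate really is the coded rational.\<close>
      have "v \<noteq> 0"
      proof
        assume "v = 0"
        then show False using near by (simp add: near_grid_point_def prod_decode_0)
      qed
      then have len: "j < length (list_decode (fst (prod_decode (snd (prod_decode i)))))"
        by (auto simp: v_def code_nth_eq split: if_splits)
      have "ball_center i j = clamp (real_of_rat (nat_to_rat_surj v))"
        using len by (simp add: ball_center_def cube_center_def clamp_def v_def code_nth_eq)
      moreover have "\<bar>clamp (real_of_rat (nat_to_rat_surj v)) - clamp (real (code_nth (cmd_cell t) j) / real N)\<bar> \<le> 1 / real N"
        using clamp_Lipschitz near_grid_point_imp[OF near] N(1) by (meson of_nat_0_less_iff order_trans)
      moreover have "ball_radius i \<le> 1 / real N"
      proof -
        have "(1/2) ^ t \<le> 1 / real N" using N by (simp add: power_divide frac_le)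
        then show ?thesis using \<open>ball_radius i \<le> (1/2) ^ t\<close> by simp
      qed
      moreover have "\<bar>r j - ball_center i j\<bar> < ball_radius i" using b j by blast
      ultimately have "\<bar>r j - clamp (real (code_nth (cmd_cell t) j) / real N)\<bar> \<le> 1 / real N + 1 / real N" by linarith
      then show "\<bar>r j - clamp (real (code_nth (cmd_cell t) j) / real N)\<bar> \<le> 2 / real N" by simp
    qed
    then have "real (cmd_value t) / real N < r k"
      using x r t(1) by (simp add: guaranteed_def authorizes_def N_def)
    moreover have "\<bar>real_of_rat q\<bar> \<le> real (cmd_value t) / real N"
      using t(2) N(1) by (simp add: N_def pos_le_divide_eq)
    ultimately show "min \<bar>real_of_rat q\<bar> 1 \<le> r k" by linarith
  qed
qed

text \<open>Points of \<open>P x\<close> with \<open>w k \<le> v\<close> cannot share the first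
  \<open>k\<close> coordinates of the leftmost point. They form a compact set, so their distance
  from it in these coordinates has a positive lower bound.\<close>

lemma leftmost_coordinate_bound:
  assumes v: "v < leftmost (P x) k"
  obtains e where "0 < e" "\<And>w. w \<in> P x \<Longrightarrow> (\<And>j. j < k \<Longrightarrow> \<bar>w j - leftmost (P x) j\<bar> \<le> e) \<Longrightarrow> v < w k"
proof -
  define Q where "Q = P x \<inter> {w. w k \<le> v}"
  define f where "f w = (\<Sum>j<k. \<bar>w j - leftmost (P x) j\<bar>)" for w :: "nat \<Rightarrow> real"
  have "compact Q"
    unfolding Q_def
    by (intro compact_Int_closed compact_P closed_Collect_le continuous_on_product_coordinates continuous_on_const)
  have f: "continuous_on Q f"
    unfolding f_def
    by (intro continuous_on_sum continuous_on_rabs continuous_on_diff continuous_on_const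
        continuous_on_subset[OF continuous_on_product_coordinates subset_UNIV])
  have pos: "0 < f w" if "w \<in> Q" for w
  proof (rule ccontr)
    assume "\<not> 0 < f w"
    moreover have "0 \<le> f w" unfolding f_def by (intro sum_nonneg) simp
    ultimately have "f w = 0" by simp
    then have "\<forall>j\<in>{..<k}. \<bar>w j - leftmost (P x) j\<bar> = 0"
      unfolding f_def by (subst (asm) sum_nonneg_eq_0_iff) auto
    then have "leftmost (P x) k \<le> w k"
      using that leftmost_le[OF compact_P nonempty, of w x k] by (simp add: Q_def)
    then show False using that v by (simp add: Q_def)
  qed
  obtain m where m: "0 < m" "\<And>w. w \<in> Q \<Longrightarrow> m \<le> f w"
  proof (cases "Q = {}")
    case False
    then obtain w where "w \<in> Q" "\<forall>y\<in>Q. f w \<le> f y"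
      using continuous_attains_inf[OF \<open>compact Q\<close> False f] by blast
    then show thesis using pos[of w] by (intro that[of "f w"]) auto
  qed (auto intro: that[of 1])
  show thesis
  \<comment> \<open>Dividing by \<open>Suc k\<close> keeps the sum of \<open>k\<close> terms
    strictly below \<open>m\<close> and covers \<open>k = 0\<close>.\<close>
  proof (rule that[of "m / real (Suc k)"])
    show "0 < m / real (Suc k)" using m(1) by simp
    fix w assume w: "w \<in> P x" "\<And>j. j < k \<Longrightarrow> \<bar>w j - leftmost (P x) j\<bar> \<le> m / real (Suc k)"
    have "f w \<le> (\<Sum>j<k. m / real (Suc k))" unfolding f_def by (rule sum_mono) (use w(2) in simp)
    also have "\<dots> = real k * (m / real (Suc k))" by simp
    also have "\<dots> < m" using m(1) by (simp add: field_simps)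
    finally show "v < w k" using m(2)[of w] w(1) by (force simp: Q_def)
  qed
qed

lemma floor_grid:
  assumes "0 \<le> (a::real)" "0 < N"
  shows "real (nat \<lfloor>a * real N\<rfloor>) \<le> a * real N" "a * real N < real (nat \<lfloor>a * real N\<rfloor>) + 1"
  using assms by (auto simp: of_nat_nat) 

text \<open>For a bound below the leftmost coordinate, a valid command \<open>t\<close> is
  constructed first; then a ball around the point, so small that it authorizes
  \<open>t\<close>.\<close>

lemma command_set_complete:
  fixes x k
  defines "r \<equiv> leftmost (P x)"
  assumes v: "0 \<le> v" "v < r k"
  shows "v \<le> J k (command_set k) (true_commands x, map r [0..<k])"
proof -
  have rP: "r \<in> P x" unfolding r_def by (rule leftmost_in[OF compact_P nonempty])
  then have rc: "r \<in> hilbert_cube" using subset_cube by blast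
  have r01: "0 \<le> r j" "r j \<le> 1" for j using rc by (auto simp: hilbert_cube_def)
  \<comment> \<open>The midpoint leaves room to round down: the value \<open>A / N\<close> announced
    by the command will lie between \<open>v\<close> and \<open>v'\<close>.\<close>
  define v' where "v' = (v + r k) / 2"
  have v': "v < v'" "v' < r k" using v by (auto simp: v'_def)
  obtain e where e: "0 < e" "\<And>w. w \<in> P x \<Longrightarrow> (\<And>j. j < k \<Longrightarrow> \<bar>w j - r j\<bar> \<le> e) \<Longrightarrow> v' < w k"
    using leftmost_coordinate_bound[of v' x k] v'(2) unfolding r_def by metis
  \<comment> \<open>Three units of \<open>1 / N\<close> must fit into \<open>e\<close>: two for the
    cell radius and one for rounding \<open>r\<close> to the grid.\<close>
  have "0 < min (e / 3) (v' - v)" using e(1) v'(1) by simp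
  then obtain h where h: "inverse (real (Suc h)) < min (e / 3) (v' - v)" using reals_Archimedean by blast
  define N where "N = Suc h"
  have N: "0 < real N" "0 < N" "1 / real N < e / 3" "1 / real N < v' - v"
    using h by (auto simp: N_def inverse_eq_divide)
  define D where "D j = nat \<lfloor>r j * real N\<rfloor>" for j
  have D: "real (D j) \<le> r j * real N" "r j * real N < real (D j) + 1" for j
    unfolding D_def using floor_grid[OF r01(1) N(2)] by auto
  define d where "d = list_encode (map D [0..<k])"
  have dj: "code_nth d j = D j" if "j < k" for j using that by (simp add: d_def code_nth_eq)
  define A where "A = nat \<lfloor>v' * real N\<rfloor>"
  have A: "real A \<le> v' * real N" "v' * real N < real A + 1"
    unfolding A_def using floor_grid[of v' N] v(1) v'(1) N(2) by auto
  have AN: "real A / real N \<le> v'" "v \<le> real A / real N"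
  proof -
    show "real A / real N \<le> v'" using A(1) N(1) by (simp add: pos_divide_le_eq)
    have "v' \<le> real A / real N + 1 / real N" using A(2) N(1) by (simp add: field_simps)
    then show "v \<le> real A / real N" using N(4) by linarith
  qed
  have Dr: "\<bar>clamp (real (D j) / real N) - r j\<bar> \<le> 1 / real N" for j
  proof -
    have le: "real (D j) / real N \<le> r j" using D(1)[of j] N(1) by (simp add: pos_divide_le_eq)
    then have "clamp (real (D j) / real N) = real (D j) / real N"
      using r01(2)[of j] by (intro clamp_id) auto
    moreover have "r j \<le> real (D j) / real N + 1 / real N" using D(2)[of j] N(1) by (simp add: field_simps)
    ultimately show ?thesis using le by linarith
  qed
  have "x \<in> guaranteed k d N A"
    unfolding guaranteed_def
  proof (intro CollectI ballI impI)
    fix w assume w: "w \<in> P x" "w \<in> grid_cell k d N"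
    have "\<bar>w j - r j\<bar> \<le> e" if "j < k" for j
    proof -
      have "\<bar>w j - clamp (real (D j) / real N)\<bar> \<le> 2 / real N"
        using w(2) that by (simp add: grid_cell_def dj)
      then have "\<bar>w j - r j\<bar> \<le> 2 * (1 / real N) + 1 / real N" using Dr[of j] by simp
      then show ?thesis using N(3) by linarith
    qed
    then have "v' < w k" using e(2)[OF w(1)] by blast
    then show "real A / real N < w k" using AN(1) by linarith
  qed
  then obtain s where s: "x \<in> coded_cylinder s" "coded_cylinder s \<subseteq> guaranteed k d N A"
    using open_contains_coded_cylinder[OF open_guaranteed] by metis
  define t where "t = prod_encode (k, prod_encode (d, prod_encode (h, prod_encode (A, s))))"
  have t: "cmd_dim t = k" "cmd_cell t = d" "cmd_scale t = N" "cmd_value t = A" "cmd_cylinder t = s"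
    by (simp_all add: cmd_defs t_def N_def)
  have on: "true_commands x t" using s by (simp add: true_commands_def t)
  \<comment> \<open>The ball gets radius \<open>1 / M\<close>, and rounding \<open>r\<close> down to
    multiples of \<open>1 / M\<close> gives an error strictly below this radius.
    \<open>N \<le> M\<close> makes the rounded center near the grid point of the cell.\<close>
  define M :: nat where "M = 2 ^ t"
  have M: "0 < real M" "0 < M" "N \<le> M" "real M = 2 ^ t"
    using cmd_scale_le[of t] by (simp_all add: M_def t)
  define B where "B j = nat \<lfloor>r j * real M\<rfloor>" for j
  have B: "real (B j) \<le> r j * real M" "r j * real M < real (B j) + 1" for j
    unfolding B_def using floor_grid[OF r01(1) M(2)] by auto
  \<comment> \<open>Distance below \<open>(1/2) ^ t\<close> means agreement in the bits from 0 to
    \<open>t\<close>, hence \<open>Suc t\<close> bits. The entries \<open>2 * B j\<close> and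
    \<open>2 * M\<close> are the integer codes of \<open>B j\<close> and \<open>M\<close>, and
    \<open>(0, M - 1)\<close> codes the radius \<open>1 / M\<close>.\<close>
  define a where "a = list_encode (map (\<lambda>i. of_bool (true_commands x i)) [0..<Suc t])"
  define c where "c = list_encode (map (\<lambda>j. prod_encode (2 * B j, 2 * M)) [0..<k])"
  define i where "i = prod_encode (a, prod_encode (c, prod_encode (0, M - 1)))"
  have word: "ball_word i j = true_commands x j" if "j \<le> t" for j
    using that by (auto simp: ball_word_def i_def cantor_center_def a_def simp del: upt_Suc)
  have radius: "ball_radius i = (1/2) ^ t"
    using M(2) by (simp add: ball_radius_def i_def Let_def M_def power_divide)
  have center: "ball_center i j = real (B j) / real M" if "j < k" for j
  proof -
    have "real (B j) / real M \<le> r j" using B(1)[of j] M(1) by (simp add: pos_divide_le_eq)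
    then have "clamp (real (B j) / real M) = real (B j) / real M" using r01(2)[of j] by (intro clamp_id) auto
    then show ?thesis
      using that by (simp add: ball_center_def cube_center_def i_def c_def nat_to_rat_surj_eq int_decode_even real_of_rat_Fract clamp_def)
  qed
  have "near_grid_point (code_nth c j) (code_nth d j) N" if j: "j < k" for j
  proof -
    have "real (B j) * real N \<le> (r j * real M) * real N" using B(1) by (rule mult_right_mono) simp
    also have "\<dots> = (r j * real N) * real M" by simp
    also have "\<dots> \<le> (real (D j) + 1) * real M" using D(2)[of j] by (intro mult_right_mono) auto
    finally have "real (B j * N) \<le> real (Suc (D j) * M)" by (simp add: algebra_simps)
    then have 1: "B j * N \<le> Suc (D j) * M" by (simp only: of_nat_le_iff)
    have "real (D j) * real M \<le> (r j * real N) * real M" using D(1) by (rule mult_right_mono) simp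
    also have "\<dots> = (r j * real M) * real N" by simp
    also have "\<dots> \<le> (real (B j) + 1) * real N" using B(2)[of j] by (intro mult_right_mono) auto
    also have "\<dots> \<le> real (B j) * real N + real M" using M(3) by (simp add: algebra_simps)
    finally have "real (D j * M) \<le> real (B j * N + M)" by (simp add: algebra_simps)
    then have 2: "D j * M \<le> B j * N + M" by (simp only: of_nat_le_iff)
    have cj: "code_nth c j = prod_encode (2 * B j, 2 * M)" using j by (simp add: c_def code_nth_eq)
    show ?thesis
      unfolding near_grid_point_def cj dj[OF j] prod_encode_inverse fst_conv snd_conv
      using 1 2 M(2) by (simp add: algebra_simps)
  qed
  moreover have "odd (code_nth a t)" using on by (simp add: a_def code_nth_eq nth_append)
  ultimately have auth: "authorizes t k i"
    using M(2) by (simp add: authorizes_def t i_def M_def)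
  define q :: rat where "q = of_nat A / of_nat N"
  have q: "real_of_rat q = real A / real N" by (simp add: q_def of_rat_divide)
  have "(i, q) \<in> command_set k"
  proof -
    have "\<bar>real_of_rat q\<bar> * real (cmd_scale t) \<le> real (cmd_value t)"
      unfolding q t using N(1) by simp
    then show ?thesis using auth unfolding command_set_def by blast
  qed
  moreover have "cantor_dist (true_commands x) (ball_word i) < ball_radius i"
    unfolding radius cantor_dist_less_iff using word by simp
  moreover have "\<bar>r j - ball_center i j\<bar> < ball_radius i" if "j < k" for j
  proof -
    have "real (B j) / real M \<le> r j" using B(1)[of j] M(1) by (simp add: pos_divide_le_eq)
    moreover have "r j < real (B j) / real M + 1 / real M" using B(2)[of j] M(1) by (simp add: field_simps)
    moreover have "1 / real M = ball_radius i" by (simp add: radius M(4) power_divide)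
    ultimately show ?thesis unfolding center[OF that] by linarith
  qed
  moreover define b where "b = J k (command_set k) (true_commands x, map r [0..<k])"
  moreover have "0 \<le> b" unfolding b_def by (rule J_bounds)
  ultimately have "min \<bar>real_of_rat q\<bar> 1 \<le> b"
    using J_le_iff[OF rc \<open>0 \<le> b\<close>, of k "command_set k" "true_commands x"] by auto
  moreover have "v \<le> min \<bar>real_of_rat q\<bar> 1" using AN(2) v r01(2)[of k] by (simp add: q)
  ultimately show ?thesis unfolding b_def by linarith
qed

lemma leftmost_eq_J_omega: "leftmost (P x) = J_omega command_set (true_commands x)"
proof (rule J_omega_unique)
  fix k
  have r: "leftmost (P x) \<in> P x" by (rule leftmost_in[OF compact_P nonempty])
  have "v \<le> J k (command_set k) (true_commands x, map (leftmost (P x)) [0..<k])" if "v < leftmost (P x) k" for v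
  proof (cases "0 \<le> v")
    case False
    then show ?thesis using J_bounds(1)[of k "command_set k" "(true_commands x, map (leftmost (P x)) [0..<k])"] by linarith
  qed (use command_set_complete that in blast)
  then have "leftmost (P x) k \<le> J k (command_set k) (true_commands x, map (leftmost (P x)) [0..<k])"
    by (rule dense_le)
  then show "leftmost (P x) k = J k (command_set k) (true_commands x, map (leftmost (P x)) [0..<k])"
    using command_set_sound[OF r] by (rule antisym)
qed

end

section \<open>From represented continua to sections over their names\<close>

text \<open>Only upper sets of the Vietoris topology enter: a closed ball around a point outside
  \<open>K x\<close> is avoided by \<open>K x\<close>, and then by \<open>K y\<close> for all
  \<open>y\<close> near \<open>x\<close>.\<close>

lemma closed_graph_crossing_continua:
  assumes K: "continuous_map euclidean crossing_continua (K :: 'a::topological_space \<Rightarrow> (nat \<Rightarrow> real) set)"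
  shows "closed {(x, w). w \<in> K x}"
proof -
  have Kx: "K x \<in> subcontinua (top_of_set hilbert_cube)" for x
    using K unfolding crossing_continua_def continuous_map_in_subtopology
    by (auto simp: continuous_map_def topspace_vietoris_subcontinua)
  then have comp: "compact (K x)" "K x \<subseteq> hilbert_cube" for x
    by (auto simp: subcontinua_def compactin_subtopology)
  have up: "open {x. K x \<subseteq> U}" if U: "open U" for U
  proof -
    have "openin (vietoris_subcontinua (top_of_set hilbert_cube)) {L \<in> subcontinua (top_of_set hilbert_cube). L \<subseteq> hilbert_cube \<inter> U}"
      unfolding vietoris_subcontinua_def using openin_open_Int[OF U, of hilbert_cube]
      by (intro topology_generated_by_Basis) blast
    then have "openin euclidean {x \<in> topspace euclidean. K x \<in> {L \<in> subcontinua (top_of_set hilbert_cube). L \<subseteq> hilbert_cube \<inter> U}}"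
      using K unfolding crossing_continua_def continuous_map_in_subtopology by (intro openin_continuous_map_preimage) auto
    moreover have "{x \<in> topspace euclidean. K x \<in> {L \<in> subcontinua (top_of_set hilbert_cube). L \<subseteq> hilbert_cube \<inter> U}} = {x. K x \<subseteq> U}"
      using Kx comp(2) by auto
    ultimately show ?thesis by simp
  qed
  have "\<exists>T. open T \<and> p \<in> T \<and> T \<subseteq> - {(x, w). w \<in> K x}" if p: "p \<in> - {(x, w). w \<in> K x}" for p
  proof -
    obtain x w where xw: "p = (x, w)" "w \<notin> K x" using p by (cases p) auto
    have "open (- K x)" using comp(1) by (intro open_Compl compact_imp_closed)
    then obtain e where e: "0 < e" "ball w e \<subseteq> - K x" using xw(2) by (meson ComplI open_contains_ball)
    define U where "U = - cball w (e / 2)"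
    have "cball w (e / 2) \<subseteq> ball w e" using e(1) by auto
    then have "K x \<subseteq> U" using e(2) by (auto simp: U_def)
    have "open U" unfolding U_def by (intro open_Compl closed_cball)
    show ?thesis
    proof (intro exI[of _ "{x. K x \<subseteq> U} \<times> ball w (e / 2)"] conjI)
      show "open ({x. K x \<subseteq> U} \<times> ball w (e / 2))" by (intro open_Times up \<open>open U\<close> open_ball)
      show "p \<in> {x. K x \<subseteq> U} \<times> ball w (e / 2)" using xw(1) \<open>K x \<subseteq> U\<close> e(1) by simp
      show "{x. K x \<subseteq> U} \<times> ball w (e / 2) \<subseteq> - {(x, w). w \<in> K x}" by (auto simp: U_def)
    qed
  qed
  then have "open (- {(x, w). w \<in> K x})" by (intro Topological_Spaces.openI)
  then show ?thesis by (simp only: closed_def)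
qed

text \<open>One index \<open>e\<close> serves all points. Coordinate 0 of a leftmost point gives
  back its name, from which the oracle is computed continuously, and the point itself becomes the
  component \<open>r\<close>; projection to \<open>r\<close> is the inverse, so there is a single
  piece.\<close>

lemma sigma_embedding_RSW_omega_CEA:
  assumes W: "standard_ce_enumeration W" and \<delta>: "total_cantor_representation crossing_continua \<delta>"
  obtains f where "sigma_embedding (top_of_set (RSW \<delta>)) (top_of_set (omega_CEA W)) f"
proof -
  obtain e where e: "W e = command_set"
    using W uniformly_ce_command_set unfolding standard_ce_enumeration_def by (metis mem_Collect_eq rangeE)
  have \<delta>c: "continuous_map (top_of_set cantor_set) crossing_continua \<delta>"
    using \<delta> unfolding total_cantor_representation_def by (elim conjE)
  define K where "K x = \<delta> (cantor_point x)" for x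
  have "continuous_map euclidean (top_of_set cantor_set) cantor_point"
    by (auto simp: continuous_map_in_subtopology continuous_on_cantor_point cantor_set_eq_range)
  from continuous_map_compose[OF this \<delta>c] have Kc: "continuous_map euclidean crossing_continua K"
    by (simp add: K_def[abs_def] comp_def)
  define P where "P x = K x \<inter> {z. z 0 = cantor_point x}" for x
  have Kprop: "K x \<subseteq> hilbert_cube" "connected (K x)" "\<exists>z\<in>K x. z 0 = 0" "\<exists>z\<in>K x. z 0 = 1" for x
  proof -
    have "K x \<in> topspace crossing_continua" using Kc by (auto simp: continuous_map_def)
    then show "K x \<subseteq> hilbert_cube" "connected (K x)" "\<exists>z\<in>K x. z 0 = 0" "\<exists>z\<in>K x. z 0 = 1"
      by (auto simp: crossing_continua_def topspace_vietoris_subcontinua subcontinua_def compactin_subtopology connectedin_subtopology)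
  qed
  interpret closed_family P
  proof
    have eq: "{(x, w). w \<in> P x} = {(x, w). w \<in> K x} \<inter> {p. snd p 0 = cantor_point (fst p)}"
      by (auto simp: P_def)
    have "closed {p :: (nat \<Rightarrow> bool) \<times> (nat \<Rightarrow> real). snd p 0 = cantor_point (fst p)}"
    proof (rule closed_Collect_eq)
      show "continuous_on UNIV (\<lambda>p :: (nat \<Rightarrow> bool) \<times> (nat \<Rightarrow> real). snd p 0)"
        by (rule continuous_on_coordinate[OF continuous_on_snd[OF continuous_on_id]])
      show "continuous_on UNIV (\<lambda>p :: (nat \<Rightarrow> bool) \<times> (nat \<Rightarrow> real). cantor_point (fst p))"
        by (rule continuous_on_compose2[OF continuous_on_cantor_point[of UNIV] continuous_on_fst[OF continuous_on_id]]) simp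
    qed
    then show "closed {(x, w). w \<in> P x}"
      unfolding eq by (intro closed_Int closed_graph_crossing_continua[OF Kc])
    fix x
    show "P x \<subseteq> hilbert_cube" using Kprop(1) by (auto simp: P_def)
    \<comment> \<open>A connected set meeting both opposite faces projects onto the whole interval,
      so its section over every name is nonempty.\<close>
    have "connected ((\<lambda>z. z 0) ` K x)"
      by (intro connected_continuous_image Kprop(2) continuous_on_subset[OF continuous_on_product_coordinates subset_UNIV])
    moreover have "0 \<in> (\<lambda>z. z 0) ` K x" "1 \<in> (\<lambda>z. z 0) ` K x" using Kprop(3,4)[of x] by force+
    ultimately have "{0..1} \<subseteq> (\<lambda>z. z 0) ` K x" by (rule connected_contains_Icc)
    then have "cantor_point x \<in> (\<lambda>z. z 0) ` K x" using cantor_point_bounds[of x] by auto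
    then show "P x \<noteq> {}" by (auto simp: P_def)
  qed
  define f where "f z = (e, true_commands (cantor_code (z 0)), z)" for z :: "nat \<Rightarrow> real"
  have RSW: "\<exists>x. z = leftmost (P x) \<and> z 0 = cantor_point x" if zR: "z \<in> RSW \<delta>" for z
  proof -
    obtain x where z: "z = leftmost (P x)"
      using zR unfolding RSW_def cantor_set_eq_range P_def K_def by auto
    then have "z \<in> P x" using leftmost_in[OF compact_P nonempty] by simp
    then show ?thesis using z by (auto simp: P_def)
  qed
  have "embedding_map (top_of_set (RSW \<delta>)) (top_of_set (omega_CEA W)) f"
  proof (rule embedding_map_top_of_set[where g = "\<lambda>p. snd (snd p)"])
    have "continuous_on (RSW \<delta>) (\<lambda>z. cantor_code (z 0))"
    proof (rule continuous_on_cantor_code_compose)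
      show "continuous_on (RSW \<delta>) (\<lambda>z. z 0)"
        by (rule continuous_on_coordinate[OF continuous_on_id])
      show "(\<lambda>z. z 0) ` RSW \<delta> \<subseteq> cantor_set" using RSW by (force simp: cantor_set_eq_range)
    qed
    then have "continuous_on (RSW \<delta>) (\<lambda>z. true_commands (cantor_code (z 0)))"
      by (rule continuous_on_compose2[OF continuous_on_true_commands]) simp
    then show "continuous_on (RSW \<delta>) f"
      unfolding f_def by (intro continuous_on_Pair continuous_on_const continuous_on_id)
    show "f ` RSW \<delta> \<subseteq> omega_CEA W"
    proof (rule image_subsetI)
      fix z assume "z \<in> RSW \<delta>"
      then obtain x where x: "z = leftmost (P x)" "z 0 = cantor_point x" using RSW by blast
      have z: "z = J_omega command_set (true_commands x)" using x(1) leftmost_eq_J_omega by simp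
      then have "z \<in> hilbert_cube" using J_omega_in_hilbert_cube by simp
      moreover have "f z = (e, true_commands x, z)" by (simp add: f_def x(2))
      ultimately show "f z \<in> omega_CEA W" using z e by (simp add: omega_CEA_def)
    qed
    show "continuous_on (f ` RSW \<delta>) (\<lambda>p. snd (snd p))" by (intro continuous_on_snd continuous_on_id)
  qed (simp add: f_def)
  then show thesis by (intro that embedding_imp_sigma_embedding)
qed

theorem theorem6p1:
  fixes W :: "nat \<Rightarrow> nat \<Rightarrow> (nat \<times> rat) set"
    and \<delta> :: "real \<Rightarrow> (nat \<Rightarrow> real) set"
    and RP :: "'a topology"
    and \<iota> :: "(nat \<Rightarrow> real) \<Rightarrow> 'a"
  assumes "standard_ce_enumeration W"
    and "total_cantor_representation crossing_continua \<delta>"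
    and "lelek_compactification (top_of_set (RSW \<delta>)) RP \<iota>"
  shows "sigma_homeomorphic_space (top_of_set (omega_CEA W)) (top_of_set (RSW \<delta>)) \<and>
         sigma_homeomorphic_space (top_of_set (RSW \<delta>)) RP \<and>
         sigma_homeomorphic_space (top_of_set (omega_CEA W)) RP"
proof -
  obtain f where f: "sigma_embedding (top_of_set (omega_CEA W)) (top_of_set (RSW \<delta>)) f"
    using sigma_embedding_omega_CEA_RSW[OF assms(2)] .
  obtain g where g: "sigma_embedding (top_of_set (RSW \<delta>)) (top_of_set (omega_CEA W)) g"
    using sigma_embedding_RSW_omega_CEA[OF assms(1,2)] .
  obtain c :: "(nat \<Rightarrow> bool) \<Rightarrow> nat \<Rightarrow> real" where "embedding_map euclidean (top_of_set (RSW \<delta>)) c"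
    using Cantor_space_embeds_in_RSW[OF assms(2)] .
  then obtain h where h: "sigma_embedding RP (top_of_set (RSW \<delta>)) h"
    using sigma_embedding_Lelek_compactification[OF assms(3)] by metis
  have i: "sigma_embedding (top_of_set (RSW \<delta>)) RP \<iota>"
    using assms(3) embedding_imp_sigma_embedding unfolding lelek_compactification_def by blast
  show ?thesis
    using sigma_embedding_Schroeder_Bernstein[OF f g] sigma_embedding_Schroeder_Bernstein[OF i h]
      sigma_embedding_Schroeder_Bernstein[OF sigma_embedding_compose[OF f i] sigma_embedding_compose[OF h g]]
    by blast
qed

end
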